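(* Let $1\le p_0<q_0\le\infty$, $0\le\alpha<\frac n{p_0}$ and $m\in\{0,1,2,\dots\}$. Suppose $T$ is a sublinear operator and both $T$ and $\mathcal M^{\#}_{T,q_0}$ are locally weak $L^{p_0}\to L^{\frac{p_0n}{n-\alpha p_0}}$ bounded. Then there exist $C_{m,n}>1$ and $0<\lambda_{m,n}<1$ such that for any $f,g\in L_c^\infty(\mathbb R^n)$ and $b\in L^1_{\rm loc}(\mathbb R^n)$ there exist a dyadic lattice $\mathscr D$ and a $\frac1{2\cdot3^n}$-sparse collection of cubes $\mathcal S\subset\mathscr D$ such that $$\int_{\mathbb R^n}|T_b^mf||g|\,dx\le C\Big(\sum_{Q\in\mathcal S}\langle|b-\langle b\rangle_Q|^m|f|\rangle_{p_0,Q}\langle|g|\rangle_{q_0',Q}|Q|^{1+\frac\alpha n}+\sum_{Q\in\mathcal S}\langle|f|\rangle_{p_0,Q}\langle|b-\langle b\rangle_Q|^m|g|\rangle_{q_0',Q}|Q|^{1+\frac\alpha n}\Big),$$ where $$C:=C_{m,n}\left(\varphi_{T,p_0,\alpha}(\lambda_{m,n})+\varphi_{\mathcal M^{\#}_{T,q_0},p_0,\alpha}(\lambda_{m,n})\right).$$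
   Context: Notation: a cube is a half-open cube $\prod_{i=1}^n[x_i-h,x_i+h)$, $h>0$; $\lambda Q=\prod[x_i-\lambda h,x_i+\lambda h)$. $\langle f\rangle_{r,Q}=\big(\frac1{|Q|}\int_Qf^r\big)^{1/r}$, $\langle f\rangle_Q=\langle f\rangle_{1,Q}$; $q_0'$ is the conjugate exponent. $L_c^\infty$ denotes bounded compactly supported functions. Sublinear: $|T(f+g)|\le|Tf|+|Tg|$ and $|T(cf)|=|c||Tf|$. Commutators: $T_b^0f=Tf$, and $T_b^mf(x)=T\big((b(x)-b(\cdot))^mf\big)(x)$ for $m\ge1$. Sharp grand maximal truncation operator: $\mathcal M^{\#}_{T,s}f(x)=\sup_{Q\ni x}\operatorname{osc}_s(T(f\chi_{\mathbb R^n\setminus3Q});Q)$, supremum over all cubes $Q\ni x$, where $\operatorname{osc}_s(h;Q)=\big(\frac1{|Q|^2}\int_{Q\times Q}|h(x')-h(x'')|^s\,dx'dx''\big)^{1/s}$ (essential supremum over $Q\times Q$ if $s=\infty$). Locally weak boundedness: for $1\le p_0<\infty$, $0\le\alpha<\frac n{p_0}$, an operator $T$ is locally weak $L^{p_0}\to L^{\frac{p_0n}{n-\alpha p_0}}$ bounded if there is a non-increasing function $\varphi_{T,p_0,\alpha}:(0,1)\to[0,\infty)$ such that $|\{x\in Q:|T(f\chi_Q)(x)|>\varphi_{T,p_0,\alpha}(\lambda)\langle|f|\rangle_{p_0,Q}|Q|^{\frac\alpha n}\}|\le\lambda|Q|$ for all $\lambda\in(0,1)$, all cubes $Q$ and all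 $f\in L^{p_0}(Q)$. The functions $\varphi_{T,p_0,\alpha}$, $\varphi_{\mathcal M^{\#}_{T,q_0},p_0,\alpha}$ in the claim are such functions for $T$ and $\mathcal M^{\#}_{T,q_0}$. The constants $C_{m,n},\lambda_{m,n}$ depend only on $m$ and $n$. Dyadic lattice: for a cube $Q_0$, $\mathscr D(Q_0)$ is the set of cubes obtained by repeated subdivision of $Q_0$ and its descendants into $2^n$ congruent subcubes. A dyadic lattice $\mathscr D$ is a collection of cubes with: (i) $Q\in\mathscr D\Rightarrow\mathscr D(Q)\subset\mathscr D$; (ii) for all $Q,Q'\in\mathscr D$ there is $R\in\mathscr D$ with $Q,Q'\in\mathscr D(R)$; (iii) every compact set is contained in some $Q\in\mathscr D$. A family $\mathcal S$ of cubes is $\eta$-sparse ($0<\eta<1$) if there are pairwise disjoint measurable sets $E_Q\subset Q$, $Q\in\mathcal S$, with $|E_Q|\ge\eta|Q|$. *)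

theory Defs
  imports "HOL-Analysis.Analysis" "HOL-Probability.Essential_Supremum"
begin

text \<open>
  Functions on \<open>\<real>\<^sup>n\<close> take values in a type of sort \<open>{real_normed_field, euclidean_space}\<close>,
  which covers the real and the complex numbers (and, up to isomorphism, nothing else). Measure
  and measurability always refer to Lebesgue measure on the Lebesgue \<open>\<sigma>\<close>-algebra.
\<close>

subsection \<open>Cubes, dyadic lattices, sparse families\<close>

definition cube :: "real ^ 'n \<Rightarrow> real \<Rightarrow> (real ^ 'n) set" where
  "cube c h = {y. \<forall>i. c $ i - h \<le> y $ i \<and> y $ i < c $ i + h}"

definition is_cube :: "(real ^ 'n) set \<Rightarrow> bool" where
  "is_cube Q \<longleftrightarrow> (\<exists>c h. 0 < h \<and> Q = cube c h)"

text \<open>The \<open>2\<^sup>n\<close> congruent subcubes of \<open>cube c h\<close> have half side \<open>h / 2\<close> and a centre all of whose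
  coordinates differ from those of \<open>c\<close> by \<open>\<plusminus> h / 2\<close>. The cube \<open>Q\<^sub>0\<close> belongs to \<open>\<D>(Q\<^sub>0)\<close>.\<close>

inductive_set dyadic_cubes :: "(real ^ 'n) set \<Rightarrow> (real ^ 'n) set set"
  for Q\<^sub>0 :: "(real ^ 'n) set" where
  self: "Q\<^sub>0 \<in> dyadic_cubes Q\<^sub>0"
| subdivide: "\<lbrakk>cube c h \<in> dyadic_cubes Q\<^sub>0; 0 < h; \<forall>i. d $ i = c $ i - h / 2 \<or> d $ i = c $ i + h / 2\<rbrakk>
    \<Longrightarrow> cube d (h / 2) \<in> dyadic_cubes Q\<^sub>0"

definition dyadic_lattice :: "(real ^ 'n) set set \<Rightarrow> bool" where
  "dyadic_lattice \<D> \<longleftrightarrow>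
     (\<forall>Q\<in>\<D>. is_cube Q) \<and>
     (\<forall>Q\<in>\<D>. dyadic_cubes Q \<subseteq> \<D>) \<and>
     (\<forall>Q\<in>\<D>. \<forall>Q'\<in>\<D>. \<exists>R\<in>\<D>. Q \<in> dyadic_cubes R \<and> Q' \<in> dyadic_cubes R) \<and>
     (\<forall>K. compact K \<longrightarrow> (\<exists>Q\<in>\<D>. K \<subseteq> Q))"

definition sparse_family :: "real \<Rightarrow> (real ^ 'n) set set \<Rightarrow> bool" where
  "sparse_family \<eta> \<S> \<longleftrightarrow> 0 < \<eta> \<and> \<eta> < 1 \<and> (\<forall>Q\<in>\<S>. is_cube Q) \<and>
     (\<exists>E. disjoint_family_on E \<S> \<and>
       (\<forall>Q\<in>\<S>. E Q \<subseteq> Q \<and> E Q \<in> sets lebesgue \<and> measure lebesgue (E Q) \<ge> \<eta> * measure lebesgue Q))"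


subsection \<open>Averages, oscillations, function spaces\<close>

text \<open>Only used for exponents \<open>r > 0\<close>, so that \<open>\<infinity>\<^sup>r = \<infinity>\<close>.\<close>

definition ennpow :: "ennreal \<Rightarrow> real \<Rightarrow> ennreal" where
  "ennpow x r = (if x = \<infinity> then \<infinity> else ennreal (enn2real x powr r))"

text \<open>\<open>\<langle>F\<rangle>\<^bsub>r,Q\<^esub>\<close> for a nonnegative function \<open>F\<close>; it may be infinite.\<close>

definition avg :: "real \<Rightarrow> (real ^ 'n) set \<Rightarrow> (real ^ 'n \<Rightarrow> real) \<Rightarrow> ennreal" where
  "avg r Q F =
     ennpow ((\<integral>\<^sup>+x\<in>Q. ennreal (F x powr r) \<partial>lebesgue) / emeasure lebesgue Q) (1 / r)"

text \<open>\<open>\<langle>b\<rangle>\<^sub>Q\<close> for a scalar valued function \<open>b\<close>.\<close>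

definition mean :: "(real ^ 'n) set \<Rightarrow> (real ^ 'n \<Rightarrow> 'k::{real_normed_field, euclidean_space}) \<Rightarrow> 'k" where
  "mean Q b = (1 / measure lebesgue Q) *\<^sub>R (LINT x:Q|lebesgue. b x)"

text \<open>Conjugate exponent of \<open>1 < q \<le> \<infinity>\<close>.\<close>

definition conj_exponent :: "ennreal \<Rightarrow> real" where
  "conj_exponent q = (if q = \<infinity> then 1 else enn2real q / (enn2real q - 1))"

definition osc :: "ennreal \<Rightarrow> (real ^ 'n) set \<Rightarrow> (real ^ 'n \<Rightarrow> 'k::{real_normed_field, euclidean_space}) \<Rightarrow> ennreal" where
  "osc s Q h =
     (if s = \<infinity>
      then esssup (lebesgue_on Q \<Otimes>\<^sub>M lebesgue_on Q) (\<lambda>(x, y). ennreal (norm (h x - h y)))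
      else ennpow ((\<integral>\<^sup>+(x, y). ennreal (norm (h x - h y) powr enn2real s)
                      \<partial>(lebesgue_on Q \<Otimes>\<^sub>M lebesgue_on Q)) / (emeasure lebesgue Q)\<^sup>2) (1 / enn2real s))"

definition cutoff :: "(real ^ 'n) set \<Rightarrow> (real ^ 'n \<Rightarrow> 'k::real_normed_field) \<Rightarrow> real ^ 'n \<Rightarrow> 'k" where
  "cutoff A f = (\<lambda>x. if x \<in> A then f x else 0)"

definition Lp_on :: "real \<Rightarrow> (real ^ 'n) set \<Rightarrow> (real ^ 'n \<Rightarrow> 'k::{real_normed_field, euclidean_space}) set" where
  "Lp_on p A = {f. f \<in> borel_measurable (lebesgue_on A) \<and>
                   (\<integral>\<^sup>+x\<in>A. ennreal (norm (f x) powr p) \<partial>lebesgue) < \<infinity>}"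

definition Lp_c :: "real \<Rightarrow> (real ^ 'n \<Rightarrow> 'k::{real_normed_field, euclidean_space}) set" where
  "Lp_c p = {f \<in> Lp_on p UNIV. compact (closure {x. f x \<noteq> 0})}"

definition Linf_c :: "(real ^ 'n \<Rightarrow> 'k::{real_normed_field, euclidean_space}) set" where
  "Linf_c = {f. f \<in> borel_measurable lebesgue \<and> (\<exists>B. AE x in lebesgue. norm (f x) \<le> B) \<and>
                compact (closure {x. f x \<noteq> 0})}"

definition locally_integrable :: "(real ^ 'n \<Rightarrow> 'k::{real_normed_field, euclidean_space}) \<Rightarrow> bool" where
  "locally_integrable b \<longleftrightarrow> (\<forall>K. compact K \<longrightarrow> set_integrable lebesgue K b)"


subsection \<open>Operators\<close>

text \<open>
  HOL functions being total, an operator is a total map on functions about which nothing is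
  assumed outside a domain \<open>X\<close>. Sublinearity is pointwise everywhere: for a nonlinear \<open>T\<close> the
  commutator evaluates at \<open>x\<close> a function which itself depends on \<open>x\<close>, hence \<open>T f\<close> has to be a
  genuine function and not merely an almost everywhere class.
\<close>

definition sublinear_operator_on ::
  "(real ^ 'n \<Rightarrow> 'k::{real_normed_field, euclidean_space}) set
    \<Rightarrow> ((real ^ 'n \<Rightarrow> 'k) \<Rightarrow> real ^ 'n \<Rightarrow> 'k) \<Rightarrow> bool" where
  "sublinear_operator_on X T \<longleftrightarrow>
     (\<forall>f\<in>X. T f \<in> borel_measurable lebesgue) \<and>
     (\<forall>f\<in>X. \<forall>g\<in>X. \<forall>x. norm (T (\<lambda>y. f y + g y) x) \<le> norm (T f x) + norm (T g x)) \<and>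
     (\<forall>f\<in>X. \<forall>c x. norm (T (\<lambda>y. c * f y) x) = norm c * norm (T f x))"

text \<open>For \<open>m = 0\<close> this is \<open>T f\<close>.\<close>

definition commutator ::
  "((real ^ 'n \<Rightarrow> 'k::{real_normed_field, euclidean_space}) \<Rightarrow> real ^ 'n \<Rightarrow> 'k)
    \<Rightarrow> (real ^ 'n \<Rightarrow> 'k) \<Rightarrow> nat \<Rightarrow> (real ^ 'n \<Rightarrow> 'k) \<Rightarrow> real ^ 'n \<Rightarrow> 'k" where
  "commutator T b m f = (\<lambda>x. T (\<lambda>y. (b x - b y) ^ m * f y) x)"

text \<open>The cubes \<open>Q\<close> containing \<open>x\<close> are parametrised by centre and half side, so \<open>3Q\<close> is \<open>cube c (3 * h)\<close>.\<close>

definition sharp_grand_maximal ::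
  "((real ^ 'n \<Rightarrow> 'k::{real_normed_field, euclidean_space}) \<Rightarrow> real ^ 'n \<Rightarrow> 'k)
    \<Rightarrow> ennreal \<Rightarrow> (real ^ 'n \<Rightarrow> 'k) \<Rightarrow> real ^ 'n \<Rightarrow> ennreal" where
  "sharp_grand_maximal T s f x =
     (SUP (c, h) \<in> {(c, h). 0 < h \<and> x \<in> cube c h}.
        osc s (cube c h) (T (cutoff (- cube c (3 * h)) f)))"

text \<open>
  \<open>U f\<close> stands for the modulus of the operator in question, which allows infinite values; the
  dependence of \<open>\<phi>\<close> on the operator, \<open>p\<^sub>0\<close> and \<open>\<alpha>\<close> is expressed by this predicate. The
  measurability clause is there because \<open>emeasure\<close> vanishes on non-measurable sets; for the sharp
  grand maximal truncation operator it is automatic, unions of cubes being measurable.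
\<close>

definition locally_weak_bounded ::
  "real \<Rightarrow> real \<Rightarrow> ((real ^ 'n \<Rightarrow> 'k::{real_normed_field, euclidean_space}) \<Rightarrow> real ^ 'n \<Rightarrow> ennreal)
    \<Rightarrow> (real \<Rightarrow> real) \<Rightarrow> bool" where
  "locally_weak_bounded p\<^sub>0 \<alpha> U \<phi> \<longleftrightarrow>
     (\<forall>t\<in>{0<..<1}. 0 \<le> \<phi> t) \<and> antimono_on {0<..<1} \<phi> \<and>
     (\<forall>t\<in>{0<..<1}. \<forall>Q. is_cube Q \<longrightarrow> (\<forall>f\<in>Lp_on p\<^sub>0 Q.
        let A = {x \<in> Q. U (cutoff Q f) x >
                   ennreal (\<phi> t) * avg p\<^sub>0 Q (\<lambda>x. norm (f x))
                     * ennreal (measure lebesgue Q powr (\<alpha> / real CARD('n)))}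
        in A \<in> sets lebesgue \<and> emeasure lebesgue A \<le> ennreal t * emeasure lebesgue Q))"

text \<open>
  The constant \<open>c \<ge> 0\<close> times an expression in \<open>[0, \<infinity>]\<close> on the right-hand side of an estimate. It
  differs from the product of \<open>ennreal\<close> only for \<open>c = 0\<close> and \<open>x = \<infinity>\<close>, where the estimate is read
  as asserting nothing. For merely locally integrable \<open>b\<close> the function \<open>(b(x) - b)\<^sup>m f\<close> can fail
  to be in \<open>L\<^sup>p\<close> for \<open>p = p\<^sub>0\<close>, in which case nothing at all is known about \<open>T\<close> on it, even if
  \<open>c = 0\<close>.
\<close>

definition const_times :: "real \<Rightarrow> ennreal \<Rightarrow> ennreal" where
  "const_times c x = (if x = \<infinity> then \<infinity> else ennreal c * x)"

end

theory Submission
  imports Defs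
begin

text \<open>
  Choose a cube \<open>Q\<^sub>0\<close> containing the supports of \<open>f\<close> and \<open>g\<close>. For a dyadic subcube \<open>Q\<close> put
  \<open>c = \<langle>b\<rangle>\<^bsub>3Q\<^esub>\<close> and \<open>F\<^sub>k = (c - b)\<^sup>k f\<close>; sublinearity and the binomial theorem reduce \<open>T\<^sub>b\<^sup>m\<close> to the functions
  \<open>T (F\<^sub>k \<chi>)\<close> with weights \<open>\<bar>b - c\<bar>\<^sup>m\<^sup>-\<^sup>k\<close>. The set where \<open>T (F\<^sub>k \<chi>\<^bsub>3Q\<^esub>)\<close>, its sharp grand maximal
  truncation or a local average of \<open>F\<^sub>k\<close> is large has small measure, so a stopping time yields disjoint
  cubes \<open>P \<subset> Q\<close> covering it almost everywhere with total measure at most \<open>\<bar>Q\<bar> / 2\<close>. Outside these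
  cubes the bound is pointwise. On \<open>P\<close> the part of \<open>f\<close> in \<open>3Q - 3P\<close> is controlled by its oscillation
  and its values on a large portion of \<open>P\<close>, and the part in \<open>3P\<close> is passed on to the next
  generation. Since the total measure of the generations decays, the recursion terminates almost
  everywhere. The mixed terms \<open>\<langle>\<bar>b - c\<bar>\<^sup>k f\<rangle> \<langle>\<bar>b - c\<bar>\<^sup>m\<^sup>-\<^sup>k g\<rangle>\<close> are interpolated between the two extreme
  ones. The tripled cubes are distributed over \<open>3\<^sup>n\<close> dyadic lattices, and the lattice with the largest sum
  is kept. If \<open>b\<^sup>m f\<close> is not in \<open>L\<^sup>p\<close>, a single cube already makes the right-hand side infinite.
\<close>

text \<open>Otherwise the simplifier turns the Lebesgue measure of a set into the Borel measure of its main part.\<close>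

declare emeasure_completion [simp del] measure_completion [simp del]

text \<open>\<open>T\<close> is only sublinear, and the commutator at x applies it to a function
  that itself depends on x. Values at two points are therefore not comparable, and the oscillation
  hypothesis says nothing about the commutator directly. Expanding around a constant c gives the
  fixed functions F_k, to which it does apply. Only the pieces that a generation gives off are
  expanded. What is passed on to P is the unexpanded (b(x) - b)^m f on 3P, so every cube may use its
  own constant.

  One exceptional set has to serve all k \<le> m, which brings m into the constants. With the weak
  bounds taken at 1/(16 (m+1) 6^n), and averages called large beyond A = 8 (m+1) 18^n times the one
  over 3Q, this set has measure at most |Q|/(4 2^n). Selecting cubes of density above 1/(2 2^n)
  costs a factor 2 2^n and leaves |Q|/2. Passing from Q to 3Q turns the proportion 1/2 into the
  sparseness 1/(2 3^n). The final constant collects 3^n lattices, 2^m from the binomial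
  coefficients, a factor 2 each from the choice of \<tau> and from the interpolation, and 5 + A from
  the local estimate.\<close>

section \<open>Half-open cubes and their Lebesgue measure\<close>

lemma cube_center_mem: "0 < h \<Longrightarrow> c \<in> cube c h"
  by (simp add: cube_def)

text \<open>Subdivision, lattices and families of triples treat cubes as sets, while computations
  need centres and half sides. The latter are recovered from the lower and upper end of each
  coordinate.\<close>

lemma cube_inject:
  assumes "0 < h" "0 < h'" "cube c h = cube c' h'"
  shows "c = c'" "h = h'"
proof -
  have lower: "c' $ i - h' \<le> c $ i - h" and upper: "c $ i + h \<le> c' $ i + h'"
    if eq: "cube c h = cube c' h'" and "0 < h" "0 < h'" for c c' :: "real ^ 'n" and h h' i
  proof -
    have "(\<chi> j. c $ j - h) \<in> cube c h"
      using that(2,3) by (simp add: cube_def)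
    then have "(\<chi> j. c $ j - h) \<in> cube c' h'"
      unfolding eq .
    then show "c' $ i - h' \<le> c $ i - h"
      by (simp add: cube_def)
    show "c $ i + h \<le> c' $ i + h'"
    proof (rule dense_ge)
      fix t assume t: "c' $ i + h' < t"
      show "c $ i + h \<le> t"
      proof (rule ccontr)
        assume "\<not> c $ i + h \<le> t"
        \<comment> \<open>The maximum with \<open>c $ i\<close> keeps the test point above the lower
          face when \<open>t\<close> is small.\<close>
        then have "(\<chi> j. if j = i then max t (c $ i) else c $ j) \<in> cube c h"
          using that(2,3) by (simp add: cube_def)
        then have "(\<chi> j. if j = i then max t (c $ i) else c $ j) \<in> cube c' h'"
          unfolding eq .
        then have "max t (c $ i) < c' $ i + h'"
          by (auto simp: cube_def dest!: spec[of _ i])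
        with t show False by simp
      qed
    qed
  qed
  have *: "c' $ i - h' = c $ i - h \<and> c $ i + h = c' $ i + h'" for i
    using lower[OF assms(3,1,2), of i] upper[OF assms(3,1,2), of i]
      lower[OF assms(3)[symmetric] assms(2,1), of i] upper[OF assms(3)[symmetric] assms(2,1), of i]
    by simp
  from *[of undefined] show "h = h'" by linarith
  have "c $ i = c' $ i" for i using *[of i] by linarith
  then show "c = c'" by (simp add: vec_eq_iff)
qed

lemma cube_sandwich:
  "box (\<chi> i. c $ i - h) (\<chi> i. c $ i + h) \<subseteq> cube c h" "cube c h \<subseteq> cbox (\<chi> i. c $ i - h) (\<chi> i. c $ i + h)"
  by (auto simp: cube_def mem_box_cart less_imp_le)

lemma cube_borel: "cube c h \<in> sets borel"
proof -
  have "cube c h = (\<Inter>i. {y. c $ i - h \<le> y $ i} \<inter> {y. y $ i < c $ i + h})"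
    by (auto simp: cube_def)
  also have "\<dots> \<in> sets borel"
    by (intro sets.countable_INT'' sets.Int borel_closed borel_open)
       (auto intro!: closed_Collect_le open_Collect_less continuous_intros)
  finally show ?thesis .
qed

lemma cube_lebesgue [measurable, simp]: "cube c h \<in> sets lebesgue"
  using cube_borel by (rule sets_completionI_sets[of _ lborel, simplified])

lemma emeasure_cube:
  fixes c :: "real ^ 'n"
  assumes "0 < h"
  shows "emeasure lebesgue (cube c h) = ennreal ((2 * h) ^ CARD('n))"
proof -
  let ?a = "\<chi> i. c $ i - h" and ?b = "\<chi> i. c $ i + h"
  have le: "?a \<bullet> b \<le> ?b \<bullet> b" if "b \<in> Basis" for b
    using that assms by (auto simp: Basis_vec_def inner_axis)
  have prod: "(\<Prod>b\<in>Basis. (?b - ?a) \<bullet> b) = (2 * h) ^ CARD('n)"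
  proof -
    have "(\<Prod>b\<in>Basis. (?b - ?a) \<bullet> b) = (\<Prod>b\<in>(Basis :: (real^'n) set). 2 * h)"
      by (rule prod.cong) (auto simp: Basis_vec_def inner_axis)
    then show ?thesis by simp
  qed
  \<comment> \<open>The open and the closed box have the same measure, which leaves only one value
    for the cube between them.\<close>
  have "emeasure lborel (box ?a ?b) \<le> emeasure lborel (cube c h)"
    "emeasure lborel (cube c h) \<le> emeasure lborel (cbox ?a ?b)"
    by (intro emeasure_mono; simp add: cube_sandwich cube_borel)+
  then have "emeasure lborel (cube c h) = ennreal ((2 * h) ^ CARD('n))"
    using le prod by (simp add: emeasure_lborel_box emeasure_lborel_cbox antisym)
  then show ?thesis by (simp add: cube_borel emeasure_completion)
qed

lemma measure_cube:
  fixes c :: "real ^ 'n"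
  shows "0 < h \<Longrightarrow> measure lebesgue (cube c h) = (2 * h) ^ CARD('n)"
  by (simp add: measure_def emeasure_cube)

lemma cube_lmeasurable: "0 < h \<Longrightarrow> cube c h \<in> lmeasurable"
  by (rule fmeasurableI) (auto simp: emeasure_cube)

lemma measure_triple_cube:
  fixes c :: "real ^ 'n"
  assumes "0 < h"
  shows "measure lebesgue (cube c (3 * h)) = 3 ^ CARD('n) * measure lebesgue (cube c h)"
proof -
  have "(2 * (3 * h)) ^ CARD('n) = (3 * (2 * h)) ^ CARD('n)" by (simp add: mult_ac)
  also have "\<dots> = 3 ^ CARD('n) * (2 * h) ^ CARD('n)" by (rule power_mult_distrib)
  finally show ?thesis using assms by (simp only: measure_cube mult_pos_pos zero_less_numeral)
qed

lemma measure_cube_mono: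
  fixes c c' :: "real ^ 'n"
  shows "0 < h \<Longrightarrow> 0 < h' \<Longrightarrow> h \<le> h' \<Longrightarrow> measure lebesgue (cube c h) \<le> measure lebesgue (cube c' h')"
  by (simp add: measure_cube power_mono)

lemma cube_subset_triple: "0 < h \<Longrightarrow> cube c h \<subseteq> cube c (3 * h)"
  unfolding cube_def by (auto simp: le_less_trans less_le_trans) (smt (verit))+

lemma compact_subset_cube:
  assumes "compact K"
  obtains h where "0 < h" "K \<subseteq> cube 0 h"
proof -
  obtain B where B: "0 < B" "\<And>x. x \<in> K \<Longrightarrow> norm x \<le> B"
    using compact_imp_bounded[OF assms] bounded_pos by blast
  have "K \<subseteq> cube 0 (B + 1)"
  proof
    fix x assume x: "x \<in> K"
    have "\<bar>x $ i\<bar> < B + 1" for i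
      using B(2)[OF x] component_le_norm_cart[of x i] by linarith
    then show "x \<in> cube 0 (B + 1)"
      by (simp add: cube_def) (smt (verit))
  qed
  with B(1) show ?thesis by (intro that[of "B + 1"]) auto
qed

subsection \<open>The dyadic grid generated by a cube\<close>

text \<open>Coordinates in units of the side length 2h / 2^k, counted from the lower corner of
  \<open>cube c h\<close>; the cubes of level k are the fibres of this map. The grid fills the whole
  space, so that cubes at the boundary of \<open>cube c h\<close> have all their neighbours.\<close>

definition grid_index :: "real ^ 'n \<Rightarrow> real \<Rightarrow> nat \<Rightarrow> real ^ 'n \<Rightarrow> int ^ 'n" where
  "grid_index c h k y = (\<chi> i. \<lfloor>2 ^ k * ((y $ i - (c $ i - h)) / (2 * h))\<rfloor>)"

definition grid_center :: "real ^ 'n \<Rightarrow> real \<Rightarrow> nat \<Rightarrow> int ^ 'n \<Rightarrow> real ^ 'n" where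
  "grid_center c h k z = (\<chi> i. c $ i - h + h / 2 ^ k * (2 * of_int (z $ i) + 1))"

definition grid_cube :: "real ^ 'n \<Rightarrow> real \<Rightarrow> nat \<Rightarrow> int ^ 'n \<Rightarrow> (real ^ 'n) set" where
  "grid_cube c h k z = cube (grid_center c h k z) (h / 2 ^ k)"

lemma grid_index_bounds:
  assumes "0 < h"
  shows "a \<le> grid_index c h k y $ i \<longleftrightarrow> c $ i - h + h / 2 ^ k * (2 * of_int a) \<le> y $ i"
    "grid_index c h k y $ i < a \<longleftrightarrow> y $ i < c $ i - h + h / 2 ^ k * (2 * of_int a)"
proof -
  show "a \<le> grid_index c h k y $ i \<longleftrightarrow> c $ i - h + h / 2 ^ k * (2 * of_int a) \<le> y $ i"
    using assms by (simp add: grid_index_def le_floor_iff field_simps)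
  then show "grid_index c h k y $ i < a \<longleftrightarrow> y $ i < c $ i - h + h / 2 ^ k * (2 * of_int a)"
    by (simp add: not_le[symmetric])
qed

lemma mem_grid_cube:
  assumes "0 < h"
  shows "y \<in> grid_cube c h k z \<longleftrightarrow> grid_index c h k y = z"
proof -
  have "y \<in> grid_cube c h k z \<longleftrightarrow> (\<forall>i. z $ i \<le> grid_index c h k y $ i \<and> grid_index c h k y $ i < z $ i + 1)"
    unfolding grid_index_bounds[OF assms] by (simp add: grid_cube_def cube_def grid_center_def algebra_simps)
  also have "\<dots> \<longleftrightarrow> grid_index c h k y = z"
    by (auto simp: vec_eq_iff) (metis add_leE order_antisym zle_add1_eq_le)+
  finally show ?thesis .
qed

lemma mem_grid_cube_triple:
  assumes "0 < h"
  shows "y \<in> cube (grid_center c h k z) (3 * (h / 2 ^ k)) \<longleftrightarrow>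
    (\<forall>i. z $ i - 1 \<le> grid_index c h k y $ i \<and> grid_index c h k y $ i \<le> z $ i + 1)"
proof -
  have "(\<forall>i. z $ i - 1 \<le> grid_index c h k y $ i \<and> grid_index c h k y $ i \<le> z $ i + 1) \<longleftrightarrow>
    (\<forall>i. z $ i - 1 \<le> grid_index c h k y $ i \<and> grid_index c h k y $ i < z $ i + 2)"
    by (smt (verit))
  also have "\<dots> \<longleftrightarrow> y \<in> cube (grid_center c h k z) (3 * (h / 2 ^ k))"
    unfolding grid_index_bounds[OF assms] by (simp add: cube_def grid_center_def algebra_simps)
  finally show ?thesis by simp
qed

text \<open>Taking floors commutes with division by 2^j, so passing to an ancestor is integer
  division of the index. Negative indices obey the same rule because \<open>div\<close> rounds
  down.\<close>

lemma grid_index_div: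
  "grid_index c h (k + j) y $ i div 2 ^ j = grid_index c h k y $ i"
proof -
  define t where "t = (y $ i - (c $ i - h)) / (2 * h)"
  let ?u = "2 ^ (k + j) * t"
  have "\<lfloor>?u\<rfloor> div 2 ^ j = \<lfloor>?u / of_int (2 ^ j)\<rfloor>"
    by (subst floor_divide_real_eq_div) auto
  also have "?u / of_int (2 ^ j) = 2 ^ k * t"
    unfolding power_add of_int_power of_int_numeral by simp
  finally show ?thesis by (simp add: grid_index_def t_def)
qed

lemma grid_cube_mono:
  assumes "0 < h" "k \<le> l" "grid_cube c h k z \<inter> grid_cube c h l w \<noteq> {}"
  shows "grid_cube c h l w \<subseteq> grid_cube c h k z"
proof
  fix y assume y: "y \<in> grid_cube c h l w"
  from assms(3) obtain x where x: "x \<in> grid_cube c h k z" "x \<in> grid_cube c h l w" by blast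
  have eq: "grid_index c h l y = grid_index c h l x"
    using x y by (simp add: mem_grid_cube[OF assms(1)])
  obtain j where l: "l = k + j" using assms(2) le_Suc_ex by blast
  have "grid_index c h k y = grid_index c h k x"
    using eq unfolding l vec_eq_iff by (metis grid_index_div)
  then show "y \<in> grid_cube c h k z"
    using x by (simp add: mem_grid_cube[OF assms(1)])
qed

text \<open>A shift of the fine index by 1 is at most a shift by 2^j, so it moves the coarse index
  by at most 1. Hence tripling respects inclusion within the grid, and the triples of a family are
  covered by those of its maximal cubes.\<close>

lemma grid_triple_mono:
  assumes "0 < h" "k \<le> l" "grid_cube c h l w \<subseteq> grid_cube c h k z"
  shows "cube (grid_center c h l w) (3 * (h / 2 ^ l)) \<subseteq> cube (grid_center c h k z) (3 * (h / 2 ^ k))"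
proof
  fix y assume y: "y \<in> cube (grid_center c h l w) (3 * (h / 2 ^ l))"
  obtain j where l: "l = k + j" using assms(2) le_Suc_ex by blast
  have "grid_center c h l w \<in> grid_cube c h l w"
    unfolding grid_cube_def using assms(1) by (intro cube_center_mem) auto
  then have cw: "grid_index c h l (grid_center c h l w) = w"
    and cz: "grid_index c h k (grid_center c h l w) = z"
    using assms(3) by (auto simp: mem_grid_cube[OF assms(1)])
  have zw: "w $ i div 2 ^ j = z $ i" for i
    using grid_index_div[of c h k j "grid_center c h l w" i] cw cz by (simp add: l)
  have *: "z $ i - 1 \<le> a div 2 ^ j \<and> a div 2 ^ j \<le> z $ i + 1" if "w $ i - 1 \<le> a" "a \<le> w $ i + 1" for a i
  proof -
    have p: "(1 :: int) \<le> 2 ^ j" by simp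
    have "w $ i - 2 ^ j \<le> a" "a \<le> w $ i + 2 ^ j" using that p by linarith+
    then have "(w $ i - 2 ^ j) div 2 ^ j \<le> a div 2 ^ j" "a div 2 ^ j \<le> (w $ i + 2 ^ j) div 2 ^ j"
      by (simp_all only: zdiv_mono1 zero_less_power zero_less_numeral)
    moreover have "(w $ i - 2 ^ j) div 2 ^ j = z $ i - 1" "(w $ i + 2 ^ j) div 2 ^ j = z $ i + 1"
      using zw[of i] div_mult_self1[of "2 ^ j" "w $ i" "-1"] by auto
    ultimately show ?thesis by simp
  qed
  show "y \<in> cube (grid_center c h k z) (3 * (h / 2 ^ k))"
    using y unfolding mem_grid_cube_triple[OF assms(1)] l
    by (metis * grid_index_div)
qed

lemma grid_cube_0: "0 < h \<Longrightarrow> grid_cube c h 0 0 = cube c h"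
  by (simp add: grid_cube_def grid_center_def vec_eq_iff[symmetric])

lemma grid_cube_disjoint:
  "0 < h \<Longrightarrow> z \<noteq> w \<Longrightarrow> grid_cube c h k z \<inter> grid_cube c h k w = {}"
  by (auto simp: mem_grid_cube)

lemma grid_cube_subset_open:
  fixes x :: "real ^ 'n"
  assumes "0 < h" "open U" "x \<in> U"
  shows "\<exists>k. grid_cube c h k (grid_index c h k x) \<subseteq> U"
proof -
  obtain e where e: "0 < e" "ball x e \<subseteq> U" using assms openE by blast
  let ?B = "real CARD('n) * (2 * h)"
  have "(\<lambda>k. ?B / 2 ^ k) \<longlonglongrightarrow> 0"
    by (rule LIMSEQ_divide_realpow_zero) simp
  then have "eventually (\<lambda>k. ?B / 2 ^ k < e) sequentially"
    using e(1) by (simp add: order_tendsto_iff)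
  then obtain k where k: "?B / 2 ^ k < e"
    by (auto simp: eventually_sequentially)
  have "grid_cube c h k (grid_index c h k x) \<subseteq> ball x e"
  proof
    fix y assume y: "y \<in> grid_cube c h k (grid_index c h k x)"
    have x: "x \<in> grid_cube c h k (grid_index c h k x)" by (simp add: mem_grid_cube assms)
    have "\<bar>(x - y) $ i\<bar> \<le> 2 * h / 2 ^ k" for i
      using x y unfolding grid_cube_def cube_def by (auto dest!: spec[of _ i])
    then have "(\<Sum>i\<in>UNIV. \<bar>(x - y) $ i\<bar>) \<le> (\<Sum>i\<in>(UNIV :: 'n set). 2 * h / 2 ^ k)"
      by (intro sum_mono) auto
    then have "norm (x - y) \<le> ?B / 2 ^ k"
      using norm_le_l1_cart[of "x - y"] by simp
    with k show "y \<in> ball x e" by (simp add: dist_norm)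
  qed
  with e show ?thesis by blast
qed

section \<open>Maximal cubes of a family in the grid\<close>

definition maximal_indices :: "real ^ 'n \<Rightarrow> real \<Rightarrow> (nat \<times> (int ^ 'n)) set \<Rightarrow> (nat \<times> (int ^ 'n)) set" where
  "maximal_indices c h V =
    {(k, z) \<in> V. \<forall>(l, w) \<in> V. l < k \<longrightarrow> grid_cube c h l w \<inter> grid_cube c h k z = {}}"

lemma maximal_indices_subset: "maximal_indices c h V \<subseteq> V"
  by (auto simp: maximal_indices_def)

lemma maximal_indices_disjoint:
  assumes "0 < h"
  shows "disjoint_family_on (\<lambda>(k, z). grid_cube c h k z) (maximal_indices c h V)"
proof -
  have "grid_cube c h k z \<inter> grid_cube c h l w = {}"
    if "(k, z) \<in> maximal_indices c h V" "(l, w) \<in> maximal_indices c h V" "(k, z) \<noteq> (l, w)" for k z l w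
    using that grid_cube_disjoint[OF assms, of z w c k]
    by (cases k l rule: linorder_cases) (auto simp: maximal_indices_def)
  then show ?thesis unfolding disjoint_family_on_def by fast
qed

text \<open>Larger cubes have smaller levels, and levels are natural numbers, so some member of
  least level meets the given cube. It contains that cube, and any larger member meeting it would
  meet the given cube as well.\<close>

lemma ex_maximal_index:
  assumes "0 < h" "(k, z) \<in> V"
  shows "\<exists>(l, w) \<in> maximal_indices c h V. l \<le> k \<and> grid_cube c h k z \<subseteq> grid_cube c h l w"
proof -
  have self: "grid_cube c h k z \<noteq> {}"
    unfolding grid_cube_def using cube_center_mem[of "h / 2 ^ k"] assms(1) by fastforce
  define P where "P l \<longleftrightarrow> (\<exists>w. (l, w) \<in> V \<and> grid_cube c h l w \<inter> grid_cube c h k z \<noteq> {})" for l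
  have "P k" using assms self by (auto simp: P_def)
  define l where "l = (LEAST l. P l)"
  have l: "P l" "l \<le> k" "\<And>j. P j \<Longrightarrow> l \<le> j"
    unfolding l_def using \<open>P k\<close> by (auto intro: LeastI Least_le)
  then obtain w where w: "(l, w) \<in> V" "grid_cube c h l w \<inter> grid_cube c h k z \<noteq> {}" by (auto simp: P_def)
  have sub: "grid_cube c h k z \<subseteq> grid_cube c h l w" by (rule grid_cube_mono[OF assms(1) l(2) w(2)])
  have "(l, w) \<in> maximal_indices c h V"
  proof -
    have "grid_cube c h j v \<inter> grid_cube c h l w = {}" if "(j, v) \<in> V" "j < l" for j v
    proof (rule ccontr)
      assume "grid_cube c h j v \<inter> grid_cube c h l w \<noteq> {}"
      then have "grid_cube c h l w \<subseteq> grid_cube c h j v"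
        using that by (intro grid_cube_mono[OF assms(1)]) auto
      then have "P j" using sub self that by (auto simp: P_def)
      with l(3) \<open>j < l\<close> show False by fastforce
    qed
    with w show ?thesis by (auto simp: maximal_indices_def)
  qed
  with l sub show ?thesis by blast
qed

subsection \<open>Dyadic lattices and tripled cubes\<close>

lemma dyadic_cubes_trans:
  assumes "Q \<in> dyadic_cubes R" "R \<in> dyadic_cubes S"
  shows "Q \<in> dyadic_cubes S"
  using assms by (induction rule: dyadic_cubes.induct) (auto intro: dyadic_cubes.subdivide)

lemma subcube_subset:
  assumes "0 < h" "\<forall>i. d $ i = c $ i - h / 2 \<or> d $ i = c $ i + h / 2"
  shows "cube d (h / 2) \<subseteq> cube c h"
proof
  fix y assume y: "y \<in> cube d (h / 2)"
  have "c $ i - h \<le> y $ i \<and> y $ i < c $ i + h" for i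
    using assms y by (auto simp: cube_def dest!: spec[of _ i])
  then show "y \<in> cube c h" by (simp add: cube_def)
qed

lemma dyadic_cubes_subset: "Q \<in> dyadic_cubes R \<Longrightarrow> Q \<subseteq> R"
proof (induction rule: dyadic_cubes.induct)
  case (subdivide c h d)
  then show ?case using subcube_subset by blast
qed auto

text \<open>The offset \<open>(-2)\<^sup>k / 3\<close> alternates in sign, so that the cubes of growing level spread in all
  directions; consecutive offsets differ by a multiple of the finer side length, so the grids are nested.\<close>

definition lattice_center :: "real ^ 'n \<Rightarrow> real \<Rightarrow> int \<Rightarrow> int ^ 'n \<Rightarrow> real ^ 'n" where
  "lattice_center a L k z =
    (\<chi> i. a $ i + (((- 2) powi k - 1) / 3 + 2 powi k * (of_int (z $ i) + 1 / 2)) * L)"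

definition lattice_cube :: "real ^ 'n \<Rightarrow> real \<Rightarrow> int \<Rightarrow> int ^ 'n \<Rightarrow> (real ^ 'n) set" where
  "lattice_cube a L k z = cube (lattice_center a L k z) (2 powi k * L / 2)"

definition shifted_lattice :: "real ^ 'n \<Rightarrow> real \<Rightarrow> (real ^ 'n) set set" where
  "shifted_lattice a L = (\<Union>k. range (lattice_cube a L k))"

lemma mem_lattice_cube:
  assumes "0 < L"
  shows "y \<in> lattice_cube a L k z \<longleftrightarrow>
    (\<forall>i. \<lfloor>((y $ i - a $ i) / L - ((- 2) powi k - 1) / 3) / 2 powi k\<rfloor> = z $ i)"
proof -
  have p: "(0 :: real) < 2 powi k" by simp
  have "(lattice_center a L k z $ i - 2 powi k * L / 2 \<le> y $ i \<and> y $ i < lattice_center a L k z $ i + 2 powi k * L / 2)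
    \<longleftrightarrow> \<lfloor>((y $ i - a $ i) / L - ((- 2) powi k - 1) / 3) / 2 powi k\<rfloor> = z $ i" for i
  proof -
    define v where "v = ((- 2) powi k - 1) / (3 :: real)"
    define w where "w = (2 :: real) powi k"
    define u where "u = (y $ i - a $ i) / L"
    have w: "0 < w" by (simp add: w_def)
    have y: "y $ i = a $ i + L * u" using assms by (simp add: u_def)
    have "lattice_center a L k z $ i - w * L / 2 = a $ i + L * (v + w * of_int (z $ i))"
      "lattice_center a L k z $ i + w * L / 2 = a $ i + L * (v + w * (of_int (z $ i) + 1))"
      by (simp_all add: lattice_center_def v_def w_def algebra_simps)
    then have "(lattice_center a L k z $ i - w * L / 2 \<le> y $ i \<and> y $ i < lattice_center a L k z $ i + w * L / 2)
      \<longleftrightarrow> v + w * of_int (z $ i) \<le> u \<and> u < v + w * (of_int (z $ i) + 1)"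
      using assms by (simp add: y)
    also have "\<dots> \<longleftrightarrow> \<lfloor>(u - v) / w\<rfloor> = z $ i"
      using w unfolding floor_eq_iff by (simp add: pos_le_divide_eq pos_divide_less_eq algebra_simps)
    finally show ?thesis unfolding u_def v_def w_def .
  qed
  then show ?thesis by (simp add: lattice_cube_def cube_def)
qed

text \<open>The sign of (-2)^k; through it the alternating offset enters the integer arithmetic of
  indices.\<close>

definition lattice_sign :: "int \<Rightarrow> int" where
  "lattice_sign k = (if even k then 1 else - 1)"

lemma powi_minus_two: "(- 2 :: real) powi k = of_int (lattice_sign k) * 2 powi k"
  using power_int_minus_left[of "2 :: real" k] by (simp add: lattice_sign_def)

lemma lattice_center_succ:
  "lattice_center a L (k + 1) z $ i =
    lattice_center a L k w $ i + (2 powi k * L / 2) * of_int (4 * z $ i - 2 * lattice_sign k + 1 - 2 * w $ i)"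
proof -
  have p: "(2 :: real) powi (k + 1) = 2 * 2 powi k"
    by (subst power_int_add) auto
  have m: "(- 2 :: real) powi (k + 1) = of_int (lattice_sign k) * 2 powi k * - 2"
    unfolding powi_minus_two[symmetric] by (subst power_int_add) auto
  show ?thesis
    unfolding lattice_center_def m p unfolding powi_minus_two by (simp add: field_simps)
qed

lemma lattice_half: "2 powi (k + 1) * L / 2 = 2 powi k * (L :: real)"
  by (subst power_int_add) auto

lemma lattice_parent:
  assumes "0 < L"
  shows "\<exists>z. lattice_cube a L k w \<in> dyadic_cubes (lattice_cube a L (k + 1) z)"
proof -
  \<comment> \<open>By \<open>lattice_center_succ\<close> the centre of a child differs from that of
    its parent by half the parent's half side exactly if 2z is \<open>w + lattice_sign k\<close> or
    one less; the parity decides which.\<close>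
  define z where "z = (\<chi> i. (w $ i + lattice_sign k) div 2)"
  have "4 * z $ i - 2 * lattice_sign k + 1 - 2 * w $ i \<in> {- 1, 1}" for i
  proof -
    have "2 * (v div 2) = v \<or> 2 * (v div 2) = v - 1" for v :: int by presburger
    then have "2 * z $ i = w $ i + lattice_sign k \<or> 2 * z $ i = w $ i + lattice_sign k - 1"
      unfolding z_def vec_lambda_beta by blast
    then show ?thesis unfolding insert_iff by linarith
  qed
  moreover have "x = y - c \<or> x = y + c" if "t \<in> {- 1, 1}" "y = x + c * of_int t" for x y c :: real and t :: int
    using that by auto
  ultimately have "lattice_center a L k w $ i = lattice_center a L (k + 1) z $ i - (2 powi (k + 1) * L / 2) / 2
     \<or> lattice_center a L k w $ i = lattice_center a L (k + 1) z $ i + (2 powi (k + 1) * L / 2) / 2" for i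
    using lattice_center_succ[of a L k z i w] unfolding lattice_half by blast
  then have "cube (lattice_center a L k w) ((2 powi (k + 1) * L / 2) / 2) \<in> dyadic_cubes (lattice_cube a L (k + 1) z)"
    using assms dyadic_cubes.self[of "lattice_cube a L (k + 1) z"]
    by (intro dyadic_cubes.subdivide[of "lattice_center a L (k + 1) z" "2 powi (k + 1) * L / 2"]) (auto simp: lattice_cube_def)
  then show ?thesis unfolding lattice_half lattice_cube_def by blast
qed

lemma lattice_child:
  assumes "0 < L" "\<forall>i. d $ i = lattice_center a L (k + 1) z $ i - (2 powi k * L / 2) \<or> d $ i = lattice_center a L (k + 1) z $ i + (2 powi k * L / 2)"
  shows "\<exists>w. d = lattice_center a L k w"
proof -
  have "\<exists>t. d $ i = lattice_center a L k (\<chi> i. t) $ i" for i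
  proof -
    let ?t = "\<lambda>s. 2 * z $ i - lattice_sign k + s"
    have "lattice_center a L (k + 1) z $ i = lattice_center a L k (\<chi> i. ?t s) $ i + (2 powi k * L / 2) * of_int (1 - 2 * s)" for s
      by (subst lattice_center_succ[of a L k z i "\<chi> i. ?t s"]) simp
    from this[of 0] this[of 1] assms(2)[rule_format, of i]
    have "d $ i = lattice_center a L k (\<chi> i. ?t 0) $ i \<or> d $ i = lattice_center a L k (\<chi> i. ?t 1) $ i"
      by auto
    then show ?thesis by blast
  qed
  then obtain t where t: "\<And>i. d $ i = lattice_center a L k (\<chi> _. t i) $ i" by metis
  have "d = lattice_center a L k (\<chi> i. t i)"
    using t by (simp add: lattice_center_def vec_eq_iff)
  then show ?thesis by blast
qed

lemma lattice_ancestor: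
  assumes "0 < L"
  shows "\<exists>z. lattice_cube a L k w \<in> dyadic_cubes (lattice_cube a L (k + int j) z)"
proof (induction j)
  case 0
  show ?case by (auto intro: dyadic_cubes.self)
next
  case (Suc j)
  then show ?case
    using lattice_parent[OF assms, of a "k + int j"] dyadic_cubes_trans by (metis add.assoc of_nat_Suc add.commute)
qed

text \<open>At an even level the offset is (2^k - 1) / 3. Relative to \<open>a\<close> and in units
  of \<open>L\<close>, the cube with all indices -1 then reaches from -(2 2^k + 1) / 3 to (2^k - 1)
  / 3, and both ends move off to infinity.\<close>

lemma lattice_exhaust:
  assumes "0 < L" "compact K"
  shows "\<exists>N. \<forall>k\<ge>N. even k \<longrightarrow> K \<subseteq> lattice_cube a L (int k) (\<chi> i. - 1)"
proof -
  have "compact ((\<lambda>x. x - a) ` K)"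
    using assms(2) by (intro compact_continuous_image continuous_intros)
  then obtain h where h: "0 < h" "(\<lambda>x. x - a) ` K \<subseteq> cube 0 h"
    using compact_subset_cube by blast
  obtain N where N: "3 * (h / L) + 1 < real N" using reals_Archimedean2 by blast
  have "K \<subseteq> lattice_cube a L (int k) (\<chi> i. - 1)" if "N \<le> k" "even k" for k
  proof
    fix x assume "x \<in> K"
    then have "x - a \<in> cube 0 h" using h by blast
    then have x: "- h \<le> x $ i - a $ i \<and> x $ i - a $ i < h" for i
      by (simp add: cube_def)
    define w where "w = (2 :: real) ^ k"
    have "real k < w" unfolding w_def by (rule of_nat_less_two_power)
    then have "3 * (h / L) + 1 < w" using N that by linarith
    then have w: "3 * h + L < w * L" using assms(1) by (simp add: field_simps)
    have w': "(- 2 :: real) powi int k = w" "(2 :: real) powi int k = w"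
      using that by (auto simp: w_def power_minus_even)
    have "0 < w" by (simp add: w_def)
    show "x \<in> lattice_cube a L (int k) (\<chi> i. - 1)"
      unfolding mem_lattice_cube[OF assms(1)] floor_eq_iff w'
    proof
      fix i
      show "of_int ((\<chi> i. - 1) $ i) \<le> ((x $ i - a $ i) / L - (w - 1) / 3) / w
        \<and> ((x $ i - a $ i) / L - (w - 1) / 3) / w < of_int ((\<chi> i. - 1) $ i) + 1"
        using x[of i] w assms(1) h(1) \<open>0 < w\<close> by (simp add: field_simps)
    qed
  qed
  then show ?thesis by blast
qed

lemma lattice_dyadic_cubes:
  assumes "0 < L" "Q \<in> dyadic_cubes R" "R \<in> shifted_lattice a L"
  shows "Q \<in> shifted_lattice a L"
  using assms(2,3)
proof (induction rule: dyadic_cubes.induct)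
  case (subdivide c h d)
  then obtain k z where kz: "cube c h = lattice_cube a L k z"
    by (auto simp: shifted_lattice_def)
  have ch: "c = lattice_center a L k z" "h = 2 powi k * L / 2"
    using cube_inject[OF \<open>0 < h\<close> _ kz[unfolded lattice_cube_def]] assms(1) by auto
  have h2: "h / 2 = 2 powi (k - 1) * L / 2"
    using lattice_half[of "k - 1" L] ch by simp
  obtain w where w: "d = lattice_center a L (k - 1) w"
    using lattice_child[OF assms(1), of d a "k - 1" z] subdivide.hyps(3) unfolding h2 ch(1) by auto
  have "cube d (h / 2) = lattice_cube a L (k - 1) w"
    by (simp add: lattice_cube_def w h2)
  then show ?case by (auto simp: shifted_lattice_def)
qed

lemma dyadic_lattice_shifted_lattice:
  assumes "0 < L"
  shows "dyadic_lattice (shifted_lattice a L)"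
  unfolding dyadic_lattice_def
proof (intro conjI ballI allI impI)
  have pos: "0 < 2 powi k * L / 2" for k using assms by simp
  show "is_cube Q" if "Q \<in> shifted_lattice a L" for Q
    using that pos unfolding shifted_lattice_def lattice_cube_def is_cube_def by blast
  show "dyadic_cubes Q \<subseteq> shifted_lattice a L" if "Q \<in> shifted_lattice a L" for Q
    using lattice_dyadic_cubes[OF assms] that by blast
  show "\<exists>Q\<in>shifted_lattice a L. K \<subseteq> Q" if K: "compact K" for K
  proof -
    obtain N where "\<forall>k\<ge>N. even k \<longrightarrow> K \<subseteq> lattice_cube a L (int k) (\<chi> i. - 1)"
      using lattice_exhaust[OF assms K] by blast
    then have "K \<subseteq> lattice_cube a L (int (2 * N)) (\<chi> i. - 1)"
      by (metis dvd_triv_left le_add2 mult_2)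
    then show ?thesis unfolding shifted_lattice_def by blast
  qed
  fix Q Q' assume "Q \<in> shifted_lattice a L" "Q' \<in> shifted_lattice a L"
  then obtain k z k' z' where Q: "Q = lattice_cube a L k z" "Q' = lattice_cube a L k' z'"
    by (auto simp: shifted_lattice_def)
  obtain x x' where x: "x \<in> Q" "x' \<in> Q'"
    using Q cube_center_mem pos by (metis lattice_cube_def)
  obtain N where N: "\<forall>k\<ge>N. even k \<longrightarrow> {x, x'} \<subseteq> lattice_cube a L (int k) (\<chi> i. - 1)"
    using lattice_exhaust[OF assms, of "{x, x'}" a] by auto
  \<comment> \<open>An even level beyond those of both cubes: \<open>R\<close> is then one of the
    exhausting cubes. It shares a point with each of the two, so it is their ancestor at this
    level.\<close>
  define K where "K = 2 * (N + nat \<bar>k\<bar> + nat \<bar>k'\<bar>)"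
  define R where "R = lattice_cube a L (int K) (\<chi> i. - 1)"
  have "even K" "N \<le> K" by (auto simp: K_def)
  with N have xR: "x \<in> R" "x' \<in> R" unfolding R_def by blast+
  have anc: "lattice_cube a L l w \<in> dyadic_cubes R" if "l \<le> int K" "y \<in> lattice_cube a L l w" "y \<in> R" for l w y
  proof -
    obtain z where z: "lattice_cube a L l w \<in> dyadic_cubes (lattice_cube a L (l + int (nat (int K - l))) z)"
      using lattice_ancestor[OF assms] by blast
    then have "y \<in> lattice_cube a L (int K) z" using dyadic_cubes_subset that by fastforce
    then have "z = (\<chi> i. - 1)"
      using \<open>y \<in> R\<close> unfolding R_def mem_lattice_cube[OF assms] by (simp add: vec_eq_iff)
    with z that show ?thesis by (simp add: R_def)
  qed
  have "Q \<in> dyadic_cubes R" "Q' \<in> dyadic_cubes R"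
    unfolding Q using x xR by (auto intro!: anc simp: Q K_def)
  moreover have "R \<in> shifted_lattice a L" by (auto simp: R_def shifted_lattice_def)
  ultimately show "\<exists>R\<in>shifted_lattice a L. Q \<in> dyadic_cubes R \<and> Q' \<in> dyadic_cubes R" by blast
qed

text \<open>A cube of the grid of \<open>cube c h\<close> has corner \<open>p + 2\<^sup>-\<^sup>k 2h z\<close>, and \<open>j\<close> has to solve
  \<open>2\<^sup>k j \<equiv> z - 1\<close> modulo 3, where \<open>2\<^sup>k \<equiv> (-1)\<^sup>k\<close>.\<close>

lemma triple_mem_shifted_lattice:
  fixes c :: "real ^ 'n"
  assumes "0 < h"
  shows "\<exists>j. (\<forall>i. j $ i \<in> {0, 1, 2 :: int}) \<and>
    cube (grid_center c h k z) (3 * (h / 2 ^ k)) \<in> shifted_lattice (\<chi> i. c $ i - h + of_int (j $ i) * (2 * h)) (6 * h)"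
proof -
  define s :: int where "s = (- 1) ^ k"
  define j :: "int ^ 'n" where "j = (\<chi> i. (s * (z $ i - 1)) mod 3)"
  have s2: "s * s = 1" by (cases "even k") (simp_all add: s_def)
  have two: "(2 :: int) ^ k mod 3 = s mod 3"
    using power_mod[of "- 1 :: int" 3 k] by (simp add: s_def)
  \<comment> \<open>This is the difference of the two centres in units of the fine side length. The
    1 in \<open>j $ i - 1\<close> and the final \<open>s\<close> stem from the offset ((-2)^(-k) -
    1) / 3; they cancel modulo 3, where 2^k is \<open>s\<close>, and what remains is z - 1 - s
    j.\<close>
  have div: "3 dvd z $ i - 1 - 2 ^ k * (j $ i - 1) - s" for i
  proof -
    obtain e where e: "(2 :: int) ^ k = s + 3 * e"
      using two by (metis mod_eqE mult.commute add.commute diff_add_cancel)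
    obtain d where d: "j $ i = s * (z $ i - 1) - 3 * d"
      by (metis j_def vec_lambda_beta minus_mult_div_eq_mod)
    have "z $ i - 1 - 2 ^ k * (j $ i - 1) - s = (1 - s * s) * (z $ i - 1) + 3 * (s * d - e * (j $ i - 1))"
      unfolding e by (simp add: d algebra_simps)
    then show ?thesis by (simp add: s2)
  qed
  define w :: "int ^ 'n" where "w = (\<chi> i. (z $ i - 1 - 2 ^ k * (j $ i - 1) - s) div 3)"
  have w: "z $ i - 1 - 2 ^ k * (j $ i - 1) - s = 3 * w $ i" for i
    using div[of i] by (simp add: w_def)
  have p: "(2 :: real) powi (- int k) = 1 / 2 ^ k" "(- 2 :: real) powi (- int k) = of_int s / 2 ^ k"
    unfolding s_def by (cases "even k"; simp add: power_int_minus inverse_eq_divide)+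
  have "grid_center c h k z $ i =
    lattice_center (\<chi> i. c $ i - h + of_int (j $ i) * (2 * h)) (6 * h) (- int k) w $ i" for i
  proof -
    have z: "real_of_int (z $ i) = 1 + 2 ^ k * (of_int (j $ i) - 1) + of_int s + 3 * of_int (w $ i)"
      using arg_cong[OF w[of i], of real_of_int] by simp
    show ?thesis
      unfolding lattice_center_def grid_center_def p by (simp add: z field_simps)
  qed
  then have "grid_center c h k z =
    lattice_center (\<chi> i. c $ i - h + of_int (j $ i) * (2 * h)) (6 * h) (- int k) w"
    by (simp only: vec_eq_iff) blast
  then have "cube (grid_center c h k z) (3 * (h / 2 ^ k)) =
    lattice_cube (\<chi> i. c $ i - h + of_int (j $ i) * (2 * h)) (6 * h) (- int k) w"
    unfolding lattice_cube_def p by simp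
  then show ?thesis
    by (intro exI[of _ j]) (auto simp: shifted_lattice_def j_def)
qed

subsection \<open>Stopping cubes\<close>

abbreviation grid_union :: "real ^ 'n \<Rightarrow> real \<Rightarrow> (nat \<times> (int ^ 'n)) set \<Rightarrow> (real ^ 'n) set" where
  "grid_union c h V \<equiv> (\<Union>(k, z)\<in>V. grid_cube c h k z)"

lemma grid_cube_lebesgue [measurable, simp]: "grid_cube c h k z \<in> sets lebesgue"
  by (simp add: grid_cube_def)

lemma sets_UN_countable_index:
  fixes V :: "'i :: countable set"
  shows "(\<And>i. i \<in> V \<Longrightarrow> X i \<in> sets M) \<Longrightarrow> (\<Union>i\<in>V. X i) \<in> sets M"
  by (intro sets.countable_UN') auto

lemma grid_union_lebesgue [measurable, simp]: "grid_union c h V \<in> sets lebesgue"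
  by (intro sets_UN_countable_index) auto

section \<open>Comparison of measures on unions of grid cubes and of their triples\<close>

lemma grid_union_maximal:
  assumes "0 < h"
  shows "grid_union c h (maximal_indices c h V) = grid_union c h V"
proof (intro equalityI subsetI)
  fix x assume "x \<in> grid_union c h V"
  then obtain k z where "(k, z) \<in> V" "x \<in> grid_cube c h k z" by auto
  then show "x \<in> grid_union c h (maximal_indices c h V)"
    using ex_maximal_index[OF assms, of k z V c] by fastforce
qed (use maximal_indices_subset in fastforce)

lemma emeasure_grid_union_maximal:
  assumes "0 < h" "sets \<mu> = sets lebesgue"
  shows "emeasure \<mu> (grid_union c h V) =
    (\<integral>\<^sup>+(k, z). emeasure \<mu> (grid_cube c h k z) \<partial>count_space (maximal_indices c h V))"
proof -
  have "emeasure \<mu> (\<Union>i\<in>maximal_indices c h V. (\<lambda>(k, z). grid_cube c h k z) i) =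
    (\<integral>\<^sup>+i. emeasure \<mu> ((\<lambda>(k, z). grid_cube c h k z) i) \<partial>count_space (maximal_indices c h V))"
    using assms maximal_indices_disjoint[OF assms(1), of c V]
    by (intro emeasure_UN_countable) (auto simp: split: prod.split)
  then show ?thesis
    using grid_union_maximal[OF assms(1), of c V] by (simp add: case_prod_unfold)
qed

text \<open>The cubes of \<open>V\<close> may overlap, so both measures are summed over the disjoint
  maximal cubes, which have the same union. Covering arguments are reduced to this comparison,
  applied to Lebesgue measure, its multiples and its densities.\<close>

lemma grid_union_emeasure_mono:
  assumes "0 < h" and sets: "sets \<mu> = sets lebesgue" "sets \<nu> = sets lebesgue"
    and le: "\<And>k z. (k, z) \<in> V \<Longrightarrow> t * emeasure \<mu> (grid_cube c h k z) \<le> emeasure \<nu> (grid_cube c h k z)"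
  shows "t * emeasure \<mu> (grid_union c h V) \<le> emeasure \<nu> (grid_union c h V)"
proof -
  have "t * emeasure \<mu> (grid_union c h V) =
    (\<integral>\<^sup>+i. t * emeasure \<mu> (case i of (k, z) \<Rightarrow> grid_cube c h k z) \<partial>count_space (maximal_indices c h V))"
    by (subst emeasure_grid_union_maximal[OF assms(1) sets(1)]) (simp add: nn_integral_cmult case_prod_unfold)
  also have "\<dots> \<le> (\<integral>\<^sup>+i. emeasure \<nu> (case i of (k, z) \<Rightarrow> grid_cube c h k z) \<partial>count_space (maximal_indices c h V))"
    using maximal_indices_subset[of c h V] le by (intro nn_integral_mono) (auto split: prod.split)
  also have "\<dots> = emeasure \<nu> (grid_union c h V)"
    by (subst emeasure_grid_union_maximal[OF assms(1) sets(2)]) (simp add: case_prod_unfold)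
  finally show ?thesis .
qed

lemma emeasure_UN_le_nn_integral_count_space:
  assumes "countable V" "\<And>i. i \<in> V \<Longrightarrow> X i \<in> sets M"
  shows "emeasure M (\<Union>i\<in>V. X i) \<le> (\<integral>\<^sup>+i. emeasure M (X i) \<partial>count_space V)"
proof -
  have U: "(\<Union>i\<in>V. X i) \<in> sets M" using assms by (intro sets.countable_UN') auto
  have "emeasure M (\<Union>i\<in>V. X i) = (\<integral>\<^sup>+x. indicator (\<Union>i\<in>V. X i) x \<partial>M)"
    using U by simp
  also have "\<dots> \<le> (\<integral>\<^sup>+x. \<integral>\<^sup>+i. indicator (X i) x \<partial>count_space V \<partial>M)"
  proof (rule nn_integral_mono)
    fix x
    show "indicator (\<Union>i\<in>V. X i) x \<le> (\<integral>\<^sup>+i. indicator (X i) x \<partial>count_space V :: ennreal)"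
    proof (cases "x \<in> (\<Union>i\<in>V. X i)")
      case True
      then obtain i where "i \<in> V" "x \<in> X i" by blast
      then show ?thesis
        using nn_integral_ge_point[of i V "\<lambda>i. indicator (X i) x"] by (simp add: indicator_def)
    qed simp
  qed
  also have "\<dots> = (\<integral>\<^sup>+i. \<integral>\<^sup>+x. indicator (X i) x \<partial>M \<partial>count_space V)"
    using assms by (intro nn_integral_count_space_nn_integral[of V "\<lambda>i x. indicator (X i) x" M] borel_measurable_indicator)
  also have "\<dots> = (\<integral>\<^sup>+i. emeasure M (X i) \<partial>count_space V)"
    using assms by (intro nn_integral_cong) auto
  finally show ?thesis .
qed

lemma emeasure_grid_cube:
  fixes c :: "real ^ 'n"
  shows "0 < h \<Longrightarrow> emeasure lebesgue (grid_cube c h k z) = ennreal ((2 * (h / 2 ^ k)) ^ CARD('n))"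
  unfolding grid_cube_def by (intro emeasure_cube) auto

lemma emeasure_triple_cube:
  fixes c :: "real ^ 'n"
  assumes "0 < h"
  shows "emeasure lebesgue (cube c (3 * h)) = 3 ^ CARD('n) * emeasure lebesgue (cube c h)"
  using assms measure_triple_cube[OF assms, of c]
  by (simp add: emeasure_eq_measure2 fmeasurableD2[OF cube_lmeasurable] emeasure_eq_ennreal_measure ennreal_mult' ennreal_power[symmetric])

text \<open>Each triple lies in the triple of a maximal cube, and the measures of the disjoint
  maximal cubes add up to that of the union.\<close>

lemma emeasure_triple_grid_union:
  fixes c :: "real ^ 'n"
  assumes "0 < h"
  shows "emeasure lebesgue (\<Union>(k, z)\<in>V. cube (grid_center c h k z) (3 * (h / 2 ^ k))) \<le>
    3 ^ CARD('n) * emeasure lebesgue (grid_union c h V)"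
proof -
  let ?M = "maximal_indices c h V" and ?T = "\<lambda>(k, z). cube (grid_center c h k z) (3 * (h / 2 ^ k))"
  have "(\<Union>i\<in>V. ?T i) \<subseteq> (\<Union>i\<in>?M. ?T i)"
  proof
    fix x assume "x \<in> (\<Union>i\<in>V. ?T i)"
    then obtain k z where kz: "(k, z) \<in> V" "x \<in> ?T (k, z)" by blast
    obtain l w where lw: "(l, w) \<in> ?M" "l \<le> k" "grid_cube c h k z \<subseteq> grid_cube c h l w"
      using ex_maximal_index[OF assms kz(1)] by blast
    show "x \<in> (\<Union>i\<in>?M. ?T i)"
      using grid_triple_mono[OF assms lw(2,3)] lw(1) kz(2) by fastforce
  qed
  then have "emeasure lebesgue (\<Union>i\<in>V. ?T i) \<le> emeasure lebesgue (\<Union>i\<in>?M. ?T i)"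
    by (intro emeasure_mono sets_UN_countable_index) auto
  also have "\<dots> \<le> (\<integral>\<^sup>+i. emeasure lebesgue (?T i) \<partial>count_space ?M)"
    by (intro emeasure_UN_le_nn_integral_count_space) auto
  also have "\<dots> = (\<integral>\<^sup>+i. 3 ^ CARD('n) * emeasure lebesgue (case i of (k, z) \<Rightarrow> grid_cube c h k z) \<partial>count_space ?M)"
    using assms by (intro nn_integral_cong)
      (simp only: case_prod_unfold grid_cube_def emeasure_triple_cube divide_pos_pos zero_less_power zero_less_numeral)
  also have "\<dots> = 3 ^ CARD('n) * emeasure lebesgue (grid_union c h V)"
    by (subst emeasure_grid_union_maximal[OF assms refl]) (simp add: nn_integral_cmult case_prod_unfold)
  finally show ?thesis by (simp add: case_prod_unfold)
qed

lemma grid_triple_eq_union: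
  assumes "0 < h"
  shows "cube (grid_center c h k z) (3 * (h / 2 ^ k)) =
    grid_union c h {(l, w). l = k \<and> (\<forall>i. \<bar>w $ i - z $ i\<bar> \<le> 1)}"
proof -
  have "\<bar>a - b\<bar> \<le> 1 \<longleftrightarrow> b - 1 \<le> a \<and> a \<le> b + 1" for a b :: int by arith
  then show ?thesis
    unfolding set_eq_iff mem_grid_cube_triple[OF assms] by (auto simp: mem_grid_cube[OF assms])
qed

text \<open>Differing by at most 1 in every index is a symmetric relation between cubes of the same
  level.\<close>

lemma triple_neighbour:
  assumes "grid_cube c h l w \<subseteq> cube (grid_center c h l z) (3 * (h / 2 ^ l))" "0 < h"
  shows "grid_cube c h l z \<subseteq> cube (grid_center c h l w) (3 * (h / 2 ^ l))"
proof -
  have c: "grid_center c h l w \<in> grid_cube c h l w"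
    unfolding grid_cube_def using assms(2) by (intro cube_center_mem) auto
  then have "grid_index c h l (grid_center c h l w) = w" by (simp add: mem_grid_cube assms(2))
  moreover have "grid_center c h l w \<in> cube (grid_center c h l z) (3 * (h / 2 ^ l))" using c assms(1) by blast
  ultimately have "z $ i - 1 \<le> w $ i \<and> w $ i \<le> z $ i + 1" for i
    unfolding mem_grid_cube_triple[OF assms(2)] by metis
  then have "w $ i - 1 \<le> z $ i \<and> z $ i \<le> w $ i + 1" for i by (smt (verit))
  then show ?thesis
    unfolding subset_iff mem_grid_cube[OF assms(2)] mem_grid_cube_triple[OF assms(2)] by blast
qed

text \<open>A tripled cube is the union of dyadic cubes of the same size, one of which must have a large
  average.\<close>

lemma triple_maximal_weak_type:
  fixes c :: "real ^ 'n"
  assumes "0 < h" and sets: "sets \<nu> = sets lebesgue"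
    and V: "\<And>k z. (k, z) \<in> V \<Longrightarrow> grid_cube c h k z \<subseteq> cube c h"
      "\<And>k z. (k, z) \<in> V \<Longrightarrow> t * emeasure lebesgue (cube (grid_center c h k z) (3 * (h / 2 ^ k)))
        < emeasure \<nu> (cube (grid_center c h k z) (3 * (h / 2 ^ k)))"
  shows "t * emeasure lebesgue (grid_union c h V) \<le> 3 ^ CARD('n) * emeasure \<nu> (cube c (3 * h))"
proof -
  \<comment> \<open>The cubes of large average are only known to lie in
    \<open>cube c (3 * h)\<close>, hence the triple on the right-hand side.\<close>
  define N where "N = {(k, w). grid_cube c h k w \<subseteq> cube c (3 * h) \<and>
    t * emeasure lebesgue (grid_cube c h k w) \<le> emeasure \<nu> (grid_cube c h k w)}"
  have cover: "grid_union c h V \<subseteq> (\<Union>(k, w)\<in>N. cube (grid_center c h k w) (3 * (h / 2 ^ k)))"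
  proof
    fix x assume "x \<in> grid_union c h V"
    then obtain k z where kz: "(k, z) \<in> V" "x \<in> grid_cube c h k z" by blast
    define Y where "Y = {(l, w). l = k \<and> (\<forall>i. \<bar>w $ i - z $ i\<bar> \<le> 1)}"
    have T: "cube (grid_center c h k z) (3 * (h / 2 ^ k)) = grid_union c h Y"
      unfolding Y_def by (rule grid_triple_eq_union[OF assms(1)])
    have "\<exists>(l, w) \<in> Y. \<not> 1 * emeasure \<nu> (grid_cube c h l w) \<le> emeasure (scale_measure t lebesgue) (grid_cube c h l w)"
    proof (rule ccontr)
      assume "\<not> ?thesis"
      then have "1 * emeasure \<nu> (grid_union c h Y) \<le> emeasure (scale_measure t lebesgue) (grid_union c h Y)"
        by (intro grid_union_emeasure_mono[OF assms(1) sets]) auto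
      with V(2)[OF kz(1)] show False unfolding T by simp
    qed
    then obtain l w where lw: "(l, w) \<in> Y" "t * emeasure lebesgue (grid_cube c h l w) \<le> emeasure \<nu> (grid_cube c h l w)"
      by (auto simp: not_le less_imp_le)
    have l: "l = k" using lw by (simp add: Y_def)
    have sub: "grid_cube c h k w \<subseteq> cube (grid_center c h k z) (3 * (h / 2 ^ k))"
      using lw(1) unfolding T l by blast
    have "grid_cube c h k z \<subseteq> grid_cube c h 0 0" using V(1)[OF kz(1)] assms(1) by (simp add: grid_cube_0)
    then have "cube (grid_center c h k z) (3 * (h / 2 ^ k)) \<subseteq> cube (grid_center c h 0 0) (3 * (h / 2 ^ 0))"
      by (intro grid_triple_mono[OF assms(1)]) auto
    also have "grid_center c h 0 0 = c" by (simp add: grid_center_def vec_eq_iff)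
    finally have "(k, w) \<in> N" using sub lw(2) by (auto simp: N_def l)
    moreover have "x \<in> cube (grid_center c h k w) (3 * (h / 2 ^ k))"
      using triple_neighbour[OF sub assms(1)] kz(2) by blast
    ultimately show "x \<in> (\<Union>(k, w)\<in>N. cube (grid_center c h k w) (3 * (h / 2 ^ k)))" by blast
  qed
  have "emeasure lebesgue (grid_union c h V) \<le> emeasure lebesgue (\<Union>(k, w)\<in>N. cube (grid_center c h k w) (3 * (h / 2 ^ k)))"
    using cover by (intro emeasure_mono sets_UN_countable_index) auto
  also have "\<dots> \<le> 3 ^ CARD('n) * emeasure lebesgue (grid_union c h N)"
    by (rule emeasure_triple_grid_union[OF assms(1)])
  finally have "t * emeasure lebesgue (grid_union c h V) \<le> 3 ^ CARD('n) * (t * emeasure lebesgue (grid_union c h N))"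
    by (metis mult.left_commute mult_left_mono zero_le)
  moreover have "t * emeasure lebesgue (grid_union c h N) \<le> emeasure \<nu> (grid_union c h N)"
    by (intro grid_union_emeasure_mono[OF assms(1) refl sets]) (auto simp: N_def)
  moreover have "emeasure \<nu> (grid_union c h N) \<le> emeasure \<nu> (cube c (3 * h))"
    using sets by (intro emeasure_mono) (auto simp: N_def)
  ultimately show ?thesis by (meson mult_left_mono order_trans zero_le)
qed

lemma emeasure_density_indicator:
  "E \<in> sets M \<Longrightarrow> A \<in> sets M \<Longrightarrow> emeasure (density M (indicator E)) A = emeasure M (A \<inter> E)"
  by (simp add: emeasure_density indicator_inter_arith[symmetric] Int_commute)

lemma grid_ancestor:
  assumes "0 < h" "k \<le> l"
  shows "\<exists>w. grid_cube c h l z \<subseteq> grid_cube c h k w"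
proof -
  have "grid_center c h l z \<in> grid_cube c h l z"
    unfolding grid_cube_def using assms(1) by (intro cube_center_mem) auto
  then show ?thesis
    using grid_cube_mono[OF assms, of c "grid_index c h k (grid_center c h l z)" z]
    by (metis IntI assms(1) empty_iff mem_grid_cube)
qed

lemma grid_cube_nonempty: "0 < h \<Longrightarrow> grid_cube c h k z \<noteq> {}"
  unfolding grid_cube_def using cube_center_mem[of "h / 2 ^ k"] by fastforce

lemma grid_cube_subset_cube:
  assumes "0 < h" "grid_cube c h k z \<inter> cube c h \<noteq> {}"
  shows "grid_cube c h k z \<subseteq> cube c h"
  using grid_cube_mono[OF assms(1), of 0 k c 0 z] assms by (simp add: grid_cube_0 Int_commute)

section \<open>Dyadic cubes in which a set has large density\<close>

text \<open>The threshold 1 / (2 2^n) is the density 1/2 divided by the ratio of the measures of a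
  parent and its child.\<close>

definition stopping_indices :: "real ^ 'n \<Rightarrow> real \<Rightarrow> (real ^ 'n) set \<Rightarrow> (nat \<times> (int ^ 'n)) set" where
  "stopping_indices c h E = {(k, z). grid_cube c h k z \<subseteq> cube c h \<and>
    emeasure lebesgue (grid_cube c h k z) < 2 * 2 ^ CARD('n) * emeasure lebesgue (grid_cube c h k z \<inter> E)}"

lemma emeasure_stopping_union:
  fixes c :: "real ^ 'n"
  assumes "0 < h" "E \<in> sets lebesgue"
  shows "emeasure lebesgue (grid_union c h (stopping_indices c h E)) \<le> 2 * 2 ^ CARD('n) * emeasure lebesgue E"
proof -
  let ?\<nu> = "scale_measure (2 * 2 ^ CARD('n)) (density lebesgue (indicator E))"
  have "1 * emeasure lebesgue (grid_union c h (stopping_indices c h E)) \<le> emeasure ?\<nu> (grid_union c h (stopping_indices c h E))"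
    using assms by (intro grid_union_emeasure_mono) (auto simp: stopping_indices_def emeasure_density_indicator less_imp_le)
  also have "\<dots> \<le> 2 * 2 ^ CARD('n) * emeasure lebesgue E"
    using assms by (auto simp: emeasure_density_indicator intro!: mult_left_mono emeasure_mono)
  finally show ?thesis by simp
qed

text \<open>The parent of a maximal cube is not selected, so E has density at most 1 / (2 2^n) in
  the parent and at most 1/2 in the cube. Smallness of E keeps the initial cube from being selected,
  so that there is a parent inside it.\<close>

lemma stopping_maximal_half:
  fixes c :: "real ^ 'n"
  assumes "0 < h" "E \<in> sets lebesgue"
    and small: "2 * 2 ^ CARD('n) * emeasure lebesgue E \<le> emeasure lebesgue (cube c h)"
    and kz: "(k, z) \<in> maximal_indices c h (stopping_indices c h E)"
  shows "2 * emeasure lebesgue (grid_cube c h k z \<inter> E) \<le> emeasure lebesgue (grid_cube c h k z)"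
proof -
  let ?S = "stopping_indices c h E"
  have S: "(k, z) \<in> ?S" using kz maximal_indices_subset by blast
  have sub: "grid_cube c h k z \<subseteq> cube c h" using S by (simp add: stopping_indices_def)
  have "k \<noteq> 0"
  proof
    assume k: "k = 0"
    have "z = 0"
      using grid_cube_disjoint[OF assms(1), of z 0 c 0] sub grid_cube_nonempty[OF assms(1), of c k z]
      by (auto simp: k grid_cube_0 assms(1))
    then have "emeasure lebesgue (cube c h) < 2 * 2 ^ CARD('n) * emeasure lebesgue (cube c h \<inter> E)"
      using S assms(1) by (simp add: stopping_indices_def k grid_cube_0)
    also have "\<dots> \<le> 2 * 2 ^ CARD('n) * emeasure lebesgue E"
      using assms(2) by (intro mult_left_mono emeasure_mono) auto
    finally show False using small by simp
  qed
  then obtain l where l: "k = Suc l" by (cases k) auto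
  obtain w where w: "grid_cube c h k z \<subseteq> grid_cube c h l w" using grid_ancestor[OF assms(1), of l k c z] l by auto
  have ne: "grid_cube c h k z \<noteq> {}" by (rule grid_cube_nonempty[OF assms(1)])
  have "(l, w) \<notin> ?S"
    using kz w ne l unfolding maximal_indices_def by fastforce
  moreover have "grid_cube c h l w \<subseteq> cube c h"
    using w sub ne by (intro grid_cube_subset_cube[OF assms(1)]) blast
  ultimately have *: "2 * 2 ^ CARD('n) * emeasure lebesgue (grid_cube c h l w \<inter> E) \<le> emeasure lebesgue (grid_cube c h l w)"
    by (auto simp: stopping_indices_def not_less)
  have "(2 * (h / 2 ^ l)) ^ CARD('n) = (2 * (2 * (h / 2 ^ k))) ^ CARD('n)" by (simp add: l)
  also have "\<dots> = 2 ^ CARD('n) * (2 * (h / 2 ^ k)) ^ CARD('n)" by (rule power_mult_distrib)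
  finally have "emeasure lebesgue (grid_cube c h l w) = 2 ^ CARD('n) * emeasure lebesgue (grid_cube c h k z)"
    using assms(1) by (simp only: emeasure_grid_cube) (simp add: ennreal_mult' flip: ennreal_power)
  then have "2 ^ CARD('n) * (2 * emeasure lebesgue (grid_cube c h k z \<inter> E)) \<le> 2 ^ CARD('n) * emeasure lebesgue (grid_cube c h k z)"
  proof -
    have "2 ^ CARD('n) * (2 * emeasure lebesgue (grid_cube c h k z \<inter> E)) \<le> 2 * 2 ^ CARD('n) * emeasure lebesgue (grid_cube c h l w \<inter> E)"
      using w assms(2) by (auto simp: mult_ac intro!: mult_left_mono emeasure_mono)
    also note *
    finally show ?thesis
      using \<open>emeasure lebesgue (grid_cube c h l w) = _\<close> by simp
  qed
  then show ?thesis
    by (subst (asm) ennreal_mult_le_mult_iff) (auto simp: power_eq_top_ennreal)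
qed

text \<open>A form of the density theorem. A cube meeting the uncovered part N is not selected, so E
  fills at most half of it. Such cubes inside an open set T around N cover N, whence 2|N| \<le> |T|;
  choosing |T - N| < e gives |N| \<le> e.\<close>

lemma stopping_covers:
  fixes c :: "real ^ 'n"
  assumes "0 < h" "E \<in> sets lebesgue" "E \<subseteq> cube c h"
  shows "E - grid_union c h (stopping_indices c h E) \<in> null_sets lebesgue"
proof -
  let ?S = "stopping_indices c h E"
  define N where "N = E - grid_union c h ?S"
  have N: "N \<in> sets lebesgue" using assms(2) by (simp add: N_def sets.Diff)
  have NQ: "N \<subseteq> cube c h" using assms(3) by (auto simp: N_def)
  have fin: "emeasure lebesgue N < \<infinity>"
    using emeasure_mono[OF NQ cube_lebesgue] emeasure_cube[OF assms(1), of c] by (simp add: le_less_trans)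
  have small: "measure lebesgue N \<le> e" if "0 < e" for e
  proof -
    obtain T where T: "open T" "N \<subseteq> T" "emeasure lebesgue (T - N) < ennreal e"
      using sets_lebesgue_outer_open[OF N \<open>0 < e\<close>] by metis
    define V where "V = {(k, z). grid_cube c h k z \<subseteq> T \<and> grid_cube c h k z \<inter> N \<noteq> {}}"
    have "N \<subseteq> grid_union c h V"
    proof
      fix x assume x: "x \<in> N"
      then obtain k where "grid_cube c h k (grid_index c h k x) \<subseteq> T"
        using grid_cube_subset_open[OF assms(1) T(1)] T(2) by blast
      then have "(k, grid_index c h k x) \<in> V" "x \<in> grid_cube c h k (grid_index c h k x)"
        using x by (auto simp: V_def mem_grid_cube[OF assms(1)])
      then show "x \<in> grid_union c h V" by blast
    qed
    have "2 * emeasure lebesgue N \<le> 2 * emeasure lebesgue (grid_union c h V \<inter> E)"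
      using \<open>N \<subseteq> grid_union c h V\<close> assms(2) by (intro mult_left_mono emeasure_mono sets.Int) (auto simp: N_def)
    also have "\<dots> = 2 * emeasure (density lebesgue (indicator E)) (grid_union c h V)"
      using assms(2) by (simp add: emeasure_density_indicator)
    also have "\<dots> \<le> emeasure lebesgue (grid_union c h V)"
    proof (rule grid_union_emeasure_mono[OF assms(1)])
      fix k z assume kz: "(k, z) \<in> V"
      then have "grid_cube c h k z \<subseteq> cube c h"
        using NQ by (intro grid_cube_subset_cube[OF assms(1)]) (auto simp: V_def)
      moreover have "(k, z) \<notin> ?S" using kz by (auto simp: V_def N_def)
      ultimately have *: "2 * 2 ^ CARD('n) * emeasure lebesgue (grid_cube c h k z \<inter> E) \<le> emeasure lebesgue (grid_cube c h k z)"
        by (auto simp: stopping_indices_def not_less)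
      have "1 * (2 * emeasure lebesgue (grid_cube c h k z \<inter> E)) \<le> 2 ^ CARD('n) * (2 * emeasure lebesgue (grid_cube c h k z \<inter> E))"
        by (intro mult_right_mono one_le_power) auto
      with * show "2 * emeasure (density lebesgue (indicator E)) (grid_cube c h k z) \<le> emeasure lebesgue (grid_cube c h k z)"
        using assms(2) by (simp add: emeasure_density_indicator mult_ac)
    qed auto
    also have "\<dots> \<le> emeasure lebesgue (N \<union> (T - N))"
      using T(1,2) N by (intro emeasure_mono sets.Un sets.Diff) (auto simp: V_def)
    also have "\<dots> \<le> emeasure lebesgue N + emeasure lebesgue (T - N)"
      using T(1) N by (intro emeasure_subadditive sets.Diff) auto
    also have "\<dots> \<le> emeasure lebesgue N + ennreal e" using T(3) by (intro add_left_mono) simp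
    finally have "2 * emeasure lebesgue N \<le> emeasure lebesgue N + ennreal e" .
    then have "ennreal (2 * measure lebesgue N) \<le> ennreal (measure lebesgue N + e)"
      using fin \<open>0 < e\<close> by (simp add: emeasure_eq_ennreal_measure top.not_eq_extremum ennreal_mult' ennreal_plus)
    then show ?thesis using \<open>0 < e\<close> by (subst (asm) ennreal_le_iff) auto
  qed
  have "measure lebesgue N \<le> 0" by (rule field_le_epsilon) (simp add: small)
  then have "emeasure lebesgue N = 0"
    using fin by (simp add: emeasure_eq_ennreal_measure top.not_eq_extremum measure_le_0_iff)
  then show ?thesis using N by (simp add: null_sets_def N_def)
qed

subsection \<open>Oscillation estimates\<close>

lemma ennreal_divide_le_iff:
  assumes "0 < v"
  shows "X / ennreal v \<le> Y \<longleftrightarrow> X \<le> Y * ennreal v"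
proof
  assume "X / ennreal v \<le> Y"
  then have "X / ennreal v * ennreal v \<le> Y * ennreal v" by (rule mult_right_mono) simp
  then show "X \<le> Y * ennreal v"
    using assms by (simp add: ennreal_divide_times ennreal_mult_divide_eq)
next
  assume "X \<le> Y * ennreal v"
  then show "X / ennreal v \<le> Y"
    using assms by (metis divide_le_posI_ennreal ennreal_less_zero_iff mult.commute)
qed

lemma ennpow_le_iff:
  assumes "0 < r" "0 \<le> K"
  shows "ennpow x (1 / r) \<le> ennreal K \<longleftrightarrow> x \<le> ennreal (K powr r)"
proof (cases x rule: ennreal_cases)
  case (real v)
  have "v powr (1 / r) \<le> K \<longleftrightarrow> v \<le> K powr r"
  proof
    assume "v powr (1 / r) \<le> K"
    then have "(v powr (1 / r)) powr r \<le> K powr r" using assms by (intro powr_mono2) auto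
    then show "v \<le> K powr r" using assms real by (simp add: powr_powr)
  next
    assume "v \<le> K powr r"
    then have "v powr (1 / r) \<le> (K powr r) powr (1 / r)" using assms real by (intro powr_mono2) auto
    then show "v powr (1 / r) \<le> K" using assms by (simp add: powr_powr)
  qed
  then show ?thesis using real assms by (simp add: ennpow_def)
qed (simp add: ennpow_def top_unique)

lemma avg_le_iff:
  fixes c :: "real ^ 'n"
  assumes "0 < r" "0 \<le> K" "0 < h"
  shows "avg r (cube c h) F \<le> ennreal K \<longleftrightarrow>
    (\<integral>\<^sup>+x\<in>cube c h. ennreal (F x powr r) \<partial>lebesgue) \<le> ennreal (K powr r) * emeasure lebesgue (cube c h)"
  using assms unfolding avg_def by (simp only: ennpow_le_iff emeasure_cube ennreal_divide_le_iff zero_less_power mult_pos_pos zero_less_numeral)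

lemma conj_exponent_ge_1: "1 < q \<Longrightarrow> 1 \<le> conj_exponent q"
proof (cases q rule: ennreal_cases)
  case (real r)
  then show "1 < q \<Longrightarrow> 1 \<le> conj_exponent q"
    by (simp add: conj_exponent_def field_simps)
qed (simp add: conj_exponent_def)

text \<open>Whichever of b and a^(q-1) is larger decides which of the two terms dominates. The
  inequality takes the place of Hoelder's, the normalisation being left to the parameters by which
  the two factors are divided.\<close>

lemma young_type:
  fixes a b q :: real
  assumes "0 \<le> a" "0 \<le> b" "1 < q"
  shows "a * b \<le> a powr q + b powr (q / (q - 1))"
proof (cases "b \<le> a powr (q - 1)")
  case True
  then have "a * b \<le> a * a powr (q - 1)" using assms by (intro mult_left_mono) auto
  also have "\<dots> = a powr q"
    using assms by (cases "a = 0") (auto simp: powr_mult_base)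
  finally show ?thesis using powr_ge_zero[of b "q / (q - 1)"] by linarith
next
  case False
  then have "(a powr (q - 1)) powr (1 / (q - 1)) \<le> b powr (1 / (q - 1))"
    using assms by (intro powr_mono2) auto
  then have "a \<le> b powr (1 / (q - 1))" using assms by (simp add: powr_powr)
  then have "a * b \<le> b * b powr (1 / (q - 1))" using assms by (metis mult.commute mult_right_mono)
  also have "\<dots> = b powr (1 + 1 / (q - 1))"
    using assms False by (cases "b = 0") (auto simp: powr_mult_base)
  also have "1 + 1 / (q - 1) = q / (q - 1)" using assms by (simp add: field_simps)
  finally show ?thesis using powr_ge_zero[of a q] by linarith
qed

lemma le_one_plus_powr:
  fixes b r :: real
  assumes "0 \<le> b" "1 \<le> r"
  shows "b \<le> 1 + b powr r"
proof (cases "b \<le> 1")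
  case False
  then have "b powr 1 \<le> b powr r" using assms by (intro powr_mono) auto
  then show ?thesis using False by simp
qed (use powr_ge_zero[of b r] in linarith)

lemma measurable_lebesgue_onI:
  "f \<in> borel_measurable lebesgue \<Longrightarrow> f \<in> borel_measurable (lebesgue_on S)"
  by (rule measurable_restrict_space1)

lemma nn_integral_lebesgue_on:
  "A \<in> sets lebesgue \<Longrightarrow> (\<integral>\<^sup>+x. f x \<partial>lebesgue_on A) = (\<integral>\<^sup>+x\<in>A. f x \<partial>lebesgue)"
  by (subst nn_integral_restrict_space) auto

text \<open>Young's inequality for |u x - u y| / K and G x / \<tau>. For finite q the oscillation
  bound says that the q-th power of the first has average at most 1 over pairs, and the other term
  does not depend on y. For q infinite the first factor is at most 1 almost everywhere.\<close>

lemma osc_double_integral: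
  fixes u :: "real ^ 'n \<Rightarrow> 'k::{real_normed_field, euclidean_space}" and c :: "real ^ 'n"
  assumes e: "0 < e" and u: "u \<in> borel_measurable lebesgue"
    and G: "G \<in> borel_measurable lebesgue" "\<And>x. 0 \<le> G x"
    and q: "1 < q" and K: "0 \<le> K" "osc q (cube c e) u \<le> ennreal K" and \<tau>: "0 < \<tau>"
  defines "L \<equiv> lebesgue_on (cube c e)"
  shows "(\<integral>\<^sup>+x. \<integral>\<^sup>+y. ennreal (norm (u x - u y) * G x) \<partial>L \<partial>L) \<le>
    ennreal (K * \<tau>) * emeasure lebesgue (cube c e) *
      (\<integral>\<^sup>+x. ennreal (1 + (G x / \<tau>) powr conj_exponent q) \<partial>L)"
proof -
  interpret L: finite_measure L
    unfolding L_def by (rule finite_measure_lebesgue_on) (rule cube_lmeasurable[OF e])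
  interpret LL: pair_sigma_finite L L ..
  let ?r = "conj_exponent q"
  define P where "P = emeasure lebesgue (cube c e)"
  define v where "v = (2 * e) ^ CARD('n)"
  have v: "0 < v" "P = ennreal v" using e by (simp_all add: v_def P_def emeasure_cube)
  have uL [measurable]: "u \<in> borel_measurable L" and GL [measurable]: "G \<in> borel_measurable L"
    unfolding L_def using u G by (auto intro: measurable_lebesgue_onI)
  have spL: "emeasure L (space L) = P"
    unfolding L_def P_def by (simp add: emeasure_restrict_space space_restrict_space)
  define I where "I = (\<integral>\<^sup>+x. ennreal ((G x / \<tau>) powr ?r) \<partial>L)"
  have Gam: "(\<integral>\<^sup>+x. ennreal (1 + (G x / \<tau>) powr ?r) \<partial>L) = P + I"
    by (simp add: ennreal_plus nn_integral_add spL I_def)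
  define D where "D = (\<lambda>(x, y). norm (u x - u y))"
  have D [measurable]: "D \<in> borel_measurable (L \<Otimes>\<^sub>M L)" unfolding D_def by measurable
  have D0: "0 \<le> D z" for z by (simp add: D_def case_prod_unfold)
  have fst: "(\<integral>\<^sup>+z. ennreal ((G (fst z) / \<tau>) powr ?r) \<partial>(L \<Otimes>\<^sub>M L)) = P * I"
    by (subst L.nn_integral_fst[symmetric]) (simp_all add: spL I_def nn_integral_cmult mult.commute)
  have lhs: "(\<integral>\<^sup>+x. \<integral>\<^sup>+y. ennreal (norm (u x - u y) * G x) \<partial>L \<partial>L) =
      (\<integral>\<^sup>+z. ennreal (D z * G (fst z)) \<partial>(L \<Otimes>\<^sub>M L))"
    by (subst L.nn_integral_fst[symmetric]) (simp_all add: D_def)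
  have pair_space: "emeasure (L \<Otimes>\<^sub>M L) (space (L \<Otimes>\<^sub>M L)) = P * P"
    by (simp add: space_pair_measure L.emeasure_pair_measure_Times spL)
  show ?thesis
  proof (cases "q = \<infinity>")
    case True
    then have "AE z in L \<Otimes>\<^sub>M L. ennreal (D z) \<le> ennreal K"
      using esssup_AE[of "\<lambda>z. ennreal (D z)" "L \<Otimes>\<^sub>M L"] K(2)
      by (auto simp: osc_def L_def[symmetric] D_def case_prod_unfold elim!: eventually_mono)
    then have AE: "AE z in L \<Otimes>\<^sub>M L. D z \<le> K" using K by simp
    have r: "?r = 1" using True by (simp add: conj_exponent_def)
    have "(\<integral>\<^sup>+z. ennreal (D z * G (fst z)) \<partial>(L \<Otimes>\<^sub>M L)) \<le>
      (\<integral>\<^sup>+z. ennreal (K * \<tau>) * ennreal ((G (fst z) / \<tau>) powr ?r) \<partial>(L \<Otimes>\<^sub>M L))"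
    proof (rule nn_integral_mono_AE, use AE in eventually_elim)
      case (elim z)
      then have "D z * G (fst z) \<le> K * \<tau> * (G (fst z) / \<tau>)"
        using G(2) \<tau> by (simp add: mult_right_mono)
      then show ?case using G(2) \<tau> K by (simp add: r ennreal_mult'[symmetric])
    qed
    also have "\<dots> = ennreal (K * \<tau>) * (P * I)" by (simp add: nn_integral_cmult fst)
    also have "\<dots> \<le> ennreal (K * \<tau>) * P * (P + I)" by (simp add: mult.assoc mult_left_mono)
    finally show ?thesis unfolding lhs Gam P_def .
  next
    case False
    then obtain s where s: "q = ennreal s" "1 < s"
      using q by (cases q rule: ennreal_cases) auto
    have r: "?r = s / (s - 1)" using s by (simp add: conj_exponent_def)
    have "ennpow ((\<integral>\<^sup>+z. ennreal (D z powr s) \<partial>(L \<Otimes>\<^sub>M L)) / P\<^sup>2) (1 / s) \<le> ennreal K"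
      using K(2) s False by (simp add: osc_def L_def[symmetric] P_def D_def case_prod_unfold)
    then have Ds: "(\<integral>\<^sup>+z. ennreal (D z powr s) \<partial>(L \<Otimes>\<^sub>M L)) \<le> ennreal (K powr s) * (P * P)"
      using s K v by (simp add: ennpow_le_iff ennreal_divide_le_iff power2_eq_square flip: ennreal_mult)
    show ?thesis
    proof (cases "K = 0")
      \<comment> \<open>The normalisation divides by \<open>K\<close>. For K = 0 the values u x and
        u y agree for almost all pairs, so the left-hand side vanishes.\<close>
      case True
      then have "(\<integral>\<^sup>+z. ennreal (D z powr s) \<partial>(L \<Otimes>\<^sub>M L)) = 0" using Ds s by simp
      then have "AE z in L \<Otimes>\<^sub>M L. ennreal (D z powr s) = 0"
        by (subst (asm) nn_integral_0_iff_AE) simp_all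
      then have "AE z in L \<Otimes>\<^sub>M L. D z = 0"
      proof eventually_elim
        case (elim z)
        then have "D z powr s \<le> 0" by (simp only: ennreal_eq_0_iff)
        then have "D z powr s = 0" using powr_ge_zero[of "D z" s] by (rule antisym)
        then show ?case by (simp only: powr_eq_0_iff)
      qed
      then have "(\<integral>\<^sup>+z. ennreal (D z * G (fst z)) \<partial>(L \<Otimes>\<^sub>M L)) = 0"
        by (subst nn_integral_0_iff_AE) (auto elim!: eventually_mono)
      then show ?thesis unfolding lhs by simp
    next
      case False
      then have Kpos: "0 < K" using K by simp
      have "(\<integral>\<^sup>+z. ennreal (D z * G (fst z)) \<partial>(L \<Otimes>\<^sub>M L)) \<le>
        (\<integral>\<^sup>+z. ennreal (K * \<tau>) * (ennreal (1 / K powr s) * ennreal (D z powr s) + ennreal ((G (fst z) / \<tau>) powr ?r)) \<partial>(L \<Otimes>\<^sub>M L))"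
      proof (rule nn_integral_mono)
        fix z
        have "(D z / K) * (G (fst z) / \<tau>) \<le> (D z / K) powr s + (G (fst z) / \<tau>) powr ?r"
          unfolding r using D0 G(2) Kpos \<tau> s by (intro young_type) auto
        then have "K * \<tau> * ((D z / K) * (G (fst z) / \<tau>)) \<le> K * \<tau> * ((D z / K) powr s + (G (fst z) / \<tau>) powr ?r)"
          using Kpos \<tau> by (intro mult_left_mono) auto
        also have "K * \<tau> * ((D z / K) * (G (fst z) / \<tau>)) = D z * G (fst z)"
          using Kpos \<tau> by simp
        also have "(D z / K) powr s = 1 / K powr s * D z powr s"
          using Kpos D0 by (simp add: powr_divide)
        finally have "ennreal (D z * G (fst z)) \<le> ennreal (K * \<tau> * (1 / K powr s * D z powr s + (G (fst z) / \<tau>) powr ?r))"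
          by (rule ennreal_leI)
        also have "\<dots> = ennreal (K * \<tau>) * (ennreal (1 / K powr s) * ennreal (D z powr s) + ennreal ((G (fst z) / \<tau>) powr ?r))"
        proof -
          have "ennreal (t * (k * X + Y)) = ennreal t * (ennreal k * ennreal X + ennreal Y)"
            if "0 \<le> t" "0 \<le> k" "0 \<le> X" "0 \<le> Y" for t k X Y :: real
            using that by (simp add: ennreal_mult ennreal_plus)
          then show ?thesis using Kpos \<tau> by (simp only: mult_nonneg_nonneg less_imp_le powr_ge_zero divide_nonneg_nonneg zero_le_one)
        qed
        finally show "ennreal (D z * G (fst z)) \<le> \<dots>" .
      qed
      also have "\<dots> = ennreal (K * \<tau>) * (ennreal (1 / K powr s) * (\<integral>\<^sup>+z. ennreal (D z powr s) \<partial>(L \<Otimes>\<^sub>M L)) + P * I)"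
        by (simp add: nn_integral_cmult nn_integral_add fst)
      also have "\<dots> \<le> ennreal (K * \<tau>) * (ennreal (1 / K powr s) * (ennreal (K powr s) * (P * P)) + P * I)"
        using Ds by (intro mult_left_mono add_right_mono) auto
      also have "ennreal (1 / K powr s) * (ennreal (K powr s) * (P * P)) = P * P"
        using Kpos by (simp add: mult.assoc[symmetric] ennreal_mult'[symmetric])
      also have "ennreal (K * \<tau>) * (P * P + P * I) = ennreal (K * \<tau>) * P * (P + I)"
        by (simp add: algebra_simps)
      finally show ?thesis unfolding lhs Gam P_def .
    qed
  qed
qed

text \<open>For y in \<open>H\<close>, |u x| \<le> |u x - u y| + B. Averaging over y in
  \<open>H\<close> costs the ratio of the measures of the cube and \<open>H\<close>, which is the 4
  in front of \<open>K\<close>. The summand 1 in the weight makes it dominate G / \<tau>, so that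
  the term with \<open>B\<close> is covered too.\<close>

lemma oscillation_estimate:
  fixes u :: "real ^ 'n \<Rightarrow> 'k::{real_normed_field, euclidean_space}" and c :: "real ^ 'n"
  assumes e: "0 < e" and u: "u \<in> borel_measurable lebesgue"
    and G: "G \<in> borel_measurable lebesgue" "\<And>x. 0 \<le> G x"
    and q: "1 < q" and K: "0 \<le> K" "osc q (cube c e) u \<le> ennreal K" and \<tau>: "0 < \<tau>"
    and H: "H \<in> sets lebesgue" "H \<subseteq> cube c e" "emeasure lebesgue (cube c e) \<le> 4 * emeasure lebesgue H"
    and B: "0 \<le> B" "\<And>y. y \<in> H \<Longrightarrow> norm (u y) \<le> B"
  shows "(\<integral>\<^sup>+x\<in>cube c e. ennreal (norm (u x) * G x) \<partial>lebesgue) \<le>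
    ennreal ((4 * K + B) * \<tau>) * (\<integral>\<^sup>+x\<in>cube c e. ennreal (1 + (G x / \<tau>) powr conj_exponent q) \<partial>lebesgue)"
proof -
  let ?r = "conj_exponent q"
  define L where "L = lebesgue_on (cube c e)"
  have [measurable]: "u \<in> borel_measurable L" "G \<in> borel_measurable L"
    unfolding L_def using u G by (auto intro: measurable_lebesgue_onI)
  interpret L: finite_measure L
    unfolding L_def by (rule finite_measure_lebesgue_on) (rule cube_lmeasurable[OF e])
  interpret LL: pair_sigma_finite L L ..
  define J where "J = (\<integral>\<^sup>+x. ennreal (1 + (G x / \<tau>) powr ?r) \<partial>L)"
  define v where "v = (2 * e) ^ CARD('n)"
  have v: "0 < v" "emeasure lebesgue (cube c e) = ennreal v" using e by (simp_all add: v_def emeasure_cube)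
  have Hfin: "emeasure lebesgue H \<noteq> \<infinity>"
    using emeasure_mono[OF H(2) cube_lebesgue] v by (auto simp: top_unique)
  define w where "w = measure lebesgue H"
  have Hw: "emeasure lebesgue H = ennreal w"
    using Hfin by (simp add: w_def emeasure_eq_ennreal_measure)
  have w: "v \<le> 4 * w" "0 < w"
  proof -
    have "ennreal v \<le> ennreal (4 * w)" using H(3) v Hw by (simp add: w_def ennreal_mult')
    then show "v \<le> 4 * w" by (subst (asm) ennreal_le_iff) (auto simp: w_def)
    then show "0 < w" using v by simp
  qed
  have pt: "ennreal (norm (u x) * G x) \<le>
    ennreal (4 / v) * (\<integral>\<^sup>+y. ennreal (norm (u x - u y) * G x) \<partial>L) + ennreal B * ennreal (G x)" for x
  proof -
    have HL: "H \<in> sets L" using H by (simp add: L_def sets_restrict_space_iff)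
    have eH: "emeasure L H = ennreal w" using H Hw by (simp add: L_def emeasure_restrict_space)
    have "ennreal (norm (u x) * G x) * ennreal w = (\<integral>\<^sup>+y\<in>H. ennreal (norm (u x) * G x) \<partial>L)"
      using HL by (simp add: nn_integral_cmult eH)
    also have "\<dots> \<le> (\<integral>\<^sup>+y. ennreal (norm (u x - u y) * G x) + ennreal (B * G x) * indicator H y \<partial>L)"
    proof (rule nn_integral_mono)
      fix y
      show "ennreal (norm (u x) * G x) * indicator H y \<le> ennreal (norm (u x - u y) * G x) + ennreal (B * G x) * indicator H y"
      proof (cases "y \<in> H")
        case True
        have "norm (u x) \<le> norm (u x - u y) + B"
          using B(2)[OF True] norm_triangle_ineq2[of "u x" "u y"] by linarith
        then have "norm (u x) * G x \<le> norm (u x - u y) * G x + B * G x"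
          using G(2)[of x] by (metis distrib_right mult_right_mono)
        then show ?thesis using True G(2) B(1) by (simp add: ennreal_leI flip: ennreal_plus)
      qed simp
    qed
    also have "\<dots> = (\<integral>\<^sup>+y. ennreal (norm (u x - u y) * G x) \<partial>L) + ennreal (B * G x) * ennreal w"
      using HL by (simp add: nn_integral_add nn_integral_cmult eH)
    finally have "ennreal (norm (u x) * G x) * ennreal w * ennreal (1 / w) \<le>
      ((\<integral>\<^sup>+y. ennreal (norm (u x - u y) * G x) \<partial>L) + ennreal (B * G x) * ennreal w) * ennreal (1 / w)"
      by (rule mult_right_mono) simp
    moreover have "ennreal t * ennreal w * ennreal (1 / w) = ennreal t" if "0 \<le> t" for t
      using w that by (simp add: ennreal_mult'[symmetric] ennreal_mult''[symmetric])
    ultimately have "ennreal (norm (u x) * G x) \<le> (\<integral>\<^sup>+y. ennreal (norm (u x - u y) * G x) \<partial>L) * ennreal (1 / w) + ennreal (B * G x)"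
      using G(2)[of x] B(1) by (simp add: distrib_right)
    also have "\<dots> \<le> (\<integral>\<^sup>+y. ennreal (norm (u x - u y) * G x) \<partial>L) * ennreal (4 / v) + ennreal (B * G x)"
      using w v by (intro add_right_mono mult_left_mono ennreal_leI) (auto simp: field_simps)
    finally show ?thesis using B G(2) by (simp add: ennreal_mult' mult.commute)
  qed
  have "(\<integral>\<^sup>+x. ennreal (norm (u x) * G x) \<partial>L) \<le>
    (\<integral>\<^sup>+x. ennreal (4 / v) * (\<integral>\<^sup>+y. ennreal (norm (u x - u y) * G x) \<partial>L) + ennreal B * ennreal (G x) \<partial>L)"
    using pt by (rule nn_integral_mono)
  also have "\<dots> = ennreal (4 / v) * (\<integral>\<^sup>+x. \<integral>\<^sup>+y. ennreal (norm (u x - u y) * G x) \<partial>L \<partial>L) + ennreal B * (\<integral>\<^sup>+x. ennreal (G x) \<partial>L)"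
    by (subst nn_integral_add) (auto simp: nn_integral_cmult)
  also have "\<dots> \<le> ennreal (4 / v) * (ennreal (K * \<tau>) * ennreal v * J) + ennreal B * (ennreal \<tau> * J)"
  proof (intro add_mono mult_left_mono)
    show "(\<integral>\<^sup>+x. \<integral>\<^sup>+y. ennreal (norm (u x - u y) * G x) \<partial>L \<partial>L) \<le> ennreal (K * \<tau>) * ennreal v * J"
      using osc_double_integral[OF e u G q K \<tau>] by (simp add: L_def J_def v(2))
    have "(\<integral>\<^sup>+x. ennreal (G x) \<partial>L) \<le> (\<integral>\<^sup>+x. ennreal \<tau> * ennreal (1 + (G x / \<tau>) powr ?r) \<partial>L)"
    proof (rule nn_integral_mono)
      fix x
      have "\<tau> * (G x / \<tau>) \<le> \<tau> * (1 + (G x / \<tau>) powr ?r)"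
        using \<tau> G(2)[of x] conj_exponent_ge_1[OF q] by (intro mult_left_mono le_one_plus_powr) auto
      then show "ennreal (G x) \<le> ennreal \<tau> * ennreal (1 + (G x / \<tau>) powr ?r)"
        using \<tau> by (simp add: ennreal_leI ennreal_mult'[symmetric] del: ennreal_plus)
    qed
    then show "(\<integral>\<^sup>+x. ennreal (G x) \<partial>L) \<le> ennreal \<tau> * J" by (simp add: J_def nn_integral_cmult)
  qed auto
  also have "\<dots> = ennreal ((4 * K + B) * \<tau>) * J"
  proof -
    have 1: "ennreal (4 / v * (K * \<tau> * v)) = ennreal (4 / v) * (ennreal (K * \<tau>) * ennreal v)"
      using v K \<tau> by (simp only: ennreal_mult mult_nonneg_nonneg less_imp_le divide_nonneg_nonneg zero_le_numeral)
    have 2: "ennreal (B * \<tau>) = ennreal B * ennreal \<tau>"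
      using B \<tau> by (simp only: ennreal_mult less_imp_le)
    have "(4 * K + B) * \<tau> = 4 / v * (K * \<tau> * v) + B * \<tau>" using v by (simp add: field_simps)
    then have "ennreal ((4 * K + B) * \<tau>) = ennreal (4 / v * (K * \<tau> * v)) + ennreal (B * \<tau>)"
      using v K \<tau> B by (simp only: ennreal_plus mult_nonneg_nonneg less_imp_le divide_nonneg_nonneg zero_le_numeral)
    then show ?thesis unfolding 1 2 by (simp only: distrib_right mult.assoc)
  qed
  finally show ?thesis unfolding J_def L_def by (simp add: nn_integral_lebesgue_on)
qed

subsection \<open>The estimate on a single cube\<close>

lemma cutoff_measurable:
  "A \<in> sets lebesgue \<Longrightarrow> f \<in> borel_measurable lebesgue \<Longrightarrow> cutoff A f \<in> borel_measurable lebesgue"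
  unfolding cutoff_def by (intro measurable_If_set) auto

lemma Lp_c_iff:
  "f \<in> Lp_c p \<longleftrightarrow> f \<in> borel_measurable lebesgue \<and>
    (\<integral>\<^sup>+x. ennreal (norm (f x) powr p) \<partial>lebesgue) < \<infinity> \<and> compact (closure {x. f x \<noteq> 0})"
  by (simp add: Lp_c_def Lp_on_def lebesgue_on_UNIV_eq)

lemma Lp_c_dominated:
  assumes "f \<in> Lp_c p" "g \<in> borel_measurable lebesgue" "0 \<le> C" "0 \<le> p"
    and le: "\<And>x. norm (g x) \<le> C * norm (f x)"
  shows "g \<in> Lp_c p"
proof -
  have "(\<integral>\<^sup>+x. ennreal (norm (g x) powr p) \<partial>lebesgue) \<le> (\<integral>\<^sup>+x. ennreal (C powr p) * ennreal (norm (f x) powr p) \<partial>lebesgue)"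
    using le assms(3,4) by (intro nn_integral_mono) (auto simp: ennreal_mult'[symmetric] powr_mult[symmetric] intro!: ennreal_leI powr_mono2)
  also have "\<dots> = ennreal (C powr p) * (\<integral>\<^sup>+x. ennreal (norm (f x) powr p) \<partial>lebesgue)"
    using assms(1) by (intro nn_integral_cmult) (auto simp: Lp_c_iff)
  also have "\<dots> < \<infinity>" using assms(1) by (auto simp: Lp_c_iff ennreal_mult_less_top)
  finally have "(\<integral>\<^sup>+x. ennreal (norm (g x) powr p) \<partial>lebesgue) < \<infinity>" .
  moreover have "{x. g x \<noteq> 0} \<subseteq> {x. f x \<noteq> 0}"
  proof clarsimp
    fix x assume "g x \<noteq> 0" "f x = 0"
    then show False using le[of x] by simp
  qed
  ultimately show ?thesis
    using assms(1,2) by (auto simp: Lp_c_iff intro: bounded_subset)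
qed

lemma Lp_c_cutoff: "f \<in> Lp_c p \<Longrightarrow> A \<in> sets lebesgue \<Longrightarrow> 0 \<le> p \<Longrightarrow> cutoff A f \<in> Lp_c p"
  by (rule Lp_c_dominated[of f p _ 1]) (auto simp: Lp_c_iff cutoff_measurable, simp add: cutoff_def)

lemma Lp_c_cmult:
  fixes f :: "real ^ 'n \<Rightarrow> 'k::{real_normed_field, euclidean_space}"
  shows "f \<in> Lp_c p \<Longrightarrow> 0 \<le> p \<Longrightarrow> (\<lambda>x. c * f x) \<in> Lp_c p"
  by (rule Lp_c_dominated[of f p _ "norm c"]) (auto simp: Lp_c_iff norm_mult)

lemma Lp_c_imp_Lp_on:
  assumes "f \<in> Lp_c p" "A \<in> sets lebesgue"
  shows "f \<in> Lp_on p A"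
proof -
  have "(\<integral>\<^sup>+x\<in>A. ennreal (norm (f x) powr p) \<partial>lebesgue) \<le> (\<integral>\<^sup>+x. ennreal (norm (f x) powr p) \<partial>lebesgue)"
    by (intro nn_integral_mono) (auto simp: indicator_def)
  then show ?thesis
    using assms by (auto simp: Lp_c_iff Lp_on_def intro: measurable_lebesgue_onI)
qed

lemma ennpow_finite: "x \<noteq> \<infinity> \<Longrightarrow> ennpow x r < \<infinity>"
  by (simp add: ennpow_def)

lemma avg_finite:
  fixes c :: "real ^ 'n"
  assumes "f \<in> Lp_c p" "0 < h"
  shows "avg p (cube c h) (\<lambda>x. norm (f x)) < \<infinity>"
proof -
  let ?I = "\<integral>\<^sup>+x\<in>cube c h. ennreal (norm (f x) powr p) \<partial>lebesgue"
  have fin: "?I < \<infinity>"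
    using Lp_c_imp_Lp_on[OF assms(1), of "cube c h"] by (simp add: Lp_on_def)
  have quot: "x / ennreal v \<noteq> \<infinity>" if "0 < v" "x < \<infinity>" for x v
    using that ennreal_divide_eq_top_iff[of x "ennreal v"] by (metis ennreal_eq_0_iff infinity_ennreal_def not_less order.irrefl)
  have "0 < (2 * h) ^ CARD('n)" using assms(2) by simp
  from quot[OF this fin] have "?I / emeasure lebesgue (cube c h) \<noteq> \<infinity>"
    unfolding emeasure_cube[OF assms(2)] .
  then show ?thesis
    unfolding avg_def by (rule ennpow_finite)
qed

lemma locally_weak_bounded_nonneg:
  "locally_weak_bounded p \<alpha> U \<phi> \<Longrightarrow> t \<in> {0<..<1} \<Longrightarrow> 0 \<le> \<phi> t"
  unfolding locally_weak_bounded_def by (elim conjE) (rule bspec)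

lemma weak_bound_set:
  fixes c :: "real ^ 'n"
  assumes "locally_weak_bounded p \<alpha> U \<phi>" "t \<in> {0<..<1}" "0 < h" "f \<in> Lp_c p"
    and "avg p (cube c h) (\<lambda>x. norm (f x)) = ennreal a" "0 \<le> a"
  defines "A \<equiv> {x \<in> cube c h. U (cutoff (cube c h) f) x >
    ennreal (\<phi> t * a * measure lebesgue (cube c h) powr (\<alpha> / real CARD('n)))}"
  shows "A \<in> sets lebesgue" "emeasure lebesgue A \<le> ennreal t * emeasure lebesgue (cube c h)"
proof -
  have phi: "0 \<le> \<phi> t" using assms(1,2) by (rule locally_weak_bounded_nonneg)
  have "is_cube (cube c h)" using assms(3) by (auto simp: is_cube_def)
  moreover have "f \<in> Lp_on p (cube c h)" using assms(4) by (intro Lp_c_imp_Lp_on) auto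
  ultimately have weak: "let A = {x \<in> cube c h. U (cutoff (cube c h) f) x >
        ennreal (\<phi> t) * avg p (cube c h) (\<lambda>x. norm (f x)) * ennreal (measure lebesgue (cube c h) powr (\<alpha> / real CARD('n)))}
      in A \<in> sets lebesgue \<and> emeasure lebesgue A \<le> ennreal t * emeasure lebesgue (cube c h)"
    using assms(1,2) unfolding locally_weak_bounded_def by blast
  have level: "ennreal (\<phi> t) * ennreal a * ennreal (measure lebesgue (cube c h) powr (\<alpha> / real CARD('n))) =
    ennreal (\<phi> t * a * measure lebesgue (cube c h) powr (\<alpha> / real CARD('n)))"
    using phi assms(6) by (simp add: ennreal_mult)
  note weak' = weak[unfolded Let_def assms(5) level, folded A_def]
  show "A \<in> sets lebesgue" "emeasure lebesgue A \<le> ennreal t * emeasure lebesgue (cube c h)"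
    by (rule conjunct1[OF weak'], rule conjunct2[OF weak'])
qed

text \<open>The first bound estimates the part away from \<open>B\<close> where both other terms are
  under control; the second one passes the part in \<open>B\<close> on to the next generation.
  Subtraction is possible because |T (-f)| = |T f|.\<close>

lemma sublinear_difference:
  fixes T :: "(real ^ 'n \<Rightarrow> 'k::{real_normed_field, euclidean_space}) \<Rightarrow> real ^ 'n \<Rightarrow> 'k"
  assumes T: "sublinear_operator_on (Lp_c p) T" and "0 \<le> p" and F: "F \<in> Lp_c p"
    and AB: "A \<in> sets lebesgue" "B \<in> sets lebesgue" "B \<subseteq> A"
  shows "norm (T (cutoff (- B) (cutoff A F)) x) \<le> norm (T (cutoff A F) x) + norm (T (cutoff B F) x)"
    "norm (T (cutoff A F) x) \<le> norm (T (cutoff (- B) (cutoff A F)) x) + norm (T (cutoff B F) x)"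
proof -
  have cA: "cutoff A F \<in> Lp_c p" and cB: "cutoff B F \<in> Lp_c p" and cAB: "cutoff (- B) (cutoff A F) \<in> Lp_c p"
    using assms by (auto intro!: Lp_c_cutoff simp: Compl_in_sets_lebesgue)
  have add: "norm (T (\<lambda>y. f y + g y) x) \<le> norm (T f x) + norm (T g x)"
    and mult: "norm (T (\<lambda>y. c * f y) x) = norm c * norm (T f x)" if "f \<in> Lp_c p" "g \<in> Lp_c p" for f g c
    using T that by (auto simp: sublinear_operator_on_def)
  have "cutoff (- B) (cutoff A F) = (\<lambda>y. cutoff A F y + - 1 * cutoff B F y)"
    using AB(3) by (auto simp: cutoff_def fun_eq_iff)
  then have "norm (T (cutoff (- B) (cutoff A F)) x) \<le> norm (T (cutoff A F) x) + norm (T (\<lambda>y. - 1 * cutoff B F y) x)"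
    using add[OF cA Lp_c_cmult[OF cB \<open>0 \<le> p\<close>, of "- 1"]] by simp
  also have "norm (T (\<lambda>y. - 1 * cutoff B F y) x) = norm (T (cutoff B F) x)"
    using mult[OF cB cB, of "- 1"] by simp
  finally show "norm (T (cutoff (- B) (cutoff A F)) x) \<le> norm (T (cutoff A F) x) + norm (T (cutoff B F) x)" .
  have "cutoff A F = (\<lambda>y. cutoff (- B) (cutoff A F) y + cutoff B F y)"
    using AB(3) by (auto simp: cutoff_def fun_eq_iff)
  then show "norm (T (cutoff A F) x) \<le> norm (T (cutoff (- B) (cutoff A F)) x) + norm (T (cutoff B F) x)"
    using add[OF cAB cB] by simp
qed

lemma cube_subset_imp_triple_subset:
  fixes c :: "real ^ 'n"
  assumes "0 < e" "0 < h" "cube d e \<subseteq> cube c h"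
  shows "e \<le> h" "cube d (3 * e) \<subseteq> cube c (3 * h)"
proof -
  have lower: "c $ i - h \<le> d $ i - e" for i
  proof -
    have "(\<chi> j. d $ j - e) \<in> cube d e" using assms(1) by (simp add: cube_def)
    then have "(\<chi> j. d $ j - e) \<in> cube c h" using assms(3) by blast
    then show ?thesis by (simp add: cube_def)
  qed
  have upper: "d $ i + e \<le> c $ i + h" for i
  proof (rule dense_le_bounded[of "d $ i"])
    fix w assume "d $ i < w" "w < d $ i + e"
    then have "(\<chi> j. if j = i then w else d $ j) \<in> cube d e" using assms(1) by (simp add: cube_def)
    then have "(\<chi> j. if j = i then w else d $ j) \<in> cube c h" using assms(3) by blast
    then show "w \<le> c $ i + h" by (auto simp: cube_def dest!: spec[of _ i])
  qed (use assms in simp)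
  show "e \<le> h" using lower[of undefined] upper[of undefined] by linarith
  show "cube d (3 * e) \<subseteq> cube c (3 * h)"
  proof
    fix y assume y: "y \<in> cube d (3 * e)"
    have "c $ i - 3 * h \<le> y $ i \<and> y $ i < c $ i + 3 * h" for i
      using y lower[of i] upper[of i] \<open>e \<le> h\<close> unfolding cube_def by (auto dest!: spec[of _ i])
    then show "y \<in> cube c (3 * h)" by (simp add: cube_def)
  qed
qed

text \<open>Off the children almost every point is outside \<open>E\<close>, where \<open>T\<close>
  is bounded pointwise. On a child P at least half of P is outside \<open>E\<close>; a further
  quarter is given up where \<open>T\<close> of F on 3P is large. The remaining set \<open>H\<close>
  still has a quarter of the measure of P, and the part of F outside 3P has bounded image there, so
  \<open>oscillation_estimate\<close> applies.\<close>

lemma local_estimate: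
  fixes T :: "(real ^ 'n \<Rightarrow> 'k::{real_normed_field, euclidean_space}) \<Rightarrow> real ^ 'n \<Rightarrow> 'k" and c :: "real ^ 'n"
  assumes p: "1 \<le> p" "ennreal p < q" and \<alpha>: "0 \<le> \<alpha>"
    and T: "sublinear_operator_on (Lp_c p) T"
    and wT: "locally_weak_bounded p \<alpha> (\<lambda>f x. ennreal (norm (T f x))) \<phi>\<^sub>T"
    and phiM: "0 \<le> \<phi>\<^sub>M t"
    and F: "F \<in> Lp_c p" and h: "0 < h" and t: "t \<in> {0<..<1}" "t * 3 ^ CARD('n) \<le> 1 / 4" and A: "0 \<le> A"
    and a: "avg p (cube c (3 * h)) (\<lambda>x. norm (F x)) = ennreal a" "0 \<le> a"
    and s: "s = measure lebesgue (cube c (3 * h)) powr (\<alpha> / real CARD('n))"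
    and W: "countable W" "disjoint_family_on (\<lambda>(d, e). cube d e) W"
      "\<And>d e. (d, e) \<in> W \<Longrightarrow> 0 < e \<and> cube d e \<subseteq> cube c h"
    and E: "E \<in> sets lebesgue"
      "\<And>x. x \<in> cube c h - E \<Longrightarrow> norm (T (cutoff (cube c (3 * h)) F) x) \<le> \<phi>\<^sub>T t * a * s"
      "\<And>x. x \<in> cube c h - E \<Longrightarrow> sharp_grand_maximal T q (cutoff (cube c (3 * h)) F) x \<le> ennreal (\<phi>\<^sub>M t * a * s)"
      "E - (\<Union>(d, e)\<in>W. cube d e) \<in> null_sets lebesgue"
      "\<And>d e. (d, e) \<in> W \<Longrightarrow> 2 * emeasure lebesgue (cube d e \<inter> E) \<le> emeasure lebesgue (cube d e)"
      "\<And>d e. (d, e) \<in> W \<Longrightarrow> avg p (cube d (3 * e)) (\<lambda>x. norm (F x)) \<le> ennreal (A * a)"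
    and G: "G \<in> borel_measurable lebesgue" "\<And>x. 0 \<le> G x" and \<tau>: "0 < \<tau>"
  shows "(\<integral>\<^sup>+x\<in>cube c h - (\<Union>(d, e)\<in>W. cube d e). ennreal (norm (T (cutoff (cube c (3 * h)) F) x) * G x) \<partial>lebesgue) +
     (\<integral>\<^sup>+(d, e). (\<integral>\<^sup>+x\<in>cube d e. ennreal (norm (T (cutoff (- cube d (3 * e)) (cutoff (cube c (3 * h)) F)) x) * G x) \<partial>lebesgue) \<partial>count_space W)
   \<le> ennreal ((4 * \<phi>\<^sub>M t + (1 + A) * \<phi>\<^sub>T t) * a * s * \<tau>) *
      (\<integral>\<^sup>+x\<in>cube c h. ennreal (1 + (G x / \<tau>) powr conj_exponent q) \<partial>lebesgue)"
proof -
  let ?r = "conj_exponent q"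
  let ?Q3 = "cube c (3 * h)"
  \<comment> \<open>With the weight as a density, and the same factor \<open>D\<close> on all
    pieces, summation over the disjoint children is countable additivity.\<close>
  define \<nu> where "\<nu> = density lebesgue (\<lambda>x. ennreal (1 + (G x / \<tau>) powr ?r))"
  have [measurable]: "G \<in> borel_measurable lebesgue" by (rule G(1))
  have weight: "(\<lambda>x. ennreal (1 + (G x / \<tau>) powr ?r)) \<in> borel_measurable lebesgue" by measurable
  have nu: "emeasure \<nu> S = (\<integral>\<^sup>+x\<in>S. ennreal (1 + (G x / \<tau>) powr ?r) \<partial>lebesgue)" if "S \<in> sets lebesgue" for S
    unfolding \<nu>_def by (rule emeasure_density[OF weight that])
  define D where "D = ennreal ((4 * \<phi>\<^sub>M t + (1 + A) * \<phi>\<^sub>T t) * a * s * \<tau>)"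
  define U where "U = (\<Union>(d, e)\<in>W. cube d e)"
  have phiT: "0 \<le> \<phi>\<^sub>T t" using wT t(1) by (rule locally_weak_bounded_nonneg)
  have s0: "0 \<le> s" by (simp add: s)
  have p0: "0 \<le> p" using p by simp
  have q1: "1 < q"
    using order_le_less_trans[OF ennreal_leI[OF p(1)] p(2)] by simp
  have cF: "cutoff ?Q3 F \<in> Lp_c p" using F p0 by (intro Lp_c_cutoff) auto
  have Tm: "T f \<in> borel_measurable lebesgue" if "f \<in> Lp_c p" for f
    using T that by (simp add: sublinear_operator_on_def)
  have U: "U \<in> sets lebesgue" unfolding U_def using W(1) by (intro sets.countable_UN') auto
  have one: "(\<integral>\<^sup>+x\<in>cube c h - U. ennreal (norm (T (cutoff ?Q3 F) x) * G x) \<partial>lebesgue) \<le> D * emeasure \<nu> (cube c h - U)"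
  proof -
    have "AE x in lebesgue. x \<notin> E - U" using E(4) unfolding U_def by (rule AE_not_in)
    then have "(\<integral>\<^sup>+x\<in>cube c h - U. ennreal (norm (T (cutoff ?Q3 F) x) * G x) \<partial>lebesgue) \<le>
      (\<integral>\<^sup>+x. D * (ennreal (1 + (G x / \<tau>) powr ?r) * indicator (cube c h - U) x) \<partial>lebesgue)"
    proof (intro nn_integral_mono_AE, elim eventually_mono)
      fix x assume x: "x \<notin> E - U"
      show "ennreal (norm (T (cutoff ?Q3 F) x) * G x) * indicator (cube c h - U) x \<le>
        D * (ennreal (1 + (G x / \<tau>) powr ?r) * indicator (cube c h - U) x)"
      proof (cases "x \<in> cube c h - U")
        case True
        then have "norm (T (cutoff ?Q3 F) x) \<le> \<phi>\<^sub>T t * a * s" using x E(2) by auto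
        also have "\<dots> \<le> (4 * \<phi>\<^sub>M t + (1 + A) * \<phi>\<^sub>T t) * a * s"
          using phiT phiM A a(2) s0 by (intro mult_right_mono) (auto simp: algebra_simps)
        finally have 1: "norm (T (cutoff ?Q3 F) x) \<le> (4 * \<phi>\<^sub>M t + (1 + A) * \<phi>\<^sub>T t) * a * s" .
        have 2: "G x \<le> \<tau> * (1 + (G x / \<tau>) powr ?r)"
          using le_one_plus_powr[of "G x / \<tau>" ?r] conj_exponent_ge_1[OF q1] G(2)[of x] \<tau> by (simp add: field_simps)
        have "norm (T (cutoff ?Q3 F) x) * G x \<le> (4 * \<phi>\<^sub>M t + (1 + A) * \<phi>\<^sub>T t) * a * s * (\<tau> * (1 + (G x / \<tau>) powr ?r))"
          using 1 2 G(2) phiM phiT A a(2) s0 by (intro mult_mono) auto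
        then show ?thesis using True phiM phiT A a(2) s0 \<tau>
          by (simp add: D_def ennreal_leI mult.assoc ennreal_mult'[symmetric] del: ennreal_plus)
      qed simp
    qed
    also have "\<dots> = D * emeasure \<nu> (cube c h - U)"
      using U G by (subst nn_integral_cmult) (auto simp: nu)
    finally show ?thesis .
  qed
  have two: "(\<integral>\<^sup>+x\<in>cube d e. ennreal (norm (T (cutoff (- cube d (3 * e)) (cutoff ?Q3 F)) x) * G x) \<partial>lebesgue) \<le> D * emeasure \<nu> (cube d e)"
    if de: "(d, e) \<in> W" for d e
  proof -
    have e: "0 < e" and sub: "cube d e \<subseteq> cube c h" using W(3)[OF de] by auto
    note sub3 = cube_subset_imp_triple_subset[OF e h sub]
    let ?P3 = "cube d (3 * e)"
    let ?u = "T (cutoff (- ?P3) (cutoff ?Q3 F))"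
    have u: "?u \<in> borel_measurable lebesgue" using p0 by (intro Tm Lp_c_cutoff[OF cF]) (auto simp: Compl_in_sets_lebesgue)
    define v where "v = (2 * e) ^ CARD('n)"
    have v: "0 < v" "emeasure lebesgue (cube d e) = ennreal v" using e by (simp_all add: v_def emeasure_cube)
    obtain a' where a': "avg p ?P3 (\<lambda>x. norm (F x)) = ennreal a'" "0 \<le> a'" "a' \<le> A * a"
    proof -
      have "avg p ?P3 (\<lambda>x. norm (F x)) \<le> ennreal (A * a)" using E(6)[OF de] .
      then show ?thesis using that A a(2)
        by (cases "avg p ?P3 (\<lambda>x. norm (F x))" rule: ennreal_cases) (auto simp: top_unique)
    qed
    define s' where "s' = measure lebesgue ?P3 powr (\<alpha> / real CARD('n))"
    have s': "0 \<le> s'" "s' \<le> s"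
      unfolding s'_def s using e h sub3 \<alpha> by (auto intro!: powr_mono2 measure_cube_mono)
    define Y where "Y = {x \<in> ?P3. ennreal (norm (T (cutoff ?P3 F) x)) > ennreal (\<phi>\<^sub>T t * a' * s')}"
    have Y: "Y \<in> sets lebesgue" "emeasure lebesgue Y \<le> ennreal t * emeasure lebesgue ?P3"
    proof -
      have "0 < 3 * e" using e by simp
      note bound = weak_bound_set[OF wT t(1) this F a'(1,2), folded s'_def, folded Y_def]
      show "Y \<in> sets lebesgue" "emeasure lebesgue Y \<le> ennreal t * emeasure lebesgue ?P3"
        by (rule bound(1), rule bound(2))
    qed
    \<comment> \<open>The weak bound is available on 3P only; the condition t 3^n \<le> 1/4 absorbs
      the measure of the triple.\<close>
    have Y4: "4 * emeasure lebesgue Y \<le> emeasure lebesgue (cube d e)"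
    proof -
      have three: "(3 :: ennreal) ^ CARD('n) = ennreal (3 ^ CARD('n))" by (simp flip: ennreal_power)
      have t0: "0 \<le> t" using t(1) by simp
      have coef: "ennreal (4 * (t * 3 ^ CARD('n))) = 4 * (ennreal t * 3 ^ CARD('n))"
        using t0 unfolding three by (simp only: ennreal_mult mult_nonneg_nonneg zero_le_power zero_le_numeral ennreal_numeral)
      have "4 * emeasure lebesgue Y \<le> 4 * (ennreal t * emeasure lebesgue ?P3)"
        using Y(2) by (rule mult_left_mono) simp
      also have "\<dots> = ennreal (4 * (t * 3 ^ CARD('n))) * emeasure lebesgue (cube d e)"
        unfolding emeasure_triple_cube[OF e] coef by (simp only: mult.assoc)
      also have "\<dots> \<le> 1 * emeasure lebesgue (cube d e)"
        using t(2) by (intro mult_right_mono) (auto simp: ennreal_le_1)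
      finally show ?thesis by simp
    qed
    define H where "H = cube d e - E - Y"
    have H: "H \<in> sets lebesgue" "H \<subseteq> cube d e" using E(1) Y(1) by (auto simp: H_def)
    have Hbig: "emeasure lebesgue (cube d e) \<le> 4 * emeasure lebesgue H"
    proof -
      have fin: "emeasure lebesgue S \<noteq> \<infinity>" if "S \<subseteq> cube d e" for S
        using emeasure_mono[OF that cube_lebesgue] v by (auto simp: top_unique)
      have fm: "cube d e \<inter> E \<in> lmeasurable" "cube d e \<inter> Y \<in> lmeasurable" "H \<in> lmeasurable" "cube d e \<in> lmeasurable"
        using fin E(1) Y(1) H by (auto intro!: fmeasurableI simp: less_top)
      have "measure lebesgue (cube d e) \<le> measure lebesgue (H \<union> (cube d e \<inter> E) \<union> (cube d e \<inter> Y))"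
        using fm by (intro measure_mono_fmeasurable) (auto simp: H_def)
      also have "\<dots> \<le> measure lebesgue H + measure lebesgue (cube d e \<inter> E) + measure lebesgue (cube d e \<inter> Y)"
        using measure_Un_le[of "H \<union> (cube d e \<inter> E)" lebesgue "cube d e \<inter> Y"] measure_Un_le[of H lebesgue "cube d e \<inter> E"] fm
        by (auto simp: fmeasurableD)
      finally have sum: "v \<le> measure lebesgue H + measure lebesgue (cube d e \<inter> E) + measure lebesgue (cube d e \<inter> Y)"
        using v by (simp add: measure_def)
      have "ennreal (2 * measure lebesgue (cube d e \<inter> E)) \<le> ennreal v"
        using E(5)[OF de] v fm by (simp add: emeasure_eq_measure2 ennreal_mult')
      then have 1: "2 * measure lebesgue (cube d e \<inter> E) \<le> v" using v by (subst (asm) ennreal_le_iff) auto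
      have "4 * emeasure lebesgue (cube d e \<inter> Y) \<le> 4 * emeasure lebesgue Y"
        using Y(1) by (intro mult_left_mono emeasure_mono) auto
      also note Y4
      finally have "ennreal (4 * measure lebesgue (cube d e \<inter> Y)) \<le> ennreal v"
        using v fm by (simp add: emeasure_eq_measure2 ennreal_mult')
      then have 2: "4 * measure lebesgue (cube d e \<inter> Y) \<le> v" using v by (subst (asm) ennreal_le_iff) auto
      have "ennreal v \<le> ennreal (4 * measure lebesgue H)" using sum 1 2 by (intro ennreal_leI) linarith
      then show ?thesis using v fm by (simp add: emeasure_eq_measure2 ennreal_mult')
    qed
    define K where "K = \<phi>\<^sub>M t * a * s"
    define B where "B = (1 + A) * \<phi>\<^sub>T t * a * s"
    have K0: "0 \<le> K" and B0: "0 \<le> B" using phiM phiT a(2) s0 A by (simp_all add: K_def B_def)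
    have "H \<noteq> {}" using Hbig v by auto
    then obtain x where x: "x \<in> H" by blast
    \<comment> \<open>P is itself one of the cubes in the supremum at a point of \<open>H\<close>,
      so one point outside \<open>E\<close> controls the oscillation on all of P.\<close>
    have "osc q (cube d e) ?u \<le> sharp_grand_maximal T q (cutoff ?Q3 F) x"
      unfolding sharp_grand_maximal_def using x e by (intro SUP_upper2[of "(d, e)"]) (auto simp: H_def)
    also have "\<dots> \<le> ennreal K" using E(3)[of x] x sub by (auto simp: K_def H_def)
    finally have osc: "osc q (cube d e) ?u \<le> ennreal K" .
    have B: "norm (?u y) \<le> B" if "y \<in> H" for y
    proof -
      have y: "y \<in> cube c h - E" "y \<in> ?P3" "y \<notin> Y"
        using that sub cube_subset_triple[OF e] by (auto simp: H_def)
      have "norm (?u y) \<le> norm (T (cutoff ?Q3 F) y) + norm (T (cutoff ?P3 F) y)"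
        using sub3 by (intro sublinear_difference[OF T p0 F]) auto
      also have "norm (T (cutoff ?Q3 F) y) \<le> \<phi>\<^sub>T t * a * s" using E(2) y by blast
      also have "norm (T (cutoff ?P3 F) y) \<le> \<phi>\<^sub>T t * a' * s'"
      proof -
        have "0 \<le> \<phi>\<^sub>T t * a' * s'" using phiT a'(2) s'(1) by simp
        moreover have "\<not> ennreal (\<phi>\<^sub>T t * a' * s') < ennreal (norm (T (cutoff ?P3 F) y))"
          using y by (simp add: Y_def)
        ultimately show ?thesis by (simp only: not_less ennreal_le_iff)
      qed
      also have "\<phi>\<^sub>T t * a' * s' \<le> \<phi>\<^sub>T t * (A * a) * s"
        using phiT a' s' A a(2) by (intro mult_mono) auto
      finally show ?thesis by (simp add: B_def algebra_simps)
    qed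
    have "(\<integral>\<^sup>+x\<in>cube d e. ennreal (norm (?u x) * G x) \<partial>lebesgue) \<le> ennreal ((4 * K + B) * \<tau>) * emeasure \<nu> (cube d e)"
      using oscillation_estimate[OF e u G q1 K0 osc \<tau> H Hbig B0 B] by (simp add: nu)
    also have "ennreal ((4 * K + B) * \<tau>) = D" by (simp add: D_def K_def B_def algebra_simps)
    finally show ?thesis .
  qed
  have "(\<integral>\<^sup>+(d, e). (\<integral>\<^sup>+x\<in>cube d e. ennreal (norm (T (cutoff (- cube d (3 * e)) (cutoff ?Q3 F)) x) * G x) \<partial>lebesgue) \<partial>count_space W) \<le>
    (\<integral>\<^sup>+i. D * emeasure \<nu> (case i of (d, e) \<Rightarrow> cube d e) \<partial>count_space W)"
    using two by (intro nn_integral_mono) auto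
  also have "\<dots> = D * emeasure \<nu> U"
  proof -
    have "emeasure \<nu> U = (\<integral>\<^sup>+i. emeasure \<nu> (case i of (d, e) \<Rightarrow> cube d e) \<partial>count_space W)"
      unfolding U_def using W(1,2) by (intro emeasure_UN_countable) (auto simp: \<nu>_def)
    then show ?thesis by (simp add: nn_integral_cmult)
  qed
  finally have "(\<integral>\<^sup>+x\<in>cube c h - U. ennreal (norm (T (cutoff ?Q3 F) x) * G x) \<partial>lebesgue) +
     (\<integral>\<^sup>+(d, e). (\<integral>\<^sup>+x\<in>cube d e. ennreal (norm (T (cutoff (- cube d (3 * e)) (cutoff ?Q3 F)) x) * G x) \<partial>lebesgue) \<partial>count_space W)
     \<le> D * emeasure \<nu> (cube c h - U) + D * emeasure \<nu> U"
    using one by (intro add_mono)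
  also have "\<dots> = D * emeasure \<nu> ((cube c h - U) \<union> U)"
    using U by (subst plus_emeasure[symmetric]) (auto simp: distrib_left \<nu>_def)
  also have "(cube c h - U) \<union> U = cube c h" using W(3) by (auto simp: U_def)
  finally show ?thesis unfolding D_def U_def by (simp add: nu)
qed

lemma twice_not_le_ennreal:
  assumes "0 < v" "2 * ennreal v \<le> ennreal v"
  shows False
proof -
  have "ennreal (2 * v) \<le> ennreal v" using assms by (simp add: ennreal_mult)
  then show False using assms(1) by (subst (asm) ennreal_le_iff) auto
qed

section \<open>Construction of the stopping family\<close>

text \<open>The weak type estimate for |F|^p at height (A a)^p. One factor 3^n comes from the
  covering and one from the measure of the tripled cube, together 9^n. The gain A^p is weakened to
  A, so that the constant is independent of p.\<close>

lemma large_average_cubes: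
  fixes c :: "real ^ 'n" and F :: "real ^ 'n \<Rightarrow> 'k::{real_normed_field, euclidean_space}"
  assumes h: "0 < h" and p: "1 \<le> p" and F: "F \<in> borel_measurable lebesgue" and A: "1 \<le> A"
    and a: "avg p (cube c (3 * h)) (\<lambda>x. norm (F x)) = ennreal a" "0 \<le> a"
  defines "V \<equiv> {(k, z). grid_cube c h k z \<subseteq> cube c h \<and>
    \<not> avg p (cube (grid_center c h k z) (3 * (h / 2 ^ k))) (\<lambda>x. norm (F x)) \<le> ennreal (A * a)}"
  shows "emeasure lebesgue (grid_union c h V) \<le> ennreal (9 ^ CARD('n) / A * measure lebesgue (cube c h))"
proof -
  define \<nu> where "\<nu> = density lebesgue (\<lambda>x. ennreal (norm (F x) powr p))"
  have "(\<lambda>x. ennreal (norm (F x) powr p)) \<in> borel_measurable lebesgue" using F by measurable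
  then have nu: "emeasure \<nu> S = (\<integral>\<^sup>+x\<in>S. ennreal (norm (F x) powr p) \<partial>lebesgue)" if "S \<in> sets lebesgue" for S
    unfolding \<nu>_def by (rule emeasure_density) (rule that)
  have avg: "avg p (cube d e) (\<lambda>x. norm (F x)) \<le> ennreal K \<longleftrightarrow>
    emeasure \<nu> (cube d e) \<le> ennreal (K powr p) * emeasure lebesgue (cube d e)" if "0 \<le> K" "0 < e" for d K e
    using p that by (simp add: avg_le_iff nu)
  define v where "v = measure lebesgue (cube c h)"
  have v: "emeasure lebesgue (cube c h) = ennreal v" "0 < v"
    using h by (simp_all add: v_def emeasure_cube measure_cube)
  have top: "emeasure \<nu> (cube c (3 * h)) \<le> ennreal (a powr p) * emeasure lebesgue (cube c (3 * h))"
    using avg[of a "3 * h" c] a h by simp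
  show ?thesis
  proof (cases "a = 0")
    \<comment> \<open>The estimate is divided by a^p below. For a = 0 the function vanishes almost
      everywhere on the tripled cube, and no average exceeds 0.\<close>
    case True
    have "V = {}"
    proof (rule ccontr)
      assume "V \<noteq> {}"
      then obtain k z where kz: "grid_cube c h k z \<subseteq> cube c h"
        "\<not> avg p (cube (grid_center c h k z) (3 * (h / 2 ^ k))) (\<lambda>x. norm (F x)) \<le> ennreal (A * a)"
        by (auto simp: V_def)
      have "cube (grid_center c h k z) (3 * (h / 2 ^ k)) \<subseteq> cube c (3 * h)"
        using h kz(1) by (intro cube_subset_imp_triple_subset(2)) (auto simp: grid_cube_def)
      then have "emeasure \<nu> (cube (grid_center c h k z) (3 * (h / 2 ^ k))) \<le> emeasure \<nu> (cube c (3 * h))"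
        by (intro emeasure_mono) (auto simp: \<nu>_def)
      also have "\<dots> \<le> 0" using top True by simp
      finally have "avg p (cube (grid_center c h k z) (3 * (h / 2 ^ k))) (\<lambda>x. norm (F x)) \<le> ennreal 0"
        using h by (subst avg) auto
      then show False using kz(2) True by simp
    qed
    then show ?thesis by simp
  next
    case False
    then have ap: "0 < a powr p" using a(2) by simp
    have "ennreal ((A * a) powr p) * emeasure lebesgue (grid_union c h V) \<le> 3 ^ CARD('n) * emeasure \<nu> (cube c (3 * h))"
    proof (rule triple_maximal_weak_type[OF h])
      show "sets \<nu> = sets lebesgue" by (simp add: \<nu>_def)
      fix k z assume "(k, z) \<in> V"
      then have kz: "grid_cube c h k z \<subseteq> cube c h"
        "\<not> avg p (cube (grid_center c h k z) (3 * (h / 2 ^ k))) (\<lambda>x. norm (F x)) \<le> ennreal (A * a)"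
        by (auto simp: V_def)
      show "grid_cube c h k z \<subseteq> cube c h" by fact
      have "0 \<le> A * a" "0 < 3 * (h / 2 ^ k)" using A a h by auto
      from kz(2)[unfolded avg[OF this]]
      show "ennreal ((A * a) powr p) * emeasure lebesgue (cube (grid_center c h k z) (3 * (h / 2 ^ k)))
        < emeasure \<nu> (cube (grid_center c h k z) (3 * (h / 2 ^ k)))"
        by (simp only: not_le)
    qed
    also have "\<dots> \<le> 3 ^ CARD('n) * (ennreal (a powr p) * emeasure lebesgue (cube c (3 * h)))"
      using top by (rule mult_left_mono) simp
    also have "\<dots> = ennreal (3 ^ CARD('n)) * (ennreal (a powr p) * (ennreal (3 ^ CARD('n)) * ennreal v))"
      unfolding emeasure_triple_cube[OF h] v(1) by (simp flip: ennreal_power)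
    also have "\<dots> = ennreal (3 ^ CARD('n) * (a powr p * (3 ^ CARD('n) * v)))"
      using v(2) by (simp only: ennreal_mult mult_nonneg_nonneg less_imp_le powr_ge_zero zero_le_power zero_le_numeral)
    finally have main: "ennreal ((A * a) powr p) * emeasure lebesgue (grid_union c h V)
      \<le> ennreal (3 ^ CARD('n) * (a powr p * (3 ^ CARD('n) * v)))" .
    have "grid_union c h V \<subseteq> cube c h" by (auto simp: V_def)
    then have "emeasure lebesgue (grid_union c h V) \<le> ennreal v"
      using emeasure_mono[of "grid_union c h V" "cube c h" lebesgue] v by simp
    then obtain w where w: "emeasure lebesgue (grid_union c h V) = ennreal w" "0 \<le> w"
      by (cases "emeasure lebesgue (grid_union c h V)" rule: ennreal_cases) (auto simp: top_unique)
    have "ennreal ((A * a) powr p * w) \<le> ennreal (3 ^ CARD('n) * (a powr p * (3 ^ CARD('n) * v)))"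
      using main w by (simp add: ennreal_mult)
    then have "(A * a) powr p * w \<le> 3 ^ CARD('n) * (a powr p * (3 ^ CARD('n) * v))"
      using v by (subst (asm) ennreal_le_iff) auto
    moreover have "(A * a) powr p = A powr p * a powr p" using A a by (simp add: powr_mult)
    moreover have "(9 :: real) ^ CARD('n) = 3 ^ CARD('n) * 3 ^ CARD('n)" by (simp flip: power_mult_distrib)
    ultimately have "a powr p * (A powr p * w) \<le> a powr p * (9 ^ CARD('n) * v)" by (simp add: mult_ac)
    then have 1: "A powr p * w \<le> 9 ^ CARD('n) * v" using ap by (simp only: mult_le_cancel_left_pos)
    have "A powr 1 \<le> A powr p" using A p by (intro powr_mono) auto
    then have "A * w \<le> A powr p * w" using w A by (intro mult_right_mono) auto
    with 1 have "w \<le> 9 ^ CARD('n) / A * v" using A by (simp add: field_simps)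
    then show ?thesis unfolding w(1) v_def[symmetric] by (rule ennreal_leI)
  qed
qed

text \<open>The recursion follows a single tree of cubes, so all F k share one family:
  \<open>E\<close> is the union of their exceptional sets. The weight \<open>G\<close> stays free in
  the last clause because a different one belongs to each k, and \<tau> is adjusted to it
  later.\<close>

lemma stopping_family:
  fixes T :: "(real ^ 'n \<Rightarrow> 'k::{real_normed_field, euclidean_space}) \<Rightarrow> real ^ 'n \<Rightarrow> 'k" and c :: "real ^ 'n"
    and F :: "nat \<Rightarrow> real ^ 'n \<Rightarrow> 'k" and m :: nat
  assumes p: "1 \<le> p" "ennreal p < q" and \<alpha>: "0 \<le> \<alpha>"
    and T: "sublinear_operator_on (Lp_c p) T"
    and wT: "locally_weak_bounded p \<alpha> (\<lambda>f x. ennreal (norm (T f x))) \<phi>\<^sub>T"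
    and wM: "locally_weak_bounded p \<alpha> (sharp_grand_maximal T q) \<phi>\<^sub>M"
    and F: "\<And>k. k \<le> m \<Longrightarrow> F k \<in> Lp_c p" and h: "0 < h"
    and a: "\<And>k. k \<le> m \<Longrightarrow> avg p (cube c (3 * h)) (\<lambda>x. norm (F k x)) = ennreal (a k)" "\<And>k. 0 \<le> a k"
    and s: "s = measure lebesgue (cube c (3 * h)) powr (\<alpha> / real CARD('n))"
  defines "t \<equiv> 1 / (16 * (real m + 1) * 6 ^ CARD('n))" and "A \<equiv> 8 * (real m + 1) * 18 ^ CARD('n)"
  obtains W where "countable W" "disjoint_family_on (\<lambda>(d, e). cube d e) W"
    "\<And>d e. (d, e) \<in> W \<Longrightarrow> \<exists>k z. d = grid_center c h k z \<and> e = h / 2 ^ k"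
    "\<And>d e. (d, e) \<in> W \<Longrightarrow> 0 < e \<and> cube d e \<subseteq> cube c h"
    "2 * emeasure lebesgue (\<Union>(d, e)\<in>W. cube d e) \<le> emeasure lebesgue (cube c h)"
    "\<And>k G \<tau>. k \<le> m \<Longrightarrow> G \<in> borel_measurable lebesgue \<Longrightarrow> (\<And>x. 0 \<le> G x) \<Longrightarrow> 0 < \<tau> \<Longrightarrow>
      (\<integral>\<^sup>+x\<in>cube c h - (\<Union>(d, e)\<in>W. cube d e). ennreal (norm (T (cutoff (cube c (3 * h)) (F k)) x) * G x) \<partial>lebesgue) +
      (\<integral>\<^sup>+(d, e). (\<integral>\<^sup>+x\<in>cube d e. ennreal (norm (T (cutoff (- cube d (3 * e)) (cutoff (cube c (3 * h)) (F k))) x) * G x) \<partial>lebesgue) \<partial>count_space W)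
      \<le> ennreal ((4 * \<phi>\<^sub>M t + (1 + A) * \<phi>\<^sub>T t) * a k * s * \<tau>) *
        (\<integral>\<^sup>+x\<in>cube c h. ennreal (1 + (G x / \<tau>) powr conj_exponent q) \<partial>lebesgue)"
proof -
  let ?Q3 = "cube c (3 * h)"
  have A1: "1 \<le> A"
  proof -
    have "1 * 1 \<le> (8 * (real m + 1)) * 18 ^ CARD('n)" by (intro mult_mono) auto
    then show ?thesis by (simp add: A_def)
  qed
  have M1: "1 * 1 \<le> (real m + 1) * (2 :: real) ^ CARD('n)" by (intro mult_mono) auto
  have six: "(6 :: real) ^ CARD('n) = 2 ^ CARD('n) * 3 ^ CARD('n)" "(18 :: real) ^ CARD('n) = 2 ^ CARD('n) * 9 ^ CARD('n)"
    by (simp_all flip: power_mult_distrib)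
  have t3: "t * 3 ^ CARD('n) = 1 / (16 * ((real m + 1) * 2 ^ CARD('n)))"
  proof -
    have "1 / (16 * M * (x * y)) * y = 1 / (16 * (M * x))" if "0 < M" "0 < x" "0 < y" for M x y :: real
      using that by (simp add: field_simps)
    then show ?thesis unfolding t_def six by (simp add: add_nonneg_pos)
  qed
  also have "\<dots> \<le> 1 / (16 * 1)" using M1 by (intro divide_left_mono) auto
  finally have t3': "t * 3 ^ CARD('n) \<le> 1 / 4" by simp
  have t0: "0 < t" by (simp add: t_def add_nonneg_pos)
  moreover have "t < 1"
  proof -
    have "t * 1 \<le> t * 3 ^ CARD('n)" using t0 by (intro mult_left_mono) auto
    then show ?thesis using t3' by simp
  qed
  ultimately have t: "t \<in> {0<..<1}" by simp
  define v where "v = measure lebesgue (cube c h)"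
  have v: "emeasure lebesgue (cube c h) = ennreal v" "0 < v"
    using h by (simp_all add: v_def emeasure_cube measure_cube)
  have e3: "0 < 3 * h" using h by simp
  define A1 where "A1 k = {x \<in> ?Q3. ennreal (norm (T (cutoff ?Q3 (F k)) x)) > ennreal (\<phi>\<^sub>T t * a k * s)}" for k
  define A2 where "A2 k = {x \<in> ?Q3. sharp_grand_maximal T q (cutoff ?Q3 (F k)) x > ennreal (\<phi>\<^sub>M t * a k * s)}" for k
  define V where "V k = {(j, z). grid_cube c h j z \<subseteq> cube c h \<and>
    \<not> avg p (cube (grid_center c h j z) (3 * (h / 2 ^ j))) (\<lambda>x. norm (F k x)) \<le> ennreal (A * a k)}" for k
  define E0 where "E0 k = A1 k \<union> A2 k \<union> grid_union c h (V k)" for k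
  define E where "E = cube c h \<inter> (\<Union>k\<le>m. E0 k)"
  have triple: "ennreal t * emeasure lebesgue ?Q3 = ennreal (t * 3 ^ CARD('n) * v)"
    unfolding emeasure_triple_cube[OF h] v(1) using t0 v(2)
    by (simp add: ennreal_mult mult.assoc flip: ennreal_power)
  have E0: "E0 k \<in> sets lebesgue" "emeasure lebesgue (E0 k) \<le> ennreal ((2 * (t * 3 ^ CARD('n)) + 9 ^ CARD('n) / A) * v)" if k: "k \<le> m" for k
  proof -
    note b1 = weak_bound_set[OF wT t e3 F[OF k] a(1)[OF k] a(2), folded s, folded A1_def]
    note b2 = weak_bound_set[OF wM t e3 F[OF k] a(1)[OF k] a(2), folded s, folded A2_def]
    have Fm: "F k \<in> borel_measurable lebesgue" using F[OF k] by (simp add: Lp_c_iff)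
    note b3 = large_average_cubes[OF h p(1) Fm \<open>1 \<le> A\<close> a(1)[OF k] a(2), folded V_def, folded v_def]
    show "E0 k \<in> sets lebesgue" unfolding E0_def using b1(1) b2(1) by (intro sets.Un) auto
    have "emeasure lebesgue (E0 k) \<le> emeasure lebesgue (A1 k \<union> A2 k) + emeasure lebesgue (grid_union c h (V k))"
      unfolding E0_def using b1(1) b2(1) by (intro emeasure_subadditive sets.Un) auto
    also have "\<dots> \<le> emeasure lebesgue (A1 k) + emeasure lebesgue (A2 k) + emeasure lebesgue (grid_union c h (V k))"
      using b1(1) b2(1) by (intro add_right_mono emeasure_subadditive)
    also have "\<dots> \<le> ennreal (t * 3 ^ CARD('n) * v) + ennreal (t * 3 ^ CARD('n) * v) + ennreal (9 ^ CARD('n) / A * v)"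
      using b1(2) b2(2) b3 unfolding triple by (intro add_mono)
    also have "\<dots> = ennreal (t * 3 ^ CARD('n) * v + t * 3 ^ CARD('n) * v + 9 ^ CARD('n) / A * v)"
      using t0 v(2) \<open>1 \<le> A\<close>
      by (simp only: ennreal_plus mult_nonneg_nonneg add_nonneg_nonneg less_imp_le zero_le_power zero_le_numeral divide_nonneg_nonneg order_trans[OF zero_le_one])
    also have "t * 3 ^ CARD('n) * v + t * 3 ^ CARD('n) * v + 9 ^ CARD('n) / A * v = (2 * (t * 3 ^ CARD('n)) + 9 ^ CARD('n) / A) * v"
      by (simp add: algebra_simps)
    finally show "emeasure lebesgue (E0 k) \<le> ennreal ((2 * (t * 3 ^ CARD('n)) + 9 ^ CARD('n) / A) * v)" .
  qed
  have E: "E \<in> sets lebesgue" "E \<subseteq> cube c h"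
    unfolding E_def using E0(1) by (auto intro!: sets.Int sets.finite_UN)
  have Esmall: "2 * (2 * 2 ^ CARD('n) * emeasure lebesgue E) \<le> ennreal v"
  proof -
    \<comment> \<open>The constants are tuned here: the two weak bounds contribute 2 t 3^n = 1 / (8
      (m+1) 2^n), and the large averages 9^n / A, which is the same number.\<close>
    have half: "2 * (t * 3 ^ CARD('n)) + 9 ^ CARD('n) / A = 1 / (4 * ((real m + 1) * 2 ^ CARD('n)))"
    proof -
      have "2 * (1 / (16 * (M * x))) + y / (8 * M * (x * y)) = 1 / (4 * (M * x))" if "0 < M" "0 < x" "0 < y" for M x y :: real
        using that by (simp add: field_simps)
      note gen = this
      show ?thesis unfolding t3 A_def six by (rule gen) auto
    qed
    define x where "x = 1 / (4 * ((real m + 1) * 2 ^ CARD('n))) * v"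
    have x0: "0 \<le> x" using v(2) by (simp add: x_def)
    have "emeasure lebesgue E \<le> emeasure lebesgue (\<Union>k\<le>m. E0 k)"
      unfolding E_def using E0(1) by (intro emeasure_mono sets.finite_UN) auto
    also have "\<dots> \<le> (\<Sum>k\<le>m. emeasure lebesgue (E0 k))"
      using E0(1) by (intro emeasure_subadditive_finite) auto
    also have "\<dots> \<le> (\<Sum>k\<le>m. ennreal x)"
      using E0(2) unfolding half x_def by (intro sum_mono) auto
    also have "\<dots> = ennreal (\<Sum>k\<le>m. x)" using x0 by (intro sum_ennreal) auto
    also have "(\<Sum>k\<le>m. x) = (real m + 1) * x" by simp
    finally have "2 * (2 * 2 ^ CARD('n) * emeasure lebesgue E) \<le> 2 * (2 * 2 ^ CARD('n) * ennreal ((real m + 1) * x))"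
      by (intro mult_left_mono) auto
    also have "\<dots> = ennreal (2 * (2 * 2 ^ CARD('n) * ((real m + 1) * x)))"
    proof -
      have "2 * (2 * 2 ^ CARD('n) * ennreal w) = ennreal (2 * (2 * 2 ^ CARD('n) * w))" if "0 \<le> w" for w
        using that by (simp add: ennreal_mult mult.assoc[symmetric] flip: ennreal_power)
      note gen = this
      show ?thesis by (rule gen) (use x0 in simp)
    qed
    also have "2 * (2 * 2 ^ CARD('n) * ((real m + 1) * x)) = v"
    proof -
      have "2 * (2 * y * (M * (1 / (4 * (M * y)) * v))) = v" if "0 < M" "0 < y" for M y :: real
        using that by (simp add: field_simps)
      note gen = this
      show ?thesis unfolding x_def by (rule gen) auto
    qed
    finally show ?thesis .
  qed
  define I where "I = maximal_indices c h (stopping_indices c h E)"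
  define f where "f = (\<lambda>(k, z). (grid_center c h k z, h / 2 ^ k))"
  define W where "W = f ` I"
  have cube_f: "(case f i of (d, e) \<Rightarrow> cube d e) = (case i of (k, z) \<Rightarrow> grid_cube c h k z)" for i
    by (simp add: f_def grid_cube_def split: prod.split)
  have UW: "(\<Union>(d, e)\<in>W. cube d e) = grid_union c h (stopping_indices c h E)"
  proof -
    have "(\<Union>(d, e)\<in>W. cube d e) = (\<Union>i\<in>I. case f i of (d, e) \<Rightarrow> cube d e)" by (simp add: W_def)
    also have "\<dots> = grid_union c h I" by (simp only: cube_f)
    finally show ?thesis unfolding I_def by (simp only: grid_union_maximal[OF h])
  qed
  have W_ex: "\<exists>k z. (k, z) \<in> I \<and> d = grid_center c h k z \<and> e = h / 2 ^ k" if "(d, e) \<in> W" for d e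
    using that by (auto simp: W_def f_def)
  have ISub: "grid_cube c h k z \<subseteq> cube c h" if "(k, z) \<in> I" for k z
    using that maximal_indices_subset[of c h "stopping_indices c h E"] by (auto simp: I_def stopping_indices_def)
  have half: "2 * emeasure lebesgue (grid_cube c h k z \<inter> E) \<le> emeasure lebesgue (grid_cube c h k z)" if "(k, z) \<in> I" for k z
  proof (rule stopping_maximal_half[OF h E(1) _ that[unfolded I_def]])
    have "1 * (2 * 2 ^ CARD('n) * emeasure lebesgue E) \<le> 2 * (2 * 2 ^ CARD('n) * emeasure lebesgue E)"
      by (rule mult_right_mono) simp_all
    with Esmall show "2 * 2 ^ CARD('n) * emeasure lebesgue E \<le> emeasure lebesgue (cube c h)"
      unfolding v(1) by (simp only: mult_1_left)
  qed
  show thesis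
  proof (rule that[of W])
    show W1: "countable W" by (simp add: W_def)
    show W2: "disjoint_family_on (\<lambda>(d, e). cube d e) W"
      unfolding disjoint_family_on_def
    proof (intro ballI impI)
      fix x y assume xy: "x \<in> W" "y \<in> W" "x \<noteq> y"
      then obtain i j where ij: "i \<in> I" "j \<in> I" "x = f i" "y = f j" "i \<noteq> j" by (auto simp: W_def)
      show "(case x of (d, e) \<Rightarrow> cube d e) \<inter> (case y of (d, e) \<Rightarrow> cube d e) = {}"
        using disjoint_family_onD[OF maximal_indices_disjoint[OF h, of c "stopping_indices c h E"], of i j] ij
        unfolding ij(3,4) cube_f I_def by simp
    qed
    show "\<exists>k z. d = grid_center c h k z \<and> e = h / 2 ^ k" if "(d, e) \<in> W" for d e
      using W_ex[OF that] by blast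
    show W3: "0 < e \<and> cube d e \<subseteq> cube c h" if "(d, e) \<in> W" for d e
      using W_ex[OF that] ISub h by (auto simp: grid_cube_def)
    have "2 * emeasure lebesgue (\<Union>(d, e)\<in>W. cube d e) \<le> 2 * (2 * 2 ^ CARD('n) * emeasure lebesgue E)"
      unfolding UW using emeasure_stopping_union[OF h E(1), of c] by (rule mult_left_mono) simp
    then show "2 * emeasure lebesgue (\<Union>(d, e)\<in>W. cube d e) \<le> emeasure lebesgue (cube c h)"
      using Esmall unfolding v(1) by (rule order_trans)
    fix k and G :: "real ^ 'n \<Rightarrow> real" and \<tau> :: real
    assume k: "k \<le> m" and G: "G \<in> borel_measurable lebesgue" "\<And>x. 0 \<le> G x" and \<tau>: "0 < \<tau>"
    have phiM: "0 \<le> \<phi>\<^sub>M t" using wM t by (rule locally_weak_bounded_nonneg)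
    have phiT: "0 \<le> \<phi>\<^sub>T t" using wT t by (rule locally_weak_bounded_nonneg)
    have s0: "0 \<le> s" by (simp add: s)
    have A0: "0 \<le> A" using \<open>1 \<le> A\<close> by simp
    show "(\<integral>\<^sup>+x\<in>cube c h - (\<Union>(d, e)\<in>W. cube d e). ennreal (norm (T (cutoff ?Q3 (F k)) x) * G x) \<partial>lebesgue) +
      (\<integral>\<^sup>+(d, e). (\<integral>\<^sup>+x\<in>cube d e. ennreal (norm (T (cutoff (- cube d (3 * e)) (cutoff ?Q3 (F k))) x) * G x) \<partial>lebesgue) \<partial>count_space W)
      \<le> ennreal ((4 * \<phi>\<^sub>M t + (1 + A) * \<phi>\<^sub>T t) * a k * s * \<tau>) *
        (\<integral>\<^sup>+x\<in>cube c h. ennreal (1 + (G x / \<tau>) powr conj_exponent q) \<partial>lebesgue)"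
    proof (rule local_estimate[where T = T and \<phi>\<^sub>T = \<phi>\<^sub>T and \<phi>\<^sub>M = \<phi>\<^sub>M and t = t and A = A and F = "F k" and a = "a k" and W = W and E = E and G = G,
          OF p \<alpha> T wT phiM F[OF k] h t t3' A0 a(1)[OF k] a(2)[of k] s W1 W2])
      show "0 < e \<and> cube d e \<subseteq> cube c h" if "(d, e) \<in> W" for d e using that by (rule W3)
      show "E \<in> sets lebesgue" by (rule E(1))
      show "G \<in> borel_measurable lebesgue" "0 < \<tau>" by (fact G(1), fact \<tau>)
      show "0 \<le> G x" for x by (rule G(2))
    next
      fix x assume x: "x \<in> cube c h - E"
      then have x': "x \<notin> E0 k" "x \<in> ?Q3" using k cube_subset_triple[OF h, of c] by (auto simp: E_def)
      have "0 \<le> \<phi>\<^sub>T t * a k * s" using phiT a(2) s0 by simp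
      moreover have "\<not> ennreal (\<phi>\<^sub>T t * a k * s) < ennreal (norm (T (cutoff ?Q3 (F k)) x))"
        using x' by (auto simp: E0_def A1_def)
      ultimately show "norm (T (cutoff ?Q3 (F k)) x) \<le> \<phi>\<^sub>T t * a k * s"
        by (simp only: not_less ennreal_le_iff)
      show "sharp_grand_maximal T q (cutoff ?Q3 (F k)) x \<le> ennreal (\<phi>\<^sub>M t * a k * s)"
        using x' by (auto simp: E0_def A2_def not_less)
    next
      show "E - (\<Union>(d, e)\<in>W. cube d e) \<in> null_sets lebesgue"
        unfolding UW by (rule stopping_covers[OF h E])
    next
      fix d e assume "(d, e) \<in> W"
      then obtain j z where jz: "(j, z) \<in> I" "d = grid_center c h j z" "e = h / 2 ^ j" using W_ex by blast
      then have de: "cube d e = grid_cube c h j z" by (simp add: grid_cube_def)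
      show "2 * emeasure lebesgue (cube d e \<inter> E) \<le> emeasure lebesgue (cube d e)"
        unfolding de by (rule half[OF jz(1)])
      show "avg p (cube d (3 * e)) (\<lambda>x. norm (F k x)) \<le> ennreal (A * a k)"
      proof (rule ccontr)
        \<comment> \<open>A selected cube with a large average would lie in \<open>E\<close>
          entirely, whereas \<open>E\<close> fills at most half of it.\<close>
        assume "\<not> ?thesis"
        then have "(j, z) \<in> V k" using ISub[OF jz(1)] by (simp add: V_def jz(2,3))
        then have "grid_cube c h j z \<subseteq> E0 k" by (auto simp: E0_def)
        then have "grid_cube c h j z \<inter> E = grid_cube c h j z" using ISub[OF jz(1)] k by (auto simp: E_def)
        then have "2 * emeasure lebesgue (grid_cube c h j z) \<le> emeasure lebesgue (grid_cube c h j z)"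
          using half[OF jz(1)] by simp
        then show False
          unfolding emeasure_grid_cube[OF h] by (rule twice_not_le_ennreal[rotated]) (use h in simp)
      qed
    qed
  qed
qed

subsection \<open>Iteration\<close>

lemma nn_integral_count_space_suminf:
  fixes f :: "'i \<Rightarrow> ennreal"
  assumes "countable I" "infinite I"
  shows "(\<integral>\<^sup>+i. f i \<partial>count_space I) = (\<Sum>n. f (from_nat_into I n))"
  using nn_integral_bij_count_space[OF bij_betw_from_nat_into[OF assms], of f]
  by (simp add: nn_integral_count_space_nat)

lemma borel_measurable_nn_integral_count_space:
  fixes f :: "'i \<Rightarrow> 'a \<Rightarrow> ennreal"
  assumes "countable I" and [measurable]: "\<And>i. i \<in> I \<Longrightarrow> f i \<in> borel_measurable M"
  shows "(\<lambda>x. \<integral>\<^sup>+i. f i x \<partial>count_space I) \<in> borel_measurable M"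
proof (cases "finite I")
  case True
  then show ?thesis by (simp add: nn_integral_count_space_finite)
next
  case False
  then have [measurable]: "f (from_nat_into I n) \<in> borel_measurable M" for n
    by (intro assms from_nat_into) auto
  show ?thesis unfolding nn_integral_count_space_suminf[OF assms(1) False] by measurable
qed

lemma sum_le_infsum_ennreal:
  fixes f :: "'i \<Rightarrow> ennreal"
  assumes "finite X" "X \<subseteq> I"
  shows "sum f X \<le> infsum f I"
  using assms by (subst nonneg_infsum_complete) (auto intro!: SUP_upper)

lemma nn_integral_count_space_le_infsum:
  fixes f :: "'i \<Rightarrow> ennreal"
  assumes "countable I"
  shows "(\<integral>\<^sup>+i. f i \<partial>count_space I) \<le> infsum f I"
proof (cases "finite I")
  case True
  then show ?thesis by (simp add: nn_integral_count_space_finite)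
next
  case False
  note bij = bij_betw_from_nat_into[OF assms False]
  have "(\<Sum>i<n. f (from_nat_into I i)) \<le> infsum f I" for n
  proof -
    have "inj_on (from_nat_into I) {..<n}" using bij by (metis bij_betw_def inj_on_subset subset_UNIV)
    then have "(\<Sum>i<n. f (from_nat_into I i)) = sum f (from_nat_into I ` {..<n})"
      by (simp add: sum.reindex)
    also have "\<dots> \<le> infsum f I"
      using bij by (intro sum_le_infsum_ennreal) (auto simp: bij_betw_def)
    finally show ?thesis .
  qed
  then show ?thesis
    unfolding nn_integral_count_space_suminf[OF assms False] by (intro suminf_le_const) auto
qed

lemma nn_integral_count_space_insert_le:
  fixes f :: "'i \<Rightarrow> ennreal"
  assumes "q \<notin> B" "insert q B \<subseteq> C"
  shows "f q + (\<integral>\<^sup>+i. f i \<partial>count_space B) \<le> (\<integral>\<^sup>+i. f i \<partial>count_space C)"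
proof -
  have "f q + (\<integral>\<^sup>+i. f i \<partial>count_space B) =
    (\<integral>\<^sup>+i. f i * indicator {q} i \<partial>count_space UNIV) + (\<integral>\<^sup>+i. f i * indicator B i \<partial>count_space UNIV)"
    by (simp add: nn_integral_count_space_indicator one_ennreal_def[symmetric])
  also have "\<dots> = (\<integral>\<^sup>+i. f i * indicator {q} i + f i * indicator B i \<partial>count_space UNIV)"
    by (simp add: nn_integral_add)
  also have "\<dots> \<le> (\<integral>\<^sup>+i. f i * indicator C i \<partial>count_space UNIV)"
    using assms by (intro nn_integral_mono) (auto simp: indicator_def)
  also have "\<dots> = (\<integral>\<^sup>+i. f i \<partial>count_space C)"
    by (simp add: nn_integral_count_space_indicator)
  finally show ?thesis .
qed

lemma nn_integral_count_space_subset_le: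
  fixes f :: "'i \<Rightarrow> ennreal"
  assumes "B \<subseteq> C"
  shows "(\<integral>\<^sup>+i. f i \<partial>count_space B) \<le> (\<integral>\<^sup>+i. f i \<partial>count_space C)"
proof -
  have "(\<integral>\<^sup>+i. f i * indicator B i \<partial>count_space UNIV) \<le> (\<integral>\<^sup>+i. f i * indicator C i \<partial>count_space UNIV)"
    using assms by (intro nn_integral_mono) (auto simp: indicator_def)
  then show ?thesis by (simp add: nn_integral_count_space_indicator)
qed

text \<open>\<open>u Q\<close> is what remains to be estimated on the cube of Q,
  \<open>off Q\<close> bounds it where there is no child, and \<open>jump Q P\<close> is the price
  of passing to the child P. Measurability is asked of \<open>off\<close> and \<open>jump\<close>
  only: x -> \<open>u Q x\<close> will involve \<open>T\<close> applied to a function that depends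
  on x.\<close>

lemma sparse_iteration:
  fixes ch :: "(real ^ 'n) \<times> real \<Rightarrow> ((real ^ 'n) \<times> real) set"
    and u off w jump
  defines "K \<equiv> \<lambda>Q :: (real ^ 'n) \<times> real. cube (fst Q) (snd Q)"
  assumes base: "ok R\<^sub>0" and pos: "\<And>Q. ok Q \<Longrightarrow> 0 < snd Q"
    and ch: "\<And>Q. ok Q \<Longrightarrow> countable (ch Q)" "\<And>Q P. ok Q \<Longrightarrow> P \<in> ch Q \<Longrightarrow> ok P"
      "\<And>Q. ok Q \<Longrightarrow> disjoint_family_on K (ch Q)" "\<And>Q P. ok Q \<Longrightarrow> P \<in> ch Q \<Longrightarrow> K P \<subseteq> K Q"
    and half: "\<And>Q. ok Q \<Longrightarrow> 2 * emeasure lebesgue (\<Union>P\<in>ch Q. K P) \<le> emeasure lebesgue (K Q)"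
    and off: "\<And>Q. ok Q \<Longrightarrow> off Q \<in> borel_measurable lebesgue"
    and jump: "\<And>Q P. ok Q \<Longrightarrow> P \<in> ch Q \<Longrightarrow> jump Q P \<in> borel_measurable lebesgue"
    and u_off: "\<And>Q x. ok Q \<Longrightarrow> x \<in> K Q \<Longrightarrow> u Q x \<le> (off Q x :: ennreal)"
    and u_jump: "\<And>Q P x. ok Q \<Longrightarrow> P \<in> ch Q \<Longrightarrow> x \<in> K P \<Longrightarrow> u Q x \<le> jump Q P x + u P x"
    and w: "\<And>Q. ok Q \<Longrightarrow> (\<integral>\<^sup>+x\<in>K Q - (\<Union>P\<in>ch Q. K P). off Q x \<partial>lebesgue) +
      (\<integral>\<^sup>+P. (\<integral>\<^sup>+x\<in>K P. jump Q P x \<partial>lebesgue) \<partial>count_space (ch Q)) \<le> w Q"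
  obtains F where "countable F" "\<And>Q. Q \<in> F \<Longrightarrow> ok Q"
    "disjoint_family_on (\<lambda>Q. K Q - (\<Union>P\<in>ch Q. K P)) F"
    "(\<integral>\<^sup>+x\<in>K R\<^sub>0. u R\<^sub>0 x \<partial>lebesgue) \<le> (\<integral>\<^sup>+Q. w Q \<partial>count_space F)"
proof -
  define U where "U Q = (\<Union>P\<in>ch Q. K P)" for Q
  have KL: "K Q \<in> sets lebesgue" for Q by (simp add: K_def)
  have UL: "U Q \<in> sets lebesgue" if "ok Q" for Q
    unfolding U_def using ch(1)[OF that] KL by (intro sets.countable_UN') auto
  have measK: "\<exists>v>0. emeasure lebesgue (K Q) = ennreal v" if "ok Q" for Q
    using pos[OF that] by (auto simp: K_def emeasure_cube intro!: exI[of _ "(2 * snd Q) ^ CARD('n)"])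
  define lev where "lev n = ((\<lambda>S. \<Union>Q\<in>S. ch Q) ^^ n) {R\<^sub>0}" for n
  have lev_0: "lev 0 = {R\<^sub>0}" and lev_Suc: "lev (Suc n) = (\<Union>Q\<in>lev n. ch Q)" for n
    by (simp_all add: lev_def)
  have okl: "Q \<in> lev n \<Longrightarrow> ok Q" for n Q
  proof (induction n arbitrary: Q)
    case (Suc n)
    then show ?case unfolding lev_Suc by (blast intro: ch(2))
  qed (simp add: lev_0 base)
  have cnt: "countable (lev n)" for n
  proof (induction n)
    case (Suc n)
    then show ?case unfolding lev_Suc by (intro countable_UN ch(1) okl)
  qed (simp add: lev_0)
  have disj: "Q = R" if "Q \<in> lev n" "R \<in> lev n" "x \<in> K Q" "x \<in> K R" for n Q R x
    using that
  proof (induction n arbitrary: Q R)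
    case (Suc n)
    then obtain Q' R' where QR: "Q' \<in> lev n" "Q \<in> ch Q'" "R' \<in> lev n" "R \<in> ch R'"
      unfolding lev_Suc by blast
    then have "x \<in> K Q'" "x \<in> K R'" using ch(4) okl Suc.prems by blast+
    then have "Q' = R'" using QR by (intro Suc.IH)
    then show ?case
      using disjoint_family_onD[OF ch(3)[OF okl[OF QR(1)]], of Q R] QR Suc.prems by blast
  qed (auto simp: lev_0)
  define \<Omega> where "\<Omega> n = (\<Union>Q\<in>lev n. K Q)" for n
  have OL: "\<Omega> n \<in> sets lebesgue" for n
    unfolding \<Omega>_def using cnt KL by (intro sets.countable_UN') auto
  have anc: "\<exists>R\<in>lev n. K Q \<subseteq> K R" if "Q \<in> lev (n + k)" for n k Q
    using that
  proof (induction k arbitrary: Q)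
    case (Suc k)
    then obtain Q' where Q': "Q' \<in> lev (n + k)" "Q \<in> ch Q'" unfolding add_Suc_right lev_Suc by blast
    then show ?case using Suc.IH[OF Q'(1)] ch(4)[OF okl[OF Q'(1)] Q'(2)] by blast
  qed auto
  have key: "x \<in> U Q" if "Q \<in> lev n" "R \<in> lev k" "n < k" "x \<in> K Q" "x \<in> K R" for Q R n k x
  proof -
    have "R \<in> lev (Suc n + (k - Suc n))" using that(2,3) by simp
    then obtain P where P: "P \<in> lev (Suc n)" "K R \<subseteq> K P"
      using anc by blast
    then obtain Q' where Q': "Q' \<in> lev n" "P \<in> ch Q'" unfolding lev_Suc by blast
    have "x \<in> K Q'" using P(2) ch(4)[OF okl[OF Q'(1)] Q'(2)] that(5) by blast
    then have "Q' = Q" using disj[OF Q'(1) that(1)] that(4) by blast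
    then show ?thesis using P(2) Q'(2) that(5) by (auto simp: U_def)
  qed
  \<comment> \<open>A cube recurring in a later generation would be contained in the union of its
    own children, which has at most half its measure. So the sum over the set \<open>F\<close> meets
    each generation's terms separately.\<close>
  have lev_disj: "Q \<notin> lev k" if "Q \<in> lev n" "n < k" for Q n k
  proof
    assume "Q \<in> lev k"
    then have "K Q \<subseteq> U Q" using key[OF that(1) _ that(2)] by blast
    then have "2 * emeasure lebesgue (K Q) \<le> 2 * emeasure lebesgue (U Q)"
      using UL[OF okl[OF that(1)]] by (intro mult_left_mono emeasure_mono) auto
    also have "\<dots> \<le> emeasure lebesgue (K Q)" using half[OF okl[OF that(1)]] by (simp add: U_def)
    finally show False
      using measK[OF okl[OF that(1)]] twice_not_le_ennreal by metis
  qed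
  define F where "F = (\<Union>n. lev n)"
  have Fc: "countable F" unfolding F_def by (intro countable_UN cnt) simp
  have Fok: "\<And>Q. Q \<in> F \<Longrightarrow> ok Q" unfolding F_def using okl by blast
  have Fdisj: "disjoint_family_on (\<lambda>Q. K Q - U Q) F"
    unfolding disjoint_family_on_def
  proof (intro ballI impI)
    fix Q R assume "Q \<in> F" "R \<in> F" "Q \<noteq> R"
    then obtain n k where nk: "Q \<in> lev n" "R \<in> lev k" unfolding F_def by blast
    show "(K Q - U Q) \<inter> (K R - U R) = {}"
    proof (rule ccontr)
      assume "(K Q - U Q) \<inter> (K R - U R) \<noteq> {}"
      then obtain x where x: "x \<in> K Q" "x \<notin> U Q" "x \<in> K R" "x \<notin> U R" by blast
      show False
        using key[OF nk, of x] key[OF nk(2,1), of x] disj[of Q n R x] nk x \<open>Q \<noteq> R\<close>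
        by (cases n k rule: linorder_cases) auto
    qed
  qed
  have O_half: "2 * emeasure lebesgue (\<Omega> (Suc n)) \<le> emeasure lebesgue (\<Omega> n)" for n
  proof -
    have "\<Omega> (Suc n) = (\<Union>Q\<in>lev n. U Q)" unfolding \<Omega>_def U_def lev_Suc by blast
    then have "2 * emeasure lebesgue (\<Omega> (Suc n)) \<le> 2 * (\<integral>\<^sup>+Q. emeasure lebesgue (U Q) \<partial>count_space (lev n))"
      using emeasure_UN_le_nn_integral_count_space[OF cnt, of n U lebesgue] UL okl
      by (intro mult_left_mono) auto
    also have "\<dots> = (\<integral>\<^sup>+Q. 2 * emeasure lebesgue (U Q) \<partial>count_space (lev n))"
      by (simp add: nn_integral_cmult)
    also have "\<dots> \<le> (\<integral>\<^sup>+Q. emeasure lebesgue (K Q) \<partial>count_space (lev n))"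
      using half okl by (intro nn_integral_mono) (auto simp: U_def)
    also have "\<dots> = emeasure lebesgue (\<Omega> n)"
      unfolding \<Omega>_def using cnt KL disj
      by (intro emeasure_UN_countable[symmetric]) (auto simp: disjoint_family_on_def)
    finally show ?thesis .
  qed
  define N where "N = (\<Inter>n. \<Omega> n)"
  have NL: "N \<in> sets lebesgue" unfolding N_def using OL by auto
  have N0: "N \<in> null_sets lebesgue"
  proof -
    obtain v where v: "0 < v" "emeasure lebesgue (K R\<^sub>0) = ennreal v" using measK[OF base] by blast
    have O_pow: "2 ^ n * emeasure lebesgue (\<Omega> n) \<le> ennreal v" for n
    proof (induction n)
      case 0
      then show ?case using v by (simp add: \<Omega>_def lev_0)
    next
      case (Suc n)
      have "2 ^ Suc n * emeasure lebesgue (\<Omega> (Suc n)) = 2 ^ n * (2 * emeasure lebesgue (\<Omega> (Suc n)))"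
        by (simp add: mult_ac)
      also have "\<dots> \<le> 2 ^ n * emeasure lebesgue (\<Omega> n)" using O_half by (intro mult_left_mono) auto
      finally show ?case using Suc by (rule order_trans)
    qed
    have N_le: "2 ^ n * emeasure lebesgue N \<le> ennreal v" for n
    proof -
      have "2 ^ n * emeasure lebesgue N \<le> 2 ^ n * emeasure lebesgue (\<Omega> n)"
        using OL by (intro mult_left_mono emeasure_mono) (auto simp: N_def)
      then show ?thesis using O_pow by (rule order_trans)
    qed
    from N_le[of 0] obtain x where x: "emeasure lebesgue N = ennreal x" "0 \<le> x"
      by (cases "emeasure lebesgue N" rule: ennreal_cases) (auto simp: top_unique)
    have le: "2 ^ n * x \<le> v" for n
    proof -
      have "ennreal (2 ^ n * x) \<le> ennreal v"
        using N_le[of n] x by (simp add: ennreal_mult flip: ennreal_power)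
      then show ?thesis using v by (subst (asm) ennreal_le_iff) auto
    qed
    have "x = 0"
    proof (rule ccontr)
      assume "x \<noteq> 0"
      then have "0 < x" using x by simp
      obtain n where "v / x < 2 ^ n" using real_arch_pow[of 2 "v / x"] by auto
      then show False using le[of n] \<open>0 < x\<close> by (simp add: field_simps)
    qed
    then show ?thesis using x NL by (simp add: null_sets_def)
  qed
  \<comment> \<open>All that Q gives off at x. The children being disjoint, at most one of them
    contributes.\<close>
  define r where "r Q x = off Q x * indicator (K Q - U Q) x + (\<integral>\<^sup>+P. jump Q P x * indicator (K P) x \<partial>count_space (ch Q))" for Q x
  \<comment> \<open>The recursion unrolled, with k bounding the number of further generations whose
    cubes contain x.\<close>
  have claim: "u Q x \<le> (\<integral>\<^sup>+R. r R x \<partial>count_space (\<Union>n\<in>{j..j + k}. lev n))"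
    if "Q \<in> lev j" "x \<in> K Q" "x \<notin> \<Omega> (Suc (j + k))" for Q j k x
    using that
  proof (induction k arbitrary: j Q)
    case 0
    have "x \<notin> U Q" using 0 unfolding add_0_right \<Omega>_def U_def lev_Suc by blast
    then have "u Q x \<le> r Q x"
      using u_off[OF okl[OF 0(1)] 0(2)] 0(2) by (simp add: r_def add_increasing2)
    also have "\<dots> \<le> (\<integral>\<^sup>+R. r R x \<partial>count_space (\<Union>n\<in>{j..j + 0}. lev n))"
      using 0 by (intro nn_integral_ge_point) auto
    finally show ?case .
  next
    case (Suc k)
    show ?case
    proof (cases "x \<in> U Q")
      case False
      then have "u Q x \<le> r Q x"
        using u_off[OF okl[OF Suc(2)] Suc(3)] Suc(3) by (simp add: r_def add_increasing2)
      also have "\<dots> \<le> (\<integral>\<^sup>+R. r R x \<partial>count_space (\<Union>n\<in>{j..j + Suc k}. lev n))"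
        using Suc(2) by (intro nn_integral_ge_point) auto
      finally show ?thesis .
    next
      case True
      then obtain P where P: "P \<in> ch Q" "x \<in> K P" unfolding U_def by blast
      have Pl: "P \<in> lev (Suc j)" using P Suc(2) unfolding lev_Suc by blast
      have "jump Q P x = jump Q P x * indicator (K P) x" using P by simp
      also have "\<dots> \<le> (\<integral>\<^sup>+P. jump Q P x * indicator (K P) x \<partial>count_space (ch Q))"
        using P(1) by (intro nn_integral_ge_point)
      also have "\<dots> \<le> r Q x" by (simp add: r_def add_increasing)
      finally have 1: "jump Q P x \<le> r Q x" .
      have 2: "u P x \<le> (\<integral>\<^sup>+R. r R x \<partial>count_space (\<Union>n\<in>{Suc j..Suc j + k}. lev n))"
        using Suc.IH[OF Pl P(2)] Suc(4) by simp
      have "u Q x \<le> jump Q P x + u P x" by (rule u_jump[OF okl[OF Suc(2)] P])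
      also have "\<dots> \<le> r Q x + (\<integral>\<^sup>+R. r R x \<partial>count_space (\<Union>n\<in>{Suc j..Suc j + k}. lev n))"
        using 1 2 by (rule add_mono)
      also have "\<dots> \<le> (\<integral>\<^sup>+R. r R x \<partial>count_space (\<Union>n\<in>{j..j + Suc k}. lev n))"
      proof (rule nn_integral_count_space_insert_le)
        show "Q \<notin> (\<Union>n\<in>{Suc j..Suc j + k}. lev n)"
          using lev_disj[OF Suc(2)] by auto
        have "{Suc j..Suc j + k} \<subseteq> {j..j + Suc k}" "j \<in> {j..j + Suc k}" by auto
        then show "insert Q (\<Union>n\<in>{Suc j..Suc j + k}. lev n) \<subseteq> (\<Union>n\<in>{j..j + Suc k}. lev n)"
          using Suc(2) by blast
      qed
      finally show ?thesis .
    qed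
  qed
  have bound: "u R\<^sub>0 x \<le> (\<integral>\<^sup>+R. r R x \<partial>count_space F)" if x: "x \<in> K R\<^sub>0" "x \<notin> N" for x
  proof -
    obtain n where n: "x \<notin> \<Omega> n" using x(2) by (auto simp: N_def)
    have "n \<noteq> 0"
    proof
      assume "n = 0"
      then show False using n x(1) by (simp add: \<Omega>_def lev_0)
    qed
    then obtain k where k: "n = Suc k" by (cases n) auto
    have "u R\<^sub>0 x \<le> (\<integral>\<^sup>+R. r R x \<partial>count_space (\<Union>n\<in>{0..0 + k}. lev n))"
      using n x(1) unfolding k by (intro claim) (auto simp: lev_0)
    also have "\<dots> \<le> (\<integral>\<^sup>+R. r R x \<partial>count_space F)"
      by (rule nn_integral_count_space_subset_le) (auto simp: F_def)
    finally show ?thesis .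
  qed
  have offm: "(\<lambda>x. off Q x * indicator (K Q - U Q) x) \<in> borel_measurable lebesgue" if "ok Q" for Q
    using off[OF that] KL UL[OF that] by (intro borel_measurable_times_ennreal borel_measurable_indicator sets.Diff)
  have jumpm: "(\<lambda>x. jump Q P x * indicator (K P) x) \<in> borel_measurable lebesgue" if "ok Q" "P \<in> ch Q" for Q P
    using jump[OF that] KL by (intro borel_measurable_times_ennreal borel_measurable_indicator)
  have rm: "r Q \<in> borel_measurable lebesgue" if "ok Q" for Q
    unfolding r_def using offm[OF that] jumpm[OF that] ch(1)[OF that]
    by (intro borel_measurable_add borel_measurable_nn_integral_count_space)
  have "(\<integral>\<^sup>+x\<in>K R\<^sub>0. u R\<^sub>0 x \<partial>lebesgue) \<le> (\<integral>\<^sup>+x. \<integral>\<^sup>+R. r R x \<partial>count_space F \<partial>lebesgue)"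
  proof (rule nn_integral_mono_AE)
    show "AE x in lebesgue. u R\<^sub>0 x * indicator (K R\<^sub>0) x \<le> (\<integral>\<^sup>+R. r R x \<partial>count_space F)"
      using AE_not_in[OF N0] by eventually_elim (use bound in \<open>auto simp: indicator_def\<close>)
  qed
  also have "\<dots> = (\<integral>\<^sup>+R. \<integral>\<^sup>+x. r R x \<partial>lebesgue \<partial>count_space F)"
    by (intro nn_integral_count_space_nn_integral Fc rm Fok)
  also have "\<dots> \<le> (\<integral>\<^sup>+Q. w Q \<partial>count_space F)"
  proof (rule nn_integral_mono)
    fix Q assume "Q \<in> space (count_space F)"
    then have Q: "ok Q" using Fok by simp
    have "(\<integral>\<^sup>+x. r Q x \<partial>lebesgue) = (\<integral>\<^sup>+x\<in>K Q - U Q. off Q x \<partial>lebesgue) +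
      (\<integral>\<^sup>+x. \<integral>\<^sup>+P. jump Q P x * indicator (K P) x \<partial>count_space (ch Q) \<partial>lebesgue)"
      unfolding r_def using offm[OF Q] jumpm[OF Q] ch(1)[OF Q]
      by (intro nn_integral_add borel_measurable_nn_integral_count_space)
    also have "(\<integral>\<^sup>+x. \<integral>\<^sup>+P. jump Q P x * indicator (K P) x \<partial>count_space (ch Q) \<partial>lebesgue) =
      (\<integral>\<^sup>+P. (\<integral>\<^sup>+x\<in>K P. jump Q P x \<partial>lebesgue) \<partial>count_space (ch Q))"
      using jumpm[OF Q] ch(1)[OF Q] by (intro nn_integral_count_space_nn_integral)
    finally show "(\<integral>\<^sup>+x. r Q x \<partial>lebesgue) \<le> w Q" using w[OF Q] by (simp add: U_def)
  qed
  finally have "(\<integral>\<^sup>+x\<in>K R\<^sub>0. u R\<^sub>0 x \<partial>lebesgue) \<le> (\<integral>\<^sup>+Q. w Q \<partial>count_space F)" .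
  with Fc Fok Fdisj show thesis unfolding U_def by (intro that[of F])
qed

text \<open>The free parameter \<open>\<tau>\<close> stands for the average of \<open>G\<close>; leaving it free avoids a separate treatment
  of averages that vanish or are infinite until this point.\<close>

lemma optimise_tau:
  fixes c :: "real ^ 'n"
  assumes X: "\<And>\<tau>. 0 < \<tau> \<Longrightarrow> X \<le> ennreal (c0 * \<tau>) * (\<integral>\<^sup>+x\<in>cube c h. ennreal (1 + (G x / \<tau>) powr r) \<partial>lebesgue)"
    and c0: "0 \<le> c0" and r: "1 \<le> r" and h: "0 < h" and G: "G \<in> borel_measurable lebesgue" "\<And>x. 0 \<le> G x"
  shows "X \<le> ennreal (2 * c0) * (avg r (cube c (3 * h)) G * emeasure lebesgue (cube c (3 * h)))"
proof -
  let ?Q3 = "cube c (3 * h)"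
  define N where "N = (\<integral>\<^sup>+x\<in>?Q3. ennreal (G x powr r) \<partial>lebesgue)"
  define v where "v = measure lebesgue ?Q3"
  have v: "emeasure lebesgue ?Q3 = ennreal v" "0 < v"
    using h by (simp_all add: v_def emeasure_cube measure_cube)
  have bound: "X \<le> ennreal (c0 * \<tau>) * (ennreal v + ennreal (1 / \<tau> powr r) * N)" if \<tau>: "0 < \<tau>" for \<tau>
  proof -
    have [measurable]: "G \<in> borel_measurable lebesgue" by (rule G(1))
    have "(\<integral>\<^sup>+x\<in>cube c h. ennreal (1 + (G x / \<tau>) powr r) \<partial>lebesgue) \<le>
      (\<integral>\<^sup>+x. indicator ?Q3 x + ennreal (1 / \<tau> powr r) * (ennreal (G x powr r) * indicator ?Q3 x) \<partial>lebesgue)"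
    proof (rule nn_integral_mono)
      fix x
      have "1 + (G x / \<tau>) powr r = 1 + 1 / \<tau> powr r * G x powr r"
        using \<tau> G(2) by (simp add: powr_divide)
      then have "ennreal (1 + (G x / \<tau>) powr r) = 1 + ennreal (1 / \<tau> powr r) * ennreal (G x powr r)"
        using \<tau> by (simp only: ennreal_plus ennreal_mult zero_le_one mult_nonneg_nonneg divide_nonneg_nonneg powr_ge_zero ennreal_1)
      then show "ennreal (1 + (G x / \<tau>) powr r) * indicator (cube c h) x \<le>
        indicator ?Q3 x + ennreal (1 / \<tau> powr r) * (ennreal (G x powr r) * indicator ?Q3 x)"
        using cube_subset_triple[OF h, of c] by (auto simp: indicator_def)
    qed
    also have "\<dots> = (\<integral>\<^sup>+x. indicator ?Q3 x \<partial>lebesgue) + (\<integral>\<^sup>+x. ennreal (1 / \<tau> powr r) * (ennreal (G x powr r) * indicator ?Q3 x) \<partial>lebesgue)"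
      by (rule nn_integral_add) simp_all
    also have "(\<integral>\<^sup>+x. ennreal (1 / \<tau> powr r) * (ennreal (G x powr r) * indicator ?Q3 x) \<partial>lebesgue) = ennreal (1 / \<tau> powr r) * N"
      unfolding N_def by (rule nn_integral_cmult) simp
    also have "(\<integral>\<^sup>+x. indicator ?Q3 x \<partial>lebesgue) = ennreal v" using v(1) by simp
    finally show ?thesis using X[OF \<tau>] by (meson mult_left_mono order_trans zero_le)
  qed
  show ?thesis
  proof (cases "avg r ?Q3 G" rule: ennreal_cases)
    case (real \<beta>)
    have "0 < r" "0 < 3 * h" using r h by auto
    from avg_le_iff[OF this(1) real(1) this(2), of c G] real(2)
    have N: "N \<le> ennreal (\<beta> powr r) * ennreal v" by (simp add: N_def v(1))
    show ?thesis
    proof (cases "\<beta> = 0")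
      case True
      then have N0: "N = 0" using N by simp
      have "X \<le> 0 + ennreal e" if e: "0 < e" for e
      proof -
        \<comment> \<open>A vanishing average allows \<tau> to tend to 0. The 1 in the denominator
          covers c0 = 0, and the resulting bound is at most e.\<close>
        have pos: "0 < e / (c0 * v + 1)" using e c0 v(2) by (simp add: add_nonneg_pos)
        have "X \<le> ennreal (c0 * (e / (c0 * v + 1))) * ennreal v" using bound[OF pos] N0 by simp
        also have "\<dots> = ennreal (c0 * (e / (c0 * v + 1)) * v)"
          using c0 v(2) pos by (simp only: ennreal_mult mult_nonneg_nonneg less_imp_le)
        also have "c0 * (e / (c0 * v + 1)) * v = e * (c0 * v / (c0 * v + 1))" by simp
        also have "\<dots> \<le> e * 1"
        proof (rule mult_left_mono)
          have "0 \<le> c0 * v" using c0 v(2) by simp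
          then show "c0 * v / (c0 * v + 1) \<le> 1" by simp
        qed (use e in simp)
        finally show ?thesis by (simp add: ennreal_leI)
      qed
      then have "X \<le> 0" by (rule ennreal_le_epsilon)
      then show ?thesis by simp
    next
      case False
      then have \<beta>: "0 < \<beta>" using real by simp
      \<comment> \<open>At \<tau> = \<beta> the second term is at most the measure of the tripled
        cube, which is the first; hence the factor 2.\<close>
      have "X \<le> ennreal (c0 * \<beta>) * (ennreal v + ennreal (1 / \<beta> powr r) * N)" by (rule bound[OF \<beta>])
      also have "\<dots> \<le> ennreal (c0 * \<beta>) * (ennreal v + ennreal (1 / \<beta> powr r) * (ennreal (\<beta> powr r) * ennreal v))"
        using N by (intro mult_left_mono add_left_mono) auto
      also have "ennreal (1 / \<beta> powr r) * (ennreal (\<beta> powr r) * ennreal v) = ennreal (1 / \<beta> powr r * (\<beta> powr r * v))"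
        using v(2) by (simp only: ennreal_mult mult_nonneg_nonneg less_imp_le powr_ge_zero divide_nonneg_nonneg zero_le_one)
      also have "1 / \<beta> powr r * (\<beta> powr r * v) = v" using \<beta> by simp
      also have "ennreal v + ennreal v = ennreal (2 * v)" using v(2) by (simp flip: ennreal_plus)
      also have "ennreal (c0 * \<beta>) * ennreal (2 * v) = ennreal (2 * c0) * (ennreal \<beta> * ennreal v)"
        using c0 \<beta> v(2) by (simp add: ennreal_mult mult_ac)
      finally show ?thesis unfolding real(2) v(1) .
    qed
  next
    case top
    show ?thesis
    \<comment> \<open>An infinite average makes the right-hand side infinite unless c0 = 0. In that
      case X = 0 by the hypothesis for any \<tau>, since 0 times \<infinity> is 0.\<close>
    proof (cases "c0 = 0")
      case True
      then show ?thesis using X[of 1] by simp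
    next
      case False
      then show ?thesis using c0 v by (simp add: top ennreal_mult_eq_top_iff ennreal_top_mult ennreal_mult_top)
    qed
  qed
qed

subsection \<open>Commutators and interpolation of averages\<close>

lemma Lp_c_dominated2:
  fixes f\<^sub>1 f\<^sub>2 g :: "real ^ 'n \<Rightarrow> 'k::{real_normed_field, euclidean_space}"
  assumes f: "f\<^sub>1 \<in> Lp_c p" "f\<^sub>2 \<in> Lp_c p" and g: "g \<in> borel_measurable lebesgue" and C: "0 \<le> C" and p: "0 \<le> p"
    and le: "\<And>x. norm (g x) \<le> C * (norm (f\<^sub>1 x) + norm (f\<^sub>2 x))"
  shows "g \<in> Lp_c p"
proof -
  have [measurable]: "f\<^sub>1 \<in> borel_measurable lebesgue" "f\<^sub>2 \<in> borel_measurable lebesgue"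
    using f by (simp_all add: Lp_c_iff)
  have pt: "norm (g x) powr p \<le> (2 * C) powr p * (norm (f\<^sub>1 x) powr p + norm (f\<^sub>2 x) powr p)" for x
  proof -
    let ?M = "max (norm (f\<^sub>1 x)) (norm (f\<^sub>2 x))"
    have "C * (norm (f\<^sub>1 x) + norm (f\<^sub>2 x)) \<le> C * (2 * ?M)" using C by (intro mult_left_mono) auto
    then have "norm (g x) \<le> 2 * C * ?M" using le[of x] by (simp add: mult_ac)
    then have "norm (g x) powr p \<le> (2 * C * ?M) powr p" using p by (intro powr_mono2) auto
    also have "\<dots> = (2 * C) powr p * ?M powr p" using C by (intro powr_mult)
    also have "?M powr p \<le> norm (f\<^sub>1 x) powr p + norm (f\<^sub>2 x) powr p" by (simp add: max_def)
    finally show ?thesis using C by (simp add: mult_left_mono)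
  qed
  have "(\<integral>\<^sup>+x. ennreal (norm (g x) powr p) \<partial>lebesgue) \<le>
    (\<integral>\<^sup>+x. ennreal ((2 * C) powr p) * (ennreal (norm (f\<^sub>1 x) powr p) + ennreal (norm (f\<^sub>2 x) powr p)) \<partial>lebesgue)"
  proof (rule nn_integral_mono)
    fix x
    show "ennreal (norm (g x) powr p) \<le> ennreal ((2 * C) powr p) * (ennreal (norm (f\<^sub>1 x) powr p) + ennreal (norm (f\<^sub>2 x) powr p))"
      using ennreal_leI[OF pt[of x]] by (simp add: ennreal_mult)
  qed
  also have "\<dots> = ennreal ((2 * C) powr p) *
      ((\<integral>\<^sup>+x. ennreal (norm (f\<^sub>1 x) powr p) \<partial>lebesgue) + (\<integral>\<^sup>+x. ennreal (norm (f\<^sub>2 x) powr p) \<partial>lebesgue))"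
    by (simp add: nn_integral_cmult nn_integral_add)
  also have "\<dots> < \<infinity>" using f by (simp add: Lp_c_iff ennreal_mult_less_top)
  finally have fin: "(\<integral>\<^sup>+x. ennreal (norm (g x) powr p) \<partial>lebesgue) < \<infinity>" .
  have sub: "{x. g x \<noteq> 0} \<subseteq> {x. f\<^sub>1 x \<noteq> 0} \<union> {x. f\<^sub>2 x \<noteq> 0}"
  proof
    fix x assume "x \<in> {x. g x \<noteq> 0}"
    then show "x \<in> {x. f\<^sub>1 x \<noteq> 0} \<union> {x. f\<^sub>2 x \<noteq> 0}" using le[of x] by (auto intro: ccontr)
  qed
  have "bounded ({x. f\<^sub>1 x \<noteq> 0} \<union> {x. f\<^sub>2 x \<noteq> 0})" using f by (simp add: Lp_c_iff)
  then have "bounded {x. g x \<noteq> 0}"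
    by (rule bounded_subset) (rule sub)
  with fin show ?thesis
    using g by (simp add: Lp_c_iff)
qed

lemma Linf_c_imp_Lp_c:
  fixes f :: "real ^ 'n \<Rightarrow> 'k::{real_normed_field, euclidean_space}"
  assumes "f \<in> Linf_c" "0 \<le> p"
  shows "f \<in> Lp_c p"
proof -
  obtain B where B: "AE x in lebesgue. norm (f x) \<le> B" using assms by (auto simp: Linf_c_def)
  have "compact (closure {x. f x \<noteq> 0})" using assms by (simp add: Linf_c_def)
  then obtain h where h: "0 < h" "closure {x. f x \<noteq> 0} \<subseteq> cube (0 :: real ^ 'n) h" by (rule compact_subset_cube)
  have "(\<integral>\<^sup>+x. ennreal (norm (f x) powr p) \<partial>lebesgue) \<le> (\<integral>\<^sup>+x. ennreal (B powr p) * indicator (cube (0 :: real ^ 'n) h) x \<partial>lebesgue)"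
  proof (rule nn_integral_mono_AE)
    show "AE x in lebesgue. ennreal (norm (f x) powr p) \<le> ennreal (B powr p) * indicator (cube (0 :: real ^ 'n) h) x"
      using B
    proof (rule eventually_mono)
      fix x assume x: "norm (f x) \<le> B"
      show "ennreal (norm (f x) powr p) \<le> ennreal (B powr p) * indicator (cube (0 :: real ^ 'n) h) x"
      proof (cases "x \<in> cube (0 :: real ^ 'n) h")
        case True
        then show ?thesis using x assms(2) by (auto intro!: ennreal_leI powr_mono2)
      next
        case False
        then have "f x = 0" using h(2) closure_subset[of "{x. f x \<noteq> 0}"] by blast
        then show ?thesis by simp
      qed
    qed
  qed
  also have "\<dots> = ennreal (B powr p) * emeasure lebesgue (cube (0 :: real ^ 'n) h)" by (simp add: nn_integral_cmult)
  also have "\<dots> < \<infinity>" using h(1) by (simp add: emeasure_cube ennreal_mult_less_top)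
  finally show ?thesis using assms by (simp add: Lp_c_iff Linf_c_def)
qed

text \<open>|a - b|^k \<le> 2^m (1 + |a|)^m (1 + |b|^m), where the 1 keeps the base above 1 so that
  the exponent may be raised from k to m. Thus the two extreme powers of b control all F_k for every
  constant a.\<close>

lemma Lp_c_power:
  fixes f b :: "real ^ 'n \<Rightarrow> 'k::{real_normed_field, euclidean_space}"
  assumes f: "f \<in> Lp_c p" "(\<lambda>y. b y ^ m * f y) \<in> Lp_c p" and b: "b \<in> borel_measurable lebesgue"
    and p: "0 \<le> p" and k: "k \<le> m"
  shows "(\<lambda>y. (a - b y) ^ k * f y) \<in> Lp_c p"
proof (rule Lp_c_dominated2[OF f, of _ "2 ^ m * (1 + norm a) ^ m"])
  have [measurable]: "f \<in> borel_measurable lebesgue" "b \<in> borel_measurable lebesgue" using f b by (simp_all add: Lp_c_iff)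
  show "(\<lambda>y. (a - b y) ^ k * f y) \<in> borel_measurable lebesgue" by measurable
  fix y
  let ?a = "1 + norm a" and ?b = "norm (b y)"
  have "norm (a - b y) ^ k \<le> (?a + ?b) ^ k"
    using norm_triangle_ineq4[of a "b y"] by (intro power_mono) auto
  also have "\<dots> \<le> (?a + ?b) ^ m" using k by (intro power_increasing) auto
  also have "\<dots> \<le> (2 * max ?a ?b) ^ m" by (intro power_mono) (auto simp: max_def)
  also have "\<dots> = 2 ^ m * max ?a ?b ^ m" by (rule power_mult_distrib)
  also have "max ?a ?b ^ m \<le> ?a ^ m * (1 + ?b ^ m)"
  proof (cases "?a \<le> ?b")
    case True
    have "1 * ?b ^ m \<le> ?a ^ m * ?b ^ m" by (intro mult_right_mono one_le_power) auto
    moreover have "0 \<le> ?a ^ m" by simp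
    ultimately show ?thesis using True by (simp add: distrib_left max_absorb2 del: zero_le_power)
  next
    case False
    have "0 \<le> ?a ^ m * ?b ^ m" by simp
    then show ?thesis using False by (simp add: distrib_left max_absorb1)
  qed
  finally have "norm (a - b y) ^ k * norm (f y) \<le> 2 ^ m * (?a ^ m * (1 + ?b ^ m)) * norm (f y)"
    by (intro mult_right_mono) (auto simp: mult_left_mono)
  then show "norm ((a - b y) ^ k * f y) \<le> 2 ^ m * ?a ^ m * (norm (f y) + norm (b y ^ m * f y))"
    by (simp add: norm_mult norm_power algebra_simps)
qed (use p in auto)

lemma sublinear_sum:
  fixes T :: "(real ^ 'n \<Rightarrow> 'k::{real_normed_field, euclidean_space}) \<Rightarrow> real ^ 'n \<Rightarrow> 'k"
  assumes T: "sublinear_operator_on (Lp_c p) T" and p: "0 \<le> p" and S: "finite S"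
    and f: "\<And>k. k \<in> S \<Longrightarrow> f k \<in> Lp_c p"
  shows "(\<lambda>y. \<Sum>k\<in>S. d k * f k y) \<in> Lp_c p"
    "norm (T (\<lambda>y. \<Sum>k\<in>S. d k * f k y) x) \<le> (\<Sum>k\<in>S. norm (d k) * norm (T (f k) x))"
proof -
  have add: "norm (T (\<lambda>y. f y + g y) x) \<le> norm (T f x) + norm (T g x)"
    and mult: "norm (T (\<lambda>y. c * f y) x) = norm c * norm (T f x)" if "f \<in> Lp_c p" "g \<in> Lp_c p" for f g c
    using T that by (simp_all add: sublinear_operator_on_def)
  have zero: "(\<lambda>y. 0 :: 'k) \<in> Lp_c p" by (simp add: Lp_c_iff)
  have "(\<lambda>y. \<Sum>k\<in>S. d k * f k y) \<in> Lp_c p \<and>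
    norm (T (\<lambda>y. \<Sum>k\<in>S. d k * f k y) x) \<le> (\<Sum>k\<in>S. norm (d k) * norm (T (f k) x))"
    using S f
  proof (induction S)
    case empty
    show ?case using zero mult[OF zero zero, of 0] by simp
  next
    case (insert k S)
    let ?g = "\<lambda>y. \<Sum>k\<in>S. d k * f k y"
    have IH: "?g \<in> Lp_c p" "norm (T ?g x) \<le> (\<Sum>k\<in>S. norm (d k) * norm (T (f k) x))"
      using insert by auto
    have k: "f k \<in> Lp_c p" "(\<lambda>y. d k * f k y) \<in> Lp_c p" using insert.prems p by (auto intro: Lp_c_cmult)
    have "(\<lambda>y. d k * f k y + ?g y) \<in> Lp_c p"
      using k(2) IH(1) p by (intro Lp_c_dominated2[OF k(2) IH(1), of _ 1]) (auto simp: Lp_c_iff norm_triangle_ineq)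
    moreover have "norm (T (\<lambda>y. d k * f k y + ?g y) x) \<le> norm (d k) * norm (T (f k) x) + norm (T ?g x)"
      using add[OF k(2) IH(1)] mult[OF k(1) k(1)] by simp
    ultimately show ?case using insert.hyps IH(2) by simp
  qed
  then show "(\<lambda>y. \<Sum>k\<in>S. d k * f k y) \<in> Lp_c p"
    "norm (T (\<lambda>y. \<Sum>k\<in>S. d k * f k y) x) \<le> (\<Sum>k\<in>S. norm (d k) * norm (T (f k) x))" by auto
qed

text \<open>At a fixed x the powers of b(x) - a are scalars and leave \<open>T\<close> by
  homogeneity; what remains inside does not depend on x. This uses sublinearity at every single
  point.\<close>

lemma commutator_expand:
  fixes T :: "(real ^ 'n \<Rightarrow> 'k::{real_normed_field, euclidean_space}) \<Rightarrow> real ^ 'n \<Rightarrow> 'k"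
  assumes T: "sublinear_operator_on (Lp_c p) T" and p: "0 \<le> p" and S: "S \<in> sets lebesgue"
    and F: "\<And>k. k \<le> m \<Longrightarrow> (\<lambda>y. (a - b y) ^ k * f y) \<in> Lp_c p"
  shows "norm (T (cutoff S (\<lambda>y. (b x - b y) ^ m * f y)) x) \<le>
    (\<Sum>k\<le>m. real (m choose k) * norm (b x - a) ^ (m - k) * norm (T (cutoff S (\<lambda>y. (a - b y) ^ k * f y)) x))"
proof -
  have "cutoff S (\<lambda>y. (b x - b y) ^ m * f y) =
    (\<lambda>y. \<Sum>k\<le>m. (of_nat (m choose k) * (b x - a) ^ (m - k)) * cutoff S (\<lambda>y. (a - b y) ^ k * f y) y)"
  proof
    fix y
    have "(b x - b y) ^ m = ((a - b y) + (b x - a)) ^ m" by simp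
    also have "\<dots> = (\<Sum>k\<le>m. of_nat (m choose k) * (a - b y) ^ k * (b x - a) ^ (m - k))"
      by (rule binomial_ring)
    finally show "cutoff S (\<lambda>y. (b x - b y) ^ m * f y) y =
      (\<Sum>k\<le>m. (of_nat (m choose k) * (b x - a) ^ (m - k)) * cutoff S (\<lambda>y. (a - b y) ^ k * f y) y)"
      by (simp add: cutoff_def sum_distrib_left sum_distrib_right mult_ac)
  qed
  then have "norm (T (cutoff S (\<lambda>y. (b x - b y) ^ m * f y)) x) \<le>
    (\<Sum>k\<le>m. norm (of_nat (m choose k) * (b x - a) ^ (m - k)) * norm (T (cutoff S (\<lambda>y. (a - b y) ^ k * f y)) x))"
    using sublinear_sum(2)[OF T p, of "{..m}" "\<lambda>k. cutoff S (\<lambda>y. (a - b y) ^ k * f y)"] F S p by (simp add: Lp_c_cutoff)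
  then show ?thesis by (simp add: norm_mult norm_power)
qed

section \<open>Interpolation between averages\<close>

lemma avg_eq_0_iff:
  fixes c :: "real ^ 'n"
  assumes "0 < r" "0 < h" "F \<in> borel_measurable lebesgue"
  shows "avg r (cube c h) F = 0 \<longleftrightarrow> (AE x in lebesgue. x \<in> cube c h \<longrightarrow> F x = 0)"
proof -
  have [measurable]: "F \<in> borel_measurable lebesgue" by fact
  have "avg r (cube c h) F = 0 \<longleftrightarrow> avg r (cube c h) F \<le> ennreal 0" by simp
  also have "\<dots> \<longleftrightarrow> (\<integral>\<^sup>+x\<in>cube c h. ennreal (F x powr r) \<partial>lebesgue) \<le> ennreal (0 powr r) * emeasure lebesgue (cube c h)"
    using assms by (intro avg_le_iff) auto
  also have "\<dots> \<longleftrightarrow> (\<integral>\<^sup>+x\<in>cube c h. ennreal (F x powr r) \<partial>lebesgue) = 0" by simp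
  also have "\<dots> \<longleftrightarrow> (AE x in lebesgue. ennreal (F x powr r) * indicator (cube c h) x = 0)"
    by (rule nn_integral_0_iff_AE) simp
  also have "\<dots> \<longleftrightarrow> (AE x in lebesgue. x \<in> cube c h \<longrightarrow> F x = 0)"
  proof -
    have "ennreal (F x powr r) = 0 \<longleftrightarrow> F x = 0" for x
      using ennreal_eq_0_iff[of "F x powr r"] powr_ge_zero[of "F x" r] powr_eq_0_iff[of "F x" r] by linarith
    then have "ennreal (F x powr r) * indicator (cube c h) x = 0 \<longleftrightarrow> (x \<in> cube c h \<longrightarrow> F x = 0)" for x
      by (auto simp: indicator_def)
    then show ?thesis by simp
  qed
  finally show ?thesis .
qed

lemma add_powr_le_powr_add:
  fixes x y p :: real
  assumes "0 \<le> x" "0 \<le> y" "1 \<le> p"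
  shows "x powr p + y powr p \<le> (x + y) powr p"
proof -
  have "z powr p \<le> z * (x + y) powr (p - 1)" if "0 \<le> z" "z \<le> x + y" for z
  proof (cases "z = 0")
    case False
    then have "z powr p = z * z powr (p - 1)" using that by (simp add: powr_mult_base)
    also have "\<dots> \<le> z * (x + y) powr (p - 1)" using that assms by (intro mult_left_mono powr_mono2) auto
    finally show ?thesis .
  qed simp
  from this[of x] this[of y] have "x powr p + y powr p \<le> (x + y) * (x + y) powr (p - 1)"
    using assms by (simp add: distrib_right)
  also have "\<dots> = (x + y) powr p" using assms by (cases "x + y = 0") (auto simp: powr_mult_base)
  finally show ?thesis .
qed

text \<open>Where s \<le> \<sigma>, s^k is at most \<sigma>^k; elsewhere it is at most s^m /
  \<sigma>^(m-k). The superadditivity of x^p recombines the two p-th powers with constant 1.\<close>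

lemma avg_power_split:
  fixes c :: "real ^ 'n"
  assumes h: "0 < h" and p: "1 \<le> p" and k: "k \<le> m" and \<sigma>: "0 < \<sigma>"
    and meas: "s \<in> borel_measurable lebesgue" "f \<in> borel_measurable lebesgue"
    and pos: "\<And>x. 0 \<le> s x" "\<And>x. 0 \<le> f x"
    and a0: "avg p (cube c h) f = ennreal a\<^sub>0" "0 \<le> a\<^sub>0"
    and am: "avg p (cube c h) (\<lambda>x. s x ^ m * f x) = ennreal a\<^sub>m" "0 \<le> a\<^sub>m"
  shows "avg p (cube c h) (\<lambda>x. s x ^ k * f x) \<le> ennreal (\<sigma> ^ k * a\<^sub>0 + a\<^sub>m / \<sigma> ^ (m - k))"
proof -
  have [measurable]: "s \<in> borel_measurable lebesgue" "f \<in> borel_measurable lebesgue" by fact+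
  have p0: "0 < p" using p by simp
  let ?Q = "cube c h" and ?\<alpha> = "\<sigma> ^ k" and ?\<beta> = "1 / \<sigma> ^ (m - k)"
  define v where "v = measure lebesgue ?Q"
  have v: "emeasure lebesgue ?Q = ennreal v" "0 < v"
    using h by (simp_all add: v_def emeasure_cube measure_cube)
  have I0: "(\<integral>\<^sup>+x\<in>?Q. ennreal (f x powr p) \<partial>lebesgue) \<le> ennreal (a\<^sub>0 powr p) * ennreal v"
    using avg_le_iff[OF p0 a0(2) h, of c f] a0(1) v by simp
  have Im: "(\<integral>\<^sup>+x\<in>?Q. ennreal ((s x ^ m * f x) powr p) \<partial>lebesgue) \<le> ennreal (a\<^sub>m powr p) * ennreal v"
    using avg_le_iff[OF p0 am(2) h, of c "\<lambda>x. s x ^ m * f x"] am(1) v by simp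
  have pt: "(s x ^ k * f x) powr p \<le> ?\<alpha> powr p * f x powr p + ?\<beta> powr p * (s x ^ m * f x) powr p" for x
  proof (cases "s x \<le> \<sigma>")
    case True
    have "s x ^ k * f x \<le> ?\<alpha> * f x" using True pos by (intro mult_right_mono power_mono) auto
    then have "(s x ^ k * f x) powr p \<le> (?\<alpha> * f x) powr p" using pos p by (intro powr_mono2) auto
    also have "\<dots> = ?\<alpha> powr p * f x powr p" using pos \<sigma> by (intro powr_mult)
    finally show ?thesis by (simp add: add_increasing2)
  next
    case False
    have "s x ^ k * \<sigma> ^ (m - k) \<le> s x ^ k * s x ^ (m - k)" using False pos \<sigma> by (intro mult_left_mono power_mono) auto
    also have "\<dots> = s x ^ m" using k by (simp flip: power_add)
    finally have "s x ^ k \<le> ?\<beta> * s x ^ m" using \<sigma> by (simp add: field_simps)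
    then have "s x ^ k * f x \<le> ?\<beta> * s x ^ m * f x" using pos by (intro mult_right_mono)
    then have "(s x ^ k * f x) powr p \<le> (?\<beta> * (s x ^ m * f x)) powr p" using pos p by (intro powr_mono2) (auto simp: mult.assoc)
    also have "\<dots> = ?\<beta> powr p * (s x ^ m * f x) powr p" using pos \<sigma> by (intro powr_mult)
    finally show ?thesis by (simp add: add_increasing)
  qed
  have "(\<integral>\<^sup>+x\<in>?Q. ennreal ((s x ^ k * f x) powr p) \<partial>lebesgue) \<le>
    (\<integral>\<^sup>+x. ennreal (?\<alpha> powr p) * (ennreal (f x powr p) * indicator ?Q x) +
      ennreal (?\<beta> powr p) * (ennreal ((s x ^ m * f x) powr p) * indicator ?Q x) \<partial>lebesgue)"
  proof (rule nn_integral_mono)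
    fix x
    have "ennreal ((s x ^ k * f x) powr p) \<le> ennreal (?\<alpha> powr p) * ennreal (f x powr p) + ennreal (?\<beta> powr p) * ennreal ((s x ^ m * f x) powr p)"
      using ennreal_leI[OF pt[of x]] by (simp add: ennreal_mult)
    then show "ennreal ((s x ^ k * f x) powr p) * indicator ?Q x \<le> ennreal (?\<alpha> powr p) * (ennreal (f x powr p) * indicator ?Q x) +
      ennreal (?\<beta> powr p) * (ennreal ((s x ^ m * f x) powr p) * indicator ?Q x)"
      by (simp add: indicator_def)
  qed
  also have "\<dots> = ennreal (?\<alpha> powr p) * (\<integral>\<^sup>+x\<in>?Q. ennreal (f x powr p) \<partial>lebesgue) +
      ennreal (?\<beta> powr p) * (\<integral>\<^sup>+x\<in>?Q. ennreal ((s x ^ m * f x) powr p) \<partial>lebesgue)"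
    by (simp add: nn_integral_add nn_integral_cmult)
  also have "\<dots> \<le> ennreal (?\<alpha> powr p) * (ennreal (a\<^sub>0 powr p) * ennreal v) + ennreal (?\<beta> powr p) * (ennreal (a\<^sub>m powr p) * ennreal v)"
    using I0 Im by (intro add_mono mult_left_mono) auto
  also have "\<dots> = ennreal (?\<alpha> powr p * (a\<^sub>0 powr p * v) + ?\<beta> powr p * (a\<^sub>m powr p * v))"
    using v(2) by (simp only: ennreal_plus ennreal_mult mult_nonneg_nonneg powr_ge_zero less_imp_le)
  also have "?\<alpha> powr p * (a\<^sub>0 powr p * v) + ?\<beta> powr p * (a\<^sub>m powr p * v) = ((?\<alpha> * a\<^sub>0) powr p + (?\<beta> * a\<^sub>m) powr p) * v"
    using a0(2) am(2) \<sigma> by (simp add: powr_mult powr_divide distrib_right)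
  also have "ennreal \<dots> \<le> ennreal ((?\<alpha> * a\<^sub>0 + ?\<beta> * a\<^sub>m) powr p * v)"
    using a0(2) am(2) \<sigma> v(2) p by (intro ennreal_leI mult_right_mono add_powr_le_powr_add) auto
  also have "\<dots> = ennreal ((\<sigma> ^ k * a\<^sub>0 + a\<^sub>m / \<sigma> ^ (m - k)) powr p) * emeasure lebesgue ?Q"
    unfolding v(1) using v(2) by (simp add: ennreal_mult)
  finally show ?thesis
    using a0(2) am(2) \<sigma> by (subst avg_le_iff[OF p0 _ h]) auto
qed

text \<open>A substitute for the logarithmic convexity of \<open>k \<mapsto> avg p Q (s\<^sup>k f)\<close>, with \<open>\<sigma>\<close> chosen such that \<open>\<sigma>\<^sup>m\<close> is the ratio of the averages of \<open>s\<^sup>m f\<close> and \<open>f\<close>.\<close>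

lemma avg_product_interpolation:
  fixes c :: "real ^ 'n"
  assumes h: "0 < h" and pr: "1 \<le> p" "1 \<le> r" and k: "k \<le> m"
    and meas: "s \<in> borel_measurable lebesgue" "f \<in> borel_measurable lebesgue" "g \<in> borel_measurable lebesgue"
    and pos: "\<And>x. 0 \<le> s x" "\<And>x. 0 \<le> f x" "\<And>x. 0 \<le> g x"
  defines "A \<equiv> \<lambda>j. avg p (cube c h) (\<lambda>x. s x ^ j * f x)" and "B \<equiv> \<lambda>j. avg r (cube c h) (\<lambda>x. s x ^ j * g x)"
  shows "A k * B (m - k) \<le> 2 * (A m * B 0 + A 0 * B m)"
proof -
  have dbl: "x \<le> 2 * (x + y)" "y \<le> 2 * (x + y)" for x y :: ennreal
  proof -
    have "1 * (x + y) \<le> 2 * (x + y)" by (rule mult_right_mono) simp_all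
    then have *: "x + y \<le> 2 * (x + y)" by (simp only: mult_1_left)
    have "x \<le> x + y" "y \<le> x + y" by (rule add_increasing2, simp, simp, rule add_increasing, simp, simp)
    with * show "x \<le> 2 * (x + y)" "y \<le> 2 * (x + y)" by (blast intro: order_trans)+
  qed
  have [measurable]: "s \<in> borel_measurable lebesgue" "f \<in> borel_measurable lebesgue" "g \<in> borel_measurable lebesgue" by fact+
  \<comment> \<open>If u or s^m u vanishes almost everywhere on the cube, so does s^j u for every j
    \<ge> 1. For 0 < k < m this makes one of the two factors vanish.\<close>
  have zero: "avg r (cube c h) (\<lambda>x. s x ^ j * u x) = 0"
    if "1 \<le> r" "u \<in> borel_measurable lebesgue" "j \<noteq> 0"
      "avg r (cube c h) (\<lambda>x. s x ^ 0 * u x) = 0 \<or> avg r (cube c h) (\<lambda>x. s x ^ m * u x) = 0" for r u j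
  proof -
    have [measurable]: "u \<in> borel_measurable lebesgue" by fact
    have r: "0 < r" using that by simp
    have iff: "avg r (cube c h) (\<lambda>x. s x ^ i * u x) = 0 \<longleftrightarrow> (AE x in lebesgue. x \<in> cube c h \<longrightarrow> s x ^ i * u x = 0)" for i
      by (rule avg_eq_0_iff[OF r h]) measurable
    from that(4) show ?thesis
      unfolding iff
    proof (elim disjE)
      assume "AE x in lebesgue. x \<in> cube c h \<longrightarrow> s x ^ 0 * u x = 0"
      then show "AE x in lebesgue. x \<in> cube c h \<longrightarrow> s x ^ j * u x = 0"
        by (rule eventually_mono) simp
    next
      assume "AE x in lebesgue. x \<in> cube c h \<longrightarrow> s x ^ m * u x = 0"
      then show "AE x in lebesgue. x \<in> cube c h \<longrightarrow> s x ^ j * u x = 0"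
        by (rule eventually_mono) (use that(3) in auto)
    qed
  qed
  consider "k = 0" | "k = m" | "A 0 = 0 \<or> A m = 0 \<or> B 0 = 0 \<or> B m = 0" "k \<noteq> 0" "k \<noteq> m"
    | "A 0 \<noteq> 0" "A m \<noteq> 0" "B 0 \<noteq> 0" "B m \<noteq> 0" "k \<noteq> 0" "k \<noteq> m"
    by blast
  then show ?thesis
  proof cases
    case 1
    then show ?thesis using dbl(2) by simp
  next
    case 2
    then show ?thesis using dbl(1) by simp
  next
    case 3
    then have "m - k \<noteq> 0" using k by simp
    then have B: "B (m - k) = 0" if "B 0 = 0 \<or> B m = 0"
      using that unfolding B_def by (rule zero[OF pr(2) meas(3)])
    have A: "A k = 0" if "A 0 = 0 \<or> A m = 0"
      using 3(2) that unfolding A_def by (rule zero[OF pr(1) meas(2)])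
    from 3(1) A B have "A k = 0 \<or> B (m - k) = 0" by blast
    then have "A k * B (m - k) = 0" by (elim disjE) simp_all
    then show ?thesis by (simp only: zero_le)
  next
    case 4
    show ?thesis
    proof (cases "A 0 = \<infinity> \<or> A m = \<infinity> \<or> B 0 = \<infinity> \<or> B m = \<infinity>")
      case True
      \<comment> \<open>All four averages being nonzero, no infinite one is cancelled by a factor
        0.\<close>
      then have "A m * B 0 + A 0 * B m = \<infinity>" using 4 by (auto simp: ennreal_mult_eq_top_iff)
      then have "2 * (A m * B 0 + A 0 * B m) = top" by (simp only: infinity_ennreal_def) (simp add: ennreal_mult_top)
      then show ?thesis by (simp only: top_greatest)
    next
      case False
      have ne: "A 0 \<noteq> \<infinity>" "A m \<noteq> \<infinity>" "B 0 \<noteq> \<infinity>" "B m \<noteq> \<infinity>"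
        using False by blast+
      have real: "x = ennreal (enn2real x)" if "x \<noteq> \<infinity>" for x
        using that by (cases x rule: ennreal_cases) simp_all
      define a0 am b0 bm where "a0 = enn2real (A 0)" "am = enn2real (A m)" "b0 = enn2real (B 0)" "bm = enn2real (B m)"
      note defs = this
      have r: "A 0 = ennreal a0" "A m = ennreal am" "B 0 = ennreal b0" "B m = ennreal bm"
        unfolding defs by (rule real[OF ne(1)], rule real[OF ne(2)], rule real[OF ne(3)], rule real[OF ne(4)])
      have nn: "0 \<le> a0" "0 \<le> am" "0 \<le> b0" "0 \<le> bm" unfolding defs by simp_all
      have pos': "0 < a0" "0 < am"
      proof -
        have "a0 \<noteq> 0" using 4(1) unfolding r(1) by (rule contrapos_nn) simp
        then show "0 < a0" using nn(1) by simp
        have "am \<noteq> 0" using 4(2) unfolding r(2) by (rule contrapos_nn) simp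
        then show "0 < am" using nn(2) by simp
      qed
      define \<sigma> where "\<sigma> = root m (am / a0)"
      have m: "0 < m" using 4 k by simp
      have \<sigma>: "0 < \<sigma>" "\<sigma> ^ m = am / a0" using pos' m by (simp_all add: \<sigma>_def)
      then have am: "am = \<sigma> ^ m * a0" using pos' by simp
      have split: "\<sigma> ^ m = \<sigma> ^ k * \<sigma> ^ (m - k)" using k by (simp flip: power_add)
      \<comment> \<open>For this \<sigma> the two terms of the split coincide.\<close>
      have Ak: "A k \<le> ennreal (2 * \<sigma> ^ k * a0)"
      proof -
        have "A k \<le> ennreal (\<sigma> ^ k * a0 + am / \<sigma> ^ (m - k))"
          unfolding A_def using r nn by (intro avg_power_split[OF h pr(1) k \<sigma>(1) meas(1,2) pos(1,2)]) (auto simp: A_def)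
        also have "\<sigma> ^ k * a0 + am / \<sigma> ^ (m - k) = 2 * \<sigma> ^ k * a0" unfolding am split using \<sigma>(1) by simp
        finally show ?thesis .
      qed
      have Bk: "B (m - k) \<le> ennreal (\<sigma> ^ (m - k) * b0 + bm / \<sigma> ^ k)"
      proof -
        have "B (m - k) \<le> ennreal (\<sigma> ^ (m - k) * b0 + bm / \<sigma> ^ (m - (m - k)))"
          unfolding B_def using r nn by (intro avg_power_split[OF h pr(2) _ \<sigma>(1) meas(1,3) pos(1,3)]) (auto simp: B_def)
        then show ?thesis using k by simp
      qed
      have "A k * B (m - k) \<le> ennreal (2 * \<sigma> ^ k * a0) * ennreal (\<sigma> ^ (m - k) * b0 + bm / \<sigma> ^ k)"
        using Ak Bk by (rule mult_mono) simp_all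
      also have "\<dots> = ennreal (2 * \<sigma> ^ k * a0 * (\<sigma> ^ (m - k) * b0 + bm / \<sigma> ^ k))"
        using nn \<sigma>(1) by (intro ennreal_mult[symmetric]) auto
      also have "2 * \<sigma> ^ k * a0 * (\<sigma> ^ (m - k) * b0 + bm / \<sigma> ^ k) = 2 * (am * b0 + a0 * bm)"
        unfolding am split using \<sigma>(1) by (simp add: field_simps)
      also have "ennreal (2 * (am * b0 + a0 * bm)) = 2 * (A m * B 0 + A 0 * B m)"
        unfolding r using nn by (simp add: ennreal_mult)
      finally show ?thesis .
    qed
  qed
qed

section \<open>One step of the recursion for commutators\<close>

lemma set_nn_integral_weighted_sum:
  fixes Y :: "'i \<Rightarrow> 'a \<Rightarrow> ennreal"
  assumes "S \<in> sets M" "\<And>k. k \<in> I \<Longrightarrow> Y k \<in> borel_measurable M"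
  shows "(\<integral>\<^sup>+x\<in>S. (\<Sum>k\<in>I. d k * Y k x) \<partial>M) = (\<Sum>k\<in>I. d k * (\<integral>\<^sup>+x\<in>S. Y k x \<partial>M))"
proof -
  have m: "(\<lambda>x. Y k x * indicator S x) \<in> borel_measurable M" if "k \<in> I" for k
    using assms(2)[OF that] assms(1) by (intro borel_measurable_times_ennreal borel_measurable_indicator)
  have "(\<integral>\<^sup>+x\<in>S. (\<Sum>k\<in>I. d k * Y k x) \<partial>M) = (\<integral>\<^sup>+x. (\<Sum>k\<in>I. d k * (Y k x * indicator S x)) \<partial>M)"
    by (simp only: sum_distrib_right mult.assoc)
  also have "\<dots> = (\<Sum>k\<in>I. \<integral>\<^sup>+x. d k * (Y k x * indicator S x) \<partial>M)"
    by (intro nn_integral_sum borel_measurable_times_ennreal[OF borel_measurable_const] m)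
  also have "\<dots> = (\<Sum>k\<in>I. d k * (\<integral>\<^sup>+x\<in>S. Y k x \<partial>M))"
    using m by (intro sum.cong refl nn_integral_cmult)
  finally show ?thesis .
qed

text \<open>For H k = (a - b)^k f cut off to a set, this bounds |T ((b(x) - b)^m f)(x)| |g(x)| with
  the same cutoff. Since the H k do not depend on x, it is measurable and can be integrated term by
  term.\<close>

definition comm_majorant ::
  "((real ^ 'n \<Rightarrow> 'k::{real_normed_field, euclidean_space}) \<Rightarrow> real ^ 'n \<Rightarrow> 'k) \<Rightarrow> (real ^ 'n \<Rightarrow> 'k) \<Rightarrow> (real ^ 'n \<Rightarrow> 'k)
    \<Rightarrow> nat \<Rightarrow> 'k \<Rightarrow> (nat \<Rightarrow> real ^ 'n \<Rightarrow> 'k) \<Rightarrow> real ^ 'n \<Rightarrow> ennreal" where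
  "comm_majorant T b g m a H x =
    (\<Sum>k\<le>m. ennreal (real (m choose k)) * ennreal (norm (T (H k) x) * (norm (b x - a) ^ (m - k) * norm (g x))))"

lemma comm_majorant_measurable:
  assumes "\<And>k. k \<le> m \<Longrightarrow> T (H k) \<in> borel_measurable lebesgue" "b \<in> borel_measurable lebesgue" "g \<in> borel_measurable lebesgue"
  shows "comm_majorant T b g m a H \<in> borel_measurable lebesgue"
proof -
  have "(\<lambda>x. \<Sum>k\<le>m. ennreal (real (m choose k)) * ennreal (norm (T (H k) x) * (norm (b x - a) ^ (m - k) * norm (g x))))
    \<in> borel_measurable lebesgue"
  proof (rule borel_measurable_sum)
    fix k assume "k \<in> {..m}"
    then have [measurable]: "T (H k) \<in> borel_measurable lebesgue" using assms(1) by simp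
    have [measurable]: "b \<in> borel_measurable lebesgue" "g \<in> borel_measurable lebesgue" by fact+
    show "(\<lambda>x. ennreal (real (m choose k)) * ennreal (norm (T (H k) x) * (norm (b x - a) ^ (m - k) * norm (g x))))
      \<in> borel_measurable lebesgue" by measurable
  qed
  then show ?thesis unfolding comm_majorant_def[abs_def] .
qed

text \<open>The contribution of one cube to the two sums of the theorem, with \<open>a\<close> in
  place of the mean of \<open>b\<close>: a single step of the recursion works for every
  constant.\<close>

definition sparse_term ::
  "real \<Rightarrow> ennreal \<Rightarrow> real \<Rightarrow> nat \<Rightarrow> (real ^ 'n \<Rightarrow> 'k::{real_normed_field, euclidean_space}) \<Rightarrow> (real ^ 'n \<Rightarrow> 'k)
    \<Rightarrow> (real ^ 'n \<Rightarrow> 'k) \<Rightarrow> 'k \<Rightarrow> (real ^ 'n) set \<Rightarrow> ennreal" where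
  "sparse_term p q \<alpha> m b f g a Q =
    avg p Q (\<lambda>x. norm (b x - a) ^ m * norm (f x)) * avg (conj_exponent q) Q (\<lambda>x. norm (g x))
      * ennreal (measure lebesgue Q powr (1 + \<alpha> / real CARD('n)))
    + avg p Q (\<lambda>x. norm (f x)) * avg (conj_exponent q) Q (\<lambda>x. norm (b x - a) ^ m * norm (g x))
      * ennreal (measure lebesgue Q powr (1 + \<alpha> / real CARD('n)))"

text \<open>The k-th term is estimated with the weight |b - a|^(m-k) |g|, which yields the mixed
  product of averages for k and m - k. Interpolation makes the bound independent of k, and the
  binomial coefficients add up to 2^m.\<close>

lemma commutator_step:
  fixes T :: "(real ^ 'n \<Rightarrow> 'k::{real_normed_field, euclidean_space}) \<Rightarrow> real ^ 'n \<Rightarrow> 'k" and c :: "real ^ 'n" and m :: nat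
  assumes p: "1 \<le> p" "ennreal p < q" and \<alpha>: "0 \<le> \<alpha>"
    and T: "sublinear_operator_on (Lp_c p) T"
    and wT: "locally_weak_bounded p \<alpha> (\<lambda>f x. ennreal (norm (T f x))) \<phi>\<^sub>T"
    and wM: "locally_weak_bounded p \<alpha> (sharp_grand_maximal T q) \<phi>\<^sub>M"
    and F: "\<And>k. k \<le> m \<Longrightarrow> (\<lambda>y. (a - b y) ^ k * f y) \<in> Lp_c p" and h: "0 < h"
    and b: "b \<in> borel_measurable lebesgue" and g: "g \<in> borel_measurable lebesgue"
  defines "t \<equiv> 1 / (16 * (real m + 1) * 6 ^ CARD('n))" and "A \<equiv> 8 * (real m + 1) * 18 ^ CARD('n)"
  defines "F \<equiv> \<lambda>k y. (a - b y) ^ k * f y" and "Q3 \<equiv> cube c (3 * h)"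
  obtains W where "countable W" "disjoint_family_on (\<lambda>(d, e). cube d e) W"
    "\<And>d e. (d, e) \<in> W \<Longrightarrow> \<exists>k z. d = grid_center c h k z \<and> e = h / 2 ^ k"
    "\<And>d e. (d, e) \<in> W \<Longrightarrow> 0 < e \<and> cube d e \<subseteq> cube c h"
    "2 * emeasure lebesgue (\<Union>(d, e)\<in>W. cube d e) \<le> emeasure lebesgue (cube c h)"
    "(\<integral>\<^sup>+x\<in>cube c h - (\<Union>(d, e)\<in>W. cube d e). comm_majorant T b g m a (\<lambda>k. cutoff Q3 (F k)) x \<partial>lebesgue) +
      (\<integral>\<^sup>+(d, e). (\<integral>\<^sup>+x\<in>cube d e. comm_majorant T b g m a (\<lambda>k. cutoff (- cube d (3 * e)) (cutoff Q3 (F k))) x \<partial>lebesgue) \<partial>count_space W)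
      \<le> ennreal (4 * 2 ^ m * (5 + A) * (\<phi>\<^sub>T t + \<phi>\<^sub>M t)) * sparse_term p q \<alpha> m b f g a Q3"
proof -
  let ?r = "conj_exponent q"
  define s where "s = measure lebesgue Q3 powr (\<alpha> / real CARD('n))"
  define v where "v = measure lebesgue Q3"
  have v: "emeasure lebesgue Q3 = ennreal v" "0 < v"
    using h by (simp_all add: v_def Q3_def emeasure_cube measure_cube)
  have FL: "F k \<in> Lp_c p" if "k \<le> m" for k using F[OF that] by (simp add: F_def)
  have p0: "0 \<le> p" using p by simp
  have e3: "0 < 3 * h" using h by simp
  have q1: "1 < q" using order_le_less_trans[OF ennreal_leI[OF p(1)] p(2)] by simp
  have r1: "1 \<le> ?r" by (rule conj_exponent_ge_1[OF q1])
  define N where "N x = norm (b x - a)" for x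
  have [measurable]: "b \<in> borel_measurable lebesgue" "g \<in> borel_measurable lebesgue" by fact+
  have [measurable]: "f \<in> borel_measurable lebesgue" using F[of 0] by (simp add: Lp_c_iff)
  have Nm [measurable]: "N \<in> borel_measurable lebesgue" unfolding N_def by measurable
  define AA where "AA k = avg p Q3 (\<lambda>x. N x ^ k * norm (f x))" for k
  define BB where "BB k = avg ?r Q3 (\<lambda>x. N x ^ k * norm (g x))" for k
  define aa where "aa k = enn2real (AA k)" for k
  have normF: "(\<lambda>x. norm (F k x)) = (\<lambda>x. N x ^ k * norm (f x))" for k
    by (simp add: F_def N_def norm_mult norm_power norm_minus_commute)
  have avgF: "avg p Q3 (\<lambda>x. norm (F k x)) = ennreal (aa k)" if "k \<le> m" for k
  proof -
    have "AA k < \<infinity>" using avg_finite[OF FL[OF that] e3] by (simp add: AA_def Q3_def normF)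
    then show ?thesis by (simp add: aa_def normF AA_def)
  qed
  then have AA: "AA k = ennreal (aa k)" if "k \<le> m" for k using that by (simp add: AA_def normF)
  have aa0: "0 \<le> aa k" for k by (simp add: aa_def)
  define D where "D = 4 * \<phi>\<^sub>M t + (1 + A) * \<phi>\<^sub>T t"
  have t: "t \<in> {0<..<1}"
  proof -
    have "1 * 1 \<le> (real m + 1) * 6 ^ CARD('n)" by (intro mult_mono one_le_power) auto
    moreover have "t = 1 / (16 * ((real m + 1) * 6 ^ CARD('n)))" by (simp only: t_def mult.assoc)
    moreover have "1 / (16 * x) \<in> {0<..<1}" if "1 * 1 \<le> x" for x :: real using that by simp
    ultimately show ?thesis by (simp only:)
  qed
  have phi: "0 \<le> \<phi>\<^sub>T t" "0 \<le> \<phi>\<^sub>M t"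
    by (rule locally_weak_bounded_nonneg[OF wT t], rule locally_weak_bounded_nonneg[OF wM t])
  have A0: "0 \<le> A" by (simp add: A_def)
  have D: "0 \<le> D" "D \<le> (5 + A) * (\<phi>\<^sub>T t + \<phi>\<^sub>M t)"
  proof -
    show "0 \<le> D" using phi A0 by (simp add: D_def)
    have "0 \<le> A * \<phi>\<^sub>M t" using phi A0 by simp
    then show "D \<le> (5 + A) * (\<phi>\<^sub>T t + \<phi>\<^sub>M t)" using phi by (simp add: D_def algebra_simps)
  qed
  have s0: "0 \<le> s" by (simp add: s_def)
  obtain W where W: "countable W" "disjoint_family_on (\<lambda>(d, e). cube d e) W"
    "\<And>d e. (d, e) \<in> W \<Longrightarrow> \<exists>k z. d = grid_center c h k z \<and> e = h / 2 ^ k"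
    "\<And>d e. (d, e) \<in> W \<Longrightarrow> 0 < e \<and> cube d e \<subseteq> cube c h"
    "2 * emeasure lebesgue (\<Union>(d, e)\<in>W. cube d e) \<le> emeasure lebesgue (cube c h)"
    and est: "\<And>k G \<tau>. k \<le> m \<Longrightarrow> G \<in> borel_measurable lebesgue \<Longrightarrow> (\<And>x. 0 \<le> G x) \<Longrightarrow> 0 < \<tau> \<Longrightarrow>
      (\<integral>\<^sup>+x\<in>cube c h - (\<Union>(d, e)\<in>W. cube d e). ennreal (norm (T (cutoff Q3 (F k)) x) * G x) \<partial>lebesgue) +
      (\<integral>\<^sup>+(d, e). (\<integral>\<^sup>+x\<in>cube d e. ennreal (norm (T (cutoff (- cube d (3 * e)) (cutoff Q3 (F k))) x) * G x) \<partial>lebesgue) \<partial>count_space W)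
      \<le> ennreal (D * aa k * s * \<tau>) *
        (\<integral>\<^sup>+x\<in>cube c h. ennreal (1 + (G x / \<tau>) powr ?r) \<partial>lebesgue)"
    unfolding Q3_def D_def A_def t_def
    by (rule stopping_family[where F = F and m = m and a = aa and s = s and c = c and h = h,
        OF p \<alpha> T wT wM FL h avgF[unfolded Q3_def] aa0 s_def[unfolded Q3_def]]) blast+
  define Y1 where "Y1 k x = ennreal (norm (T (cutoff Q3 (F k)) x) * (N x ^ (m - k) * norm (g x)))" for k x
  define Y2 where "Y2 d e k x = ennreal (norm (T (cutoff (- cube d (3 * e)) (cutoff Q3 (F k))) x) * (N x ^ (m - k) * norm (g x)))" for d e k x
  define S where "S = cube c h - (\<Union>(d, e)\<in>W. cube d e)"
  define V where "V = ennreal (v powr (1 + \<alpha> / real CARD('n)))"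
  have est_k: "(\<integral>\<^sup>+x\<in>S. Y1 k x \<partial>lebesgue) + (\<integral>\<^sup>+(d, e). (\<integral>\<^sup>+x\<in>cube d e. Y2 d e k x \<partial>lebesgue) \<partial>count_space W)
    \<le> ennreal (4 * D) * (AA m * BB 0 * V + AA 0 * BB m * V)" if k: "k \<le> m" for k
  proof -
    let ?G = "\<lambda>x. N x ^ (m - k) * norm (g x)"
    have G: "?G \<in> borel_measurable lebesgue" "\<And>x. 0 \<le> ?G x" by (measurable, simp add: N_def)
    have c0: "0 \<le> D * aa k * s" using D aa0 s0 by simp
    have "(\<integral>\<^sup>+x\<in>S. Y1 k x \<partial>lebesgue) + (\<integral>\<^sup>+(d, e). (\<integral>\<^sup>+x\<in>cube d e. Y2 d e k x \<partial>lebesgue) \<partial>count_space W)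
      \<le> ennreal (2 * (D * aa k * s)) * (avg ?r Q3 ?G * emeasure lebesgue Q3)"
      unfolding Y1_def Y2_def S_def Q3_def
      by (rule optimise_tau[OF est[OF k G, unfolded Q3_def] c0 r1 h G])
    also have "\<dots> = ennreal (2 * D) * (AA k * BB (m - k) * V)"
    proof -
      \<comment> \<open>The measure of the triple comes from the integral of the weight, its power
        \<alpha> / n from the weak bounds.\<close>
      have "v powr (1 + \<alpha> / real CARD('n)) = v * s"
        using v(2) by (simp add: powr_add s_def v_def[symmetric])
      then have V: "V = ennreal v * ennreal s" using v(2) s0 by (simp add: V_def ennreal_mult)
      have "ennreal (2 * (D * aa k * s)) = ennreal (2 * D) * ennreal (aa k) * ennreal s"
        using D(1) aa0[of k] s0 by (simp add: ennreal_mult mult.assoc)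
      then show ?thesis unfolding V AA[OF k] v(1) BB_def by (simp only: mult_ac)
    qed
    also have "\<dots> \<le> ennreal (2 * D) * (2 * (AA m * BB 0 + AA 0 * BB m) * V)"
    proof (intro mult_left_mono mult_right_mono)
      show "AA k * BB (m - k) \<le> 2 * (AA m * BB 0 + AA 0 * BB m)"
        unfolding AA_def BB_def Q3_def
        by (rule avg_product_interpolation[OF e3 p(1) r1 k Nm]) (measurable, simp_all add: N_def)
    qed simp_all
    also have "\<dots> = ennreal (4 * D) * (AA m * BB 0 * V + AA 0 * BB m * V)"
    proof -
      have "ennreal (4 * D) = ennreal (2 * D) * 2" using D(1) ennreal_mult[of "2 * D" 2] by (simp add: mult_ac)
      then show ?thesis by (simp only: distrib_right mult.assoc)
    qed
    finally show ?thesis .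
  qed
  have Tm: "T u \<in> borel_measurable lebesgue" if "u \<in> Lp_c p" for u
    using T that by (simp add: sublinear_operator_on_def)
  have Y1m: "Y1 k \<in> borel_measurable lebesgue" if "k \<le> m" for k
  proof -
    have [measurable]: "T (cutoff Q3 (F k)) \<in> borel_measurable lebesgue"
      using FL[OF that] p0 by (intro Tm Lp_c_cutoff) (auto simp: Q3_def)
    show ?thesis unfolding Y1_def by measurable
  qed
  have Y2m: "Y2 d e k \<in> borel_measurable lebesgue" if "k \<le> m" for k d e
  proof -
    have [measurable]: "T (cutoff (- cube d (3 * e)) (cutoff Q3 (F k))) \<in> borel_measurable lebesgue"
      using FL[OF that] p0 by (intro Tm Lp_c_cutoff) (auto simp: Q3_def Compl_in_sets_lebesgue)
    show ?thesis unfolding Y2_def by measurable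
  qed
  let ?B = "\<lambda>k. ennreal (real (m choose k))"
  have Sm: "S \<in> sets lebesgue"
    unfolding S_def using W(1) by (intro sets.Diff sets.countable_UN') auto
  have "(\<integral>\<^sup>+x\<in>S. comm_majorant T b g m a (\<lambda>k. cutoff Q3 (F k)) x \<partial>lebesgue) = (\<Sum>k\<le>m. ?B k * (\<integral>\<^sup>+x\<in>S. Y1 k x \<partial>lebesgue))"
    unfolding comm_majorant_def N_def[symmetric] Y1_def[symmetric]
    by (rule set_nn_integral_weighted_sum[OF Sm]) (simp add: Y1m)
  moreover have "(\<integral>\<^sup>+(d, e). (\<integral>\<^sup>+x\<in>cube d e. comm_majorant T b g m a (\<lambda>k. cutoff (- cube d (3 * e)) (cutoff Q3 (F k))) x \<partial>lebesgue) \<partial>count_space W)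
    = (\<Sum>k\<le>m. ?B k * (\<integral>\<^sup>+(d, e). (\<integral>\<^sup>+x\<in>cube d e. Y2 d e k x \<partial>lebesgue) \<partial>count_space W))"
  proof -
    have "(\<integral>\<^sup>+x\<in>cube d e. comm_majorant T b g m a (\<lambda>k. cutoff (- cube d (3 * e)) (cutoff Q3 (F k))) x \<partial>lebesgue)
      = (\<Sum>k\<le>m. ?B k * (\<integral>\<^sup>+x\<in>cube d e. Y2 d e k x \<partial>lebesgue))" for d e
      unfolding comm_majorant_def N_def[symmetric] Y2_def[symmetric]
      by (rule set_nn_integral_weighted_sum) (simp_all add: Y2m)
    then have "(\<integral>\<^sup>+(d, e). (\<integral>\<^sup>+x\<in>cube d e. comm_majorant T b g m a (\<lambda>k. cutoff (- cube d (3 * e)) (cutoff Q3 (F k))) x \<partial>lebesgue) \<partial>count_space W)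
      = (\<integral>\<^sup>+i. (\<Sum>k\<le>m. ?B k * (case i of (d, e) \<Rightarrow> \<integral>\<^sup>+x\<in>cube d e. Y2 d e k x \<partial>lebesgue)) \<partial>count_space W)"
      by (simp add: case_prod_unfold)
    also have "\<dots> = (\<Sum>k\<le>m. ?B k * (\<integral>\<^sup>+(d, e). (\<integral>\<^sup>+x\<in>cube d e. Y2 d e k x \<partial>lebesgue) \<partial>count_space W))"
      by (subst nn_integral_sum) (simp_all add: nn_integral_cmult)
    finally show ?thesis .
  qed
  ultimately have "(\<integral>\<^sup>+x\<in>S. comm_majorant T b g m a (\<lambda>k. cutoff Q3 (F k)) x \<partial>lebesgue) +
      (\<integral>\<^sup>+(d, e). (\<integral>\<^sup>+x\<in>cube d e. comm_majorant T b g m a (\<lambda>k. cutoff (- cube d (3 * e)) (cutoff Q3 (F k))) x \<partial>lebesgue) \<partial>count_space W)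
    = (\<Sum>k\<le>m. ?B k * ((\<integral>\<^sup>+x\<in>S. Y1 k x \<partial>lebesgue) + (\<integral>\<^sup>+(d, e). (\<integral>\<^sup>+x\<in>cube d e. Y2 d e k x \<partial>lebesgue) \<partial>count_space W)))"
    by (simp only: sum.distrib distrib_left)
  also have "\<dots> \<le> (\<Sum>k\<le>m. ?B k * (ennreal (4 * D) * (AA m * BB 0 * V + AA 0 * BB m * V)))"
    using est_k by (intro sum_mono mult_left_mono) auto
  also have "\<dots> = (\<Sum>k\<le>m. ?B k) * (ennreal (4 * D) * (AA m * BB 0 * V + AA 0 * BB m * V))"
    by (simp only: sum_distrib_right)
  also have "(\<Sum>k\<le>m. ?B k) = ennreal (2 ^ m)"
  proof -
    have "(\<Sum>k\<le>m. ?B k) = ennreal (\<Sum>k\<le>m. real (m choose k))" by (intro sum_ennreal) simp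
    also have "(\<Sum>k\<le>m. real (m choose k)) = real (\<Sum>k\<le>m. m choose k)" by (rule of_nat_sum[symmetric])
    also have "(\<Sum>k\<le>m. m choose k) = 2 ^ m" by (rule choose_row_sum)
    finally show ?thesis by simp
  qed
  also have "ennreal (2 ^ m) * (ennreal (4 * D) * (AA m * BB 0 * V + AA 0 * BB m * V)) =
    ennreal (2 ^ m * (4 * D)) * (AA m * BB 0 * V + AA 0 * BB m * V)"
    using D(1) by (simp only: ennreal_mult mult.assoc mult_nonneg_nonneg zero_le_power zero_le_numeral)
  also have "\<dots> \<le> ennreal (4 * 2 ^ m * (5 + A) * (\<phi>\<^sub>T t + \<phi>\<^sub>M t)) * (AA m * BB 0 * V + AA 0 * BB m * V)"
  proof (intro mult_right_mono ennreal_leI)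
    have "2 ^ m * (4 * D) \<le> 2 ^ m * (4 * ((5 + A) * (\<phi>\<^sub>T t + \<phi>\<^sub>M t)))" using D(2) by (intro mult_left_mono) auto
    then show "2 ^ m * (4 * D) \<le> 4 * 2 ^ m * (5 + A) * (\<phi>\<^sub>T t + \<phi>\<^sub>M t)" by (simp only: mult_ac)
  qed simp
  also have "AA m * BB 0 * V + AA 0 * BB m * V = sparse_term p q \<alpha> m b f g a Q3"
    by (simp add: sparse_term_def AA_def BB_def V_def v_def N_def)
  finally show thesis
    unfolding S_def by (intro that[of W] W) (assumption | rule W)+
qed

section \<open>Recursion over all generations of cubes\<close>

text \<open>The grid of a grid cube is part of the same grid. All cubes of the recursion thus belong
  to the grid of the initial cube, and this is what places their triples in finitely many
  lattices.\<close>

lemma grid_center_trans: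
  "grid_center (grid_center c h k z) (h / 2 ^ k) j w = grid_center c h (k + j) (\<chi> i. 2 ^ j * z $ i + w $ i)"
proof -
  have "c $ i - h + h / 2 ^ k * (2 * of_int (z $ i) + 1) - h / 2 ^ k + h / 2 ^ k / 2 ^ j * (2 * of_int (w $ i) + 1)
    = c $ i - h + h / 2 ^ (k + j) * (2 * of_int (2 ^ j * z $ i + w $ i) + 1)" for i
    by (simp add: power_add field_simps)
  then show ?thesis by (simp add: grid_center_def vec_eq_iff)
qed

lemma cutoff_cutoff: "cutoff A (cutoff B f) = cutoff (A \<inter> B) f"
  by (auto simp: cutoff_def fun_eq_iff)

lemma comm_majorant_bound:
  assumes "norm u \<le> (\<Sum>k\<le>m. real (m choose k) * norm (b x - a) ^ (m - k) * norm (T (H k) x))"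
  shows "ennreal (norm u * norm (g x)) \<le> comm_majorant T b g m a H x"
proof -
  have "norm u * norm (g x) \<le> (\<Sum>k\<le>m. real (m choose k) * norm (b x - a) ^ (m - k) * norm (T (H k) x)) * norm (g x)"
    using assms by (rule mult_right_mono) simp
  also have "\<dots> = (\<Sum>k\<le>m. real (m choose k) * (norm (T (H k) x) * (norm (b x - a) ^ (m - k) * norm (g x))))"
    unfolding sum_distrib_right by (intro sum.cong refl) (simp only: mult_ac)
  finally have "ennreal (norm u * norm (g x)) \<le> ennreal (\<Sum>k\<le>m. real (m choose k) * (norm (T (H k) x) * (norm (b x - a) ^ (m - k) * norm (g x))))"
    by (rule ennreal_leI)
  also have "\<dots> = (\<Sum>k\<le>m. ennreal (real (m choose k) * (norm (T (H k) x) * (norm (b x - a) ^ (m - k) * norm (g x)))))"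
    by (intro sum_ennreal[symmetric]) simp
  also have "\<dots> = comm_majorant T b g m a H x"
    unfolding comm_majorant_def by (intro sum.cong refl ennreal_mult) simp_all
  finally show ?thesis .
qed

lemma sparse_domination_cubes:
  fixes T :: "(real ^ 'n \<Rightarrow> 'k::{real_normed_field, euclidean_space}) \<Rightarrow> real ^ 'n \<Rightarrow> 'k" and m :: nat
  assumes p: "1 \<le> p" "ennreal p < q" and \<alpha>: "0 \<le> \<alpha>"
    and T: "sublinear_operator_on (Lp_c p) T"
    and wT: "locally_weak_bounded p \<alpha> (\<lambda>f x. ennreal (norm (T f x))) \<phi>\<^sub>T"
    and wM: "locally_weak_bounded p \<alpha> (sharp_grand_maximal T q) \<phi>\<^sub>M"
    and f: "f \<in> Lp_c p" "(\<lambda>y. b y ^ m * f y) \<in> Lp_c p"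
    and b: "b \<in> borel_measurable lebesgue" and g: "g \<in> borel_measurable lebesgue"
    and h0: "0 < h\<^sub>0" and supp: "\<And>x. x \<notin> cube c\<^sub>0 h\<^sub>0 \<Longrightarrow> f x = 0 \<and> g x = 0"
  defines "t \<equiv> 1 / (16 * (real m + 1) * 6 ^ CARD('n))" and "A \<equiv> 8 * (real m + 1) * 18 ^ CARD('n)"
  obtains F E where "countable F" "\<And>c h. (c, h) \<in> F \<Longrightarrow> \<exists>k z. c = grid_center c\<^sub>0 h\<^sub>0 k z \<and> h = h\<^sub>0 / 2 ^ k"
    "disjoint_family_on E F"
    "\<And>c h. (c, h) \<in> F \<Longrightarrow> E (c, h) \<in> sets lebesgue \<and> E (c, h) \<subseteq> cube c h \<and>
      measure lebesgue (cube c h) \<le> 2 * measure lebesgue (E (c, h))"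
    "(\<integral>\<^sup>+x. ennreal (norm (commutator T b m f x) * norm (g x)) \<partial>lebesgue) \<le>
      (\<integral>\<^sup>+(c, h). ennreal (4 * 2 ^ m * (5 + A) * (\<phi>\<^sub>T t + \<phi>\<^sub>M t)) *
        sparse_term p q \<alpha> m b f g (mean (cube c (3 * h)) b) (cube c (3 * h)) \<partial>count_space F)"
proof -
  define C where "C = ennreal (4 * 2 ^ m * (5 + A) * (\<phi>\<^sub>T t + \<phi>\<^sub>M t))"
  define K where "K Q = cube (fst Q) (snd Q)" for Q :: "(real ^ 'n) \<times> real"
  define K3 where "K3 Q = cube (fst Q) (3 * snd Q)" for Q :: "(real ^ 'n) \<times> real"
  define ok where "ok Q \<longleftrightarrow> (\<exists>k z. Q = (grid_center c\<^sub>0 h\<^sub>0 k z, h\<^sub>0 / 2 ^ k))" for Q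
  define a where "a Q = mean (K3 Q) b" for Q
  define H where "H a k y = (a - b y) ^ k * f y" for a k y
  define off where "off Q = comm_majorant T b g m (a Q) (\<lambda>k. cutoff (K3 Q) (H (a Q) k))" for Q
  define jump where "jump Q P = comm_majorant T b g m (a Q) (\<lambda>k. cutoff (- K3 P) (cutoff (K3 Q) (H (a Q) k)))" for Q P
  define w where "w Q = C * sparse_term p q \<alpha> m b f g (a Q) (K3 Q)" for Q
  \<comment> \<open>Not expanded: the constant \<open>a Q\<close> enters \<open>off\<close> and
    \<open>jump\<close> only and may change from cube to cube.\<close>
  define u where "u Q x = ennreal (norm (T (cutoff (K3 Q) (\<lambda>y. (b x - b y) ^ m * f y)) x) * norm (g x))" for Q x
  have p0: "0 \<le> p" using p by simp
  have HL: "H a k \<in> Lp_c p" if "k \<le> m" for a k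
    unfolding H_def[abs_def] by (rule Lp_c_power[OF f b p0 that])
  have K3L: "K3 Q \<in> sets lebesgue" for Q by (simp add: K3_def)
  have Tm: "T v \<in> borel_measurable lebesgue" if "v \<in> Lp_c p" for v
    using T that by (simp add: sublinear_operator_on_def)
  have pos: "0 < snd Q" if "ok Q" for Q using that h0 by (auto simp: ok_def)
  have ok_trans: "ok (d, e)" if "ok Q" and ex: "\<exists>k z. d = grid_center (fst Q) (snd Q) k z \<and> e = snd Q / 2 ^ k" for Q d e
  proof -
    obtain k z where Q: "Q = (grid_center c\<^sub>0 h\<^sub>0 k z, h\<^sub>0 / 2 ^ k)" using \<open>ok Q\<close> by (auto simp: ok_def)
    obtain j w where de: "d = grid_center (fst Q) (snd Q) j w" "e = snd Q / 2 ^ j" using ex by blast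
    have "(d, e) = (grid_center c\<^sub>0 h\<^sub>0 (k + j) (\<chi> i. 2 ^ j * z $ i + w $ i), h\<^sub>0 / 2 ^ (k + j))"
      unfolding de Q by (simp add: grid_center_trans power_add)
    then show ?thesis unfolding ok_def by blast
  qed
  define good where "good Q W \<longleftrightarrow> countable W \<and> disjoint_family_on K W \<and> (\<forall>P\<in>W. ok P \<and> K P \<subseteq> K Q) \<and>
    2 * emeasure lebesgue (\<Union>P\<in>W. K P) \<le> emeasure lebesgue (K Q) \<and>
    (\<integral>\<^sup>+x\<in>K Q - (\<Union>P\<in>W. K P). off Q x \<partial>lebesgue) +
      (\<integral>\<^sup>+P. (\<integral>\<^sup>+x\<in>K P. jump Q P x \<partial>lebesgue) \<partial>count_space W) \<le> w Q" for Q W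
  have ex_good: "\<exists>W. good Q W" if Q: "ok Q" for Q
  proof -
    obtain W where W: "countable W" "disjoint_family_on (\<lambda>(d, e). cube d e) W"
      "\<And>d e. (d, e) \<in> W \<Longrightarrow> \<exists>k z. d = grid_center (fst Q) (snd Q) k z \<and> e = snd Q / 2 ^ k"
      "\<And>d e. (d, e) \<in> W \<Longrightarrow> 0 < e \<and> cube d e \<subseteq> cube (fst Q) (snd Q)"
      "2 * emeasure lebesgue (\<Union>(d, e)\<in>W. cube d e) \<le> emeasure lebesgue (cube (fst Q) (snd Q))"
      "(\<integral>\<^sup>+x\<in>cube (fst Q) (snd Q) - (\<Union>(d, e)\<in>W. cube d e).
          comm_majorant T b g m (a Q) (\<lambda>k. cutoff (cube (fst Q) (3 * snd Q)) (\<lambda>y. (a Q - b y) ^ k * f y)) x \<partial>lebesgue) +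
        (\<integral>\<^sup>+(d, e). (\<integral>\<^sup>+x\<in>cube d e. comm_majorant T b g m (a Q) (\<lambda>k. cutoff (- cube d (3 * e))
          (cutoff (cube (fst Q) (3 * snd Q)) (\<lambda>y. (a Q - b y) ^ k * f y))) x \<partial>lebesgue) \<partial>count_space W)
        \<le> ennreal (4 * 2 ^ m * (5 + A) * (\<phi>\<^sub>T t + \<phi>\<^sub>M t)) * sparse_term p q \<alpha> m b f g (a Q) (cube (fst Q) (3 * snd Q))"
      unfolding A_def t_def
      by (rule commutator_step[where a = "a Q" and c = "fst Q" and h = "snd Q" and m = m and f = f,
          OF p \<alpha> T wT wM HL[unfolded H_def[abs_def]] pos[OF Q] b g]) blast+
    have K: "K = (\<lambda>(d, e). cube d e)" by (simp add: K_def[abs_def] case_prod_unfold)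
    have "ok P \<and> K P \<subseteq> K Q" if "P \<in> W" for P
      using ok_trans[OF Q W(3), of "fst P" "snd P"] W(4)[of "fst P" "snd P"] that by (simp add: K_def)
    then have "\<forall>P\<in>W. ok P \<and> K P \<subseteq> K Q" by blast
    moreover have "(\<integral>\<^sup>+x\<in>K Q - (\<Union>P\<in>W. K P). off Q x \<partial>lebesgue) +
      (\<integral>\<^sup>+P. (\<integral>\<^sup>+x\<in>K P. jump Q P x \<partial>lebesgue) \<partial>count_space W) \<le> w Q"
      using W(6) unfolding K_def off_def jump_def w_def C_def K3_def H_def[abs_def] case_prod_unfold .
    moreover have "countable W" "disjoint_family_on K W" "2 * emeasure lebesgue (\<Union>P\<in>W. K P) \<le> emeasure lebesgue (K Q)"
      using W(1,2,5) by (simp_all only: K case_prod_unfold)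
    ultimately have "good Q W" unfolding good_def by (intro conjI)
    then show ?thesis by (rule exI)
  qed
  define ch where "ch Q = (SOME W. good Q W)" for Q
  have ch_good: "good Q (ch Q)" if "ok Q" for Q
    unfolding ch_def using ex_good[OF that] by (rule someI_ex)
  note ch_all = ch_good[unfolded good_def]
  have ch1: "countable (ch Q)" if "ok Q" for Q using ch_all[OF that] by (elim conjE)
  have ch2: "disjoint_family_on K (ch Q)" if "ok Q" for Q using ch_all[OF that] by (elim conjE)
  have ch_sub: "\<forall>P\<in>ch Q. ok P \<and> K P \<subseteq> K Q" if "ok Q" for Q using ch_all[OF that] by (elim conjE)
  have ch3: "ok P" if "ok Q" "P \<in> ch Q" for Q P using ch_sub[OF that(1)] that(2) by blast
  have ch4: "K P \<subseteq> K Q" if "ok Q" "P \<in> ch Q" for Q P using ch_sub[OF that(1)] that(2) by blast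
  have ch5: "2 * emeasure lebesgue (\<Union>P\<in>ch Q. K P) \<le> emeasure lebesgue (K Q)" if "ok Q" for Q
    using ch_all[OF that] by (elim conjE)
  have ch6: "(\<integral>\<^sup>+x\<in>K Q - (\<Union>P\<in>ch Q. K P). off Q x \<partial>lebesgue) +
      (\<integral>\<^sup>+P. (\<integral>\<^sup>+x\<in>K P. jump Q P x \<partial>lebesgue) \<partial>count_space (ch Q)) \<le> w Q" if "ok Q" for Q
    using ch_all[OF that] by (elim conjE)
  have off_m: "off Q \<in> borel_measurable lebesgue" for Q
    unfolding off_def using b g by (intro comm_majorant_measurable Tm Lp_c_cutoff HL K3L p0) auto
  have jump_m: "jump Q P \<in> borel_measurable lebesgue" for Q P
    unfolding jump_def using b g
    by (intro comm_majorant_measurable Tm Lp_c_cutoff HL K3L p0 Compl_in_sets_lebesgue[THEN iffD2]) auto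
  have u_off: "u Q x \<le> off Q x" for Q x
    unfolding u_def off_def
    by (rule comm_majorant_bound, unfold H_def[abs_def])
       (rule commutator_expand[OF T p0 K3L HL[unfolded H_def[abs_def]]])
  have u_jump: "u Q x \<le> jump Q P x + u P x" if Q: "ok Q" "P \<in> ch Q" for Q P x
  proof -
    define \<Psi> where "\<Psi> y = (b x - b y) ^ m * f y" for y
    have \<Psi>: "\<Psi> \<in> Lp_c p" using HL[of m "b x"] by (simp add: \<Psi>_def[abs_def] H_def[abs_def])
    have sub: "K3 P \<subseteq> K3 Q"
      unfolding K3_def using ch4[OF Q] pos[OF Q(1)] pos[OF ch3[OF Q]]
      by (intro cube_subset_imp_triple_subset(2)) (simp_all add: K_def)
    have "norm (T (cutoff (K3 Q) \<Psi>) x) \<le> norm (T (cutoff (- K3 P) (cutoff (K3 Q) \<Psi>)) x) + norm (T (cutoff (K3 P) \<Psi>) x)"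
      by (rule sublinear_difference(2)[OF T p0 \<Psi> K3L K3L sub])
    then have "norm (T (cutoff (K3 Q) \<Psi>) x) * norm (g x) \<le>
      norm (T (cutoff (- K3 P) (cutoff (K3 Q) \<Psi>)) x) * norm (g x) + norm (T (cutoff (K3 P) \<Psi>) x) * norm (g x)"
      by (metis distrib_right mult_right_mono norm_ge_zero)
    then have "u Q x \<le> ennreal (norm (T (cutoff (- K3 P) (cutoff (K3 Q) \<Psi>)) x) * norm (g x)) + u P x"
      unfolding u_def \<Psi>_def[abs_def, symmetric] by (subst ennreal_plus[symmetric], simp, simp, rule ennreal_leI)
    also have "ennreal (norm (T (cutoff (- K3 P) (cutoff (K3 Q) \<Psi>)) x) * norm (g x)) \<le> jump Q P x"
      unfolding jump_def cutoff_cutoff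
    proof (rule comm_majorant_bound)
      have "- K3 P \<inter> K3 Q \<in> sets lebesgue" using K3L by (intro sets.Int) (simp_all add: Compl_in_sets_lebesgue)
      then show "norm (T (cutoff (- K3 P \<inter> K3 Q) \<Psi>) x) \<le> (\<Sum>k\<le>m. real (m choose k) * norm (b x - a Q) ^ (m - k) *
        norm (T (cutoff (- K3 P \<inter> K3 Q) (H (a Q) k)) x))"
        unfolding \<Psi>_def[abs_def] H_def[abs_def]
        by (rule commutator_expand[OF T p0]) (rule HL[unfolded H_def[abs_def]])
    qed
    finally show ?thesis by (simp add: add_right_mono)
  qed
  have base: "ok (c\<^sub>0, h\<^sub>0)"
    unfolding ok_def by (intro exI[of _ 0]) (simp add: grid_center_def vec_eq_iff)
  obtain F where F: "countable F" "\<And>Q. Q \<in> F \<Longrightarrow> ok Q"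
    "disjoint_family_on (\<lambda>Q. K Q - (\<Union>P\<in>ch Q. K P)) F"
    "(\<integral>\<^sup>+x\<in>K (c\<^sub>0, h\<^sub>0). u (c\<^sub>0, h\<^sub>0) x \<partial>lebesgue) \<le> (\<integral>\<^sup>+Q. w Q \<partial>count_space F)"
    unfolding K_def
    by (rule sparse_iteration[where ok = ok and ch = ch and u = u and off = off and jump = jump and w = w,
        OF base pos ch1 ch3 ch2[unfolded K_def[abs_def]] ch4[unfolded K_def] ch5[unfolded K_def]
          off_m jump_m u_off u_jump ch6[unfolded K_def]]) blast+
  define E where "E Q = K Q - (\<Union>P\<in>ch Q. K P)" for Q
  show thesis
  proof (rule that[of F E])
    show "countable F" by fact
    show "\<exists>k z. c = grid_center c\<^sub>0 h\<^sub>0 k z \<and> h = h\<^sub>0 / 2 ^ k" if "(c, h) \<in> F" for c h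
      using F(2)[OF that] by (simp add: ok_def)
    show "disjoint_family_on E F" using F(3) by (simp add: E_def[abs_def])
    show "E (c, h) \<in> sets lebesgue \<and> E (c, h) \<subseteq> cube c h \<and>
      measure lebesgue (cube c h) \<le> 2 * measure lebesgue (E (c, h))" if "(c, h) \<in> F" for c h
    proof -
      have okQ: "ok (c, h)" by (rule F(2)[OF that])
      have h: "0 < h" using pos[OF okQ] by simp
      define U where "U = (\<Union>P\<in>ch (c, h). K P)"
      have U: "U \<in> sets lebesgue" unfolding U_def using ch1[OF okQ] by (intro sets.countable_UN') (auto simp: K_def)
      have sub: "U \<subseteq> cube c h" using ch4[OF okQ] by (auto simp: U_def K_def)
      have fm: "U \<in> lmeasurable" using fmeasurableI2[OF cube_lmeasurable[OF h] sub U] .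
      have "2 * emeasure lebesgue U \<le> emeasure lebesgue (cube c h)"
        using ch5[OF okQ] by (simp add: U_def K_def)
      then have "ennreal (2 * measure lebesgue U) \<le> ennreal (measure lebesgue (cube c h))"
        using fm cube_lmeasurable[OF h, of c] by (simp add: emeasure_eq_measure2 ennreal_mult)
      then have "2 * measure lebesgue U \<le> measure lebesgue (cube c h)" by (subst (asm) ennreal_le_iff) auto
      moreover have "measure lebesgue (cube c h - U) = measure lebesgue (cube c h) - measure lebesgue U"
        by (rule measurable_measure_Diff[OF cube_lmeasurable[OF h] U sub])
      moreover have "E (c, h) = cube c h - U" by (simp add: E_def U_def K_def)
      ultimately show ?thesis using U by auto
    qed
    \<comment> \<open>Cutting off to the triple of the initial cube changes nothing, because f is
      supported in that cube; outside it g vanishes.\<close>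
    have eq: "ennreal (norm (commutator T b m f x) * norm (g x)) = u (c\<^sub>0, h\<^sub>0) x * indicator (K (c\<^sub>0, h\<^sub>0)) x" for x
    proof (cases "x \<in> cube c\<^sub>0 h\<^sub>0")
      case True
      have "cutoff (K3 (c\<^sub>0, h\<^sub>0)) (\<lambda>y. (b x - b y) ^ m * f y) = (\<lambda>y. (b x - b y) ^ m * f y)"
      proof
        fix y
        show "cutoff (K3 (c\<^sub>0, h\<^sub>0)) (\<lambda>y. (b x - b y) ^ m * f y) y = (b x - b y) ^ m * f y"
          using supp[of y] cube_subset_triple[OF h0, of c\<^sub>0] by (auto simp: cutoff_def K3_def)
      qed
      then show ?thesis using True by (simp add: u_def K_def commutator_def)
    next
      case False
      then show ?thesis using supp[OF False] by (simp add: K_def)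
    qed
    have "(\<integral>\<^sup>+x. ennreal (norm (commutator T b m f x) * norm (g x)) \<partial>lebesgue) \<le> (\<integral>\<^sup>+Q. w Q \<partial>count_space F)"
      unfolding eq by (rule F(4))
    then show "(\<integral>\<^sup>+x. ennreal (norm (commutator T b m f x) * norm (g x)) \<partial>lebesgue) \<le>
      (\<integral>\<^sup>+(c, h). ennreal (4 * 2 ^ m * (5 + A) * (\<phi>\<^sub>T t + \<phi>\<^sub>M t)) *
        sparse_term p q \<alpha> m b f g (mean (cube c (3 * h)) b) (cube c (3 * h)) \<partial>count_space F)"
      unfolding w_def C_def a_def K3_def case_prod_unfold .
  qed
qed

subsection \<open>From cubes to a sparse family in one lattice\<close>

lemma locally_integrable_imp_measurable:
  fixes b :: "real ^ 'n \<Rightarrow> 'k::{real_normed_field, euclidean_space}"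
  assumes "locally_integrable b"
  shows "b \<in> borel_measurable lebesgue"
proof (rule borel_measurable_LIMSEQ_metric)
  show "(\<lambda>x. indicator (cball 0 (real n)) x *\<^sub>R b x) \<in> borel_measurable lebesgue" for n
    using assms compact_cball[of 0 "real n"] unfolding locally_integrable_def set_integrable_def
    by (blast intro: borel_measurable_integrable)
  fix x :: "real ^ 'n"
  obtain N where "norm x \<le> real N" using real_arch_simple by blast
  then have "eventually (\<lambda>n. indicator (cball 0 (real n)) x *\<^sub>R b x = b x) sequentially"
    by (intro eventually_sequentiallyI[of N]) (auto simp: indicator_def)
  then show "(\<lambda>n. indicator (cball 0 (real n)) x *\<^sub>R b x) \<longlonglongrightarrow> b x" by (rule tendsto_eventually)
qed

lemma ennreal_times_le_const_times: "ennreal c * x \<le> const_times c x"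
  by (simp add: const_times_def)

lemma cube_mem_shifted_lattice:
  assumes "0 < h"
  shows "\<exists>a L. 0 < L \<and> cube c h \<in> shifted_lattice a L"
proof -
  have h: "0 < h / 3" using assms by simp
  have "grid_center c (h / 3) 0 0 = c" by (simp add: grid_center_def vec_eq_iff)
  then show ?thesis
    using triple_mem_shifted_lattice[OF h, of c 0 0] h by (auto intro!: exI[of _ "6 * (h / 3)"])
qed

text \<open>The sums over the classes of \<kappa> add up to the whole sum, so the largest class
  carries at least the fraction 1 / \<open>card J\<close> of it.\<close>

lemma nn_integral_count_space_pigeonhole:
  fixes f :: "'i \<Rightarrow> ennreal"
  assumes "finite J" "\<And>i. i \<in> I \<Longrightarrow> \<kappa> i \<in> J" "J \<noteq> {}"
  shows "\<exists>j\<in>J. (\<integral>\<^sup>+i. f i \<partial>count_space I) \<le> of_nat (card J) * (\<integral>\<^sup>+i. f i \<partial>count_space {i \<in> I. \<kappa> i = j})"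
proof -
  define X where "X j = (\<integral>\<^sup>+i. f i \<partial>count_space {i \<in> I. \<kappa> i = j})" for j
  obtain j where j: "j \<in> J" "\<And>i. i \<in> J \<Longrightarrow> X i \<le> X j"
  proof -
    have "Max (X ` J) \<in> X ` J" using assms by (intro Max_in) auto
    then obtain j where "j \<in> J" "X j = Max (X ` J)" by auto
    then show ?thesis using assms(1) by (intro that[of j]) auto
  qed
  have "(\<integral>\<^sup>+i. f i \<partial>count_space I) = (\<integral>\<^sup>+i. f i * indicator I i \<partial>count_space UNIV)"
    by (simp add: nn_integral_count_space_indicator)
  also have "\<dots> = (\<integral>\<^sup>+i. (\<Sum>j\<in>J. f i * indicator {i \<in> I. \<kappa> i = j} i) \<partial>count_space UNIV)"
  proof (rule nn_integral_cong)
    fix i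
    show "f i * indicator I i = (\<Sum>j\<in>J. f i * indicator {i \<in> I. \<kappa> i = j} i)"
    proof (cases "i \<in> I")
      case True
      have "(\<Sum>j\<in>J. f i * indicator {i \<in> I. \<kappa> i = j} i) = (\<Sum>j\<in>J. if \<kappa> i = j then f i else 0)"
        using True by (intro sum.cong) (auto simp: indicator_def)
      then show ?thesis using True assms by (simp add: sum.delta)
    qed simp
  qed
  also have "\<dots> = (\<Sum>j\<in>J. X j)"
    by (subst nn_integral_sum) (simp_all add: X_def nn_integral_count_space_indicator)
  also have "\<dots> \<le> (\<Sum>i\<in>J. X j)" using j(2) by (rule sum_mono)
  also have "\<dots> = of_nat (card J) * X j" by simp
  finally show ?thesis using j(1) unfolding X_def by blast
qed

text \<open>If (b - a)^m f were in L^p, then \<open>Lp_c_power\<close>, applied to b - a with the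
  constant -a, would put b^m f there.\<close>

lemma infinite_average:
  fixes f b :: "real ^ 'n \<Rightarrow> 'k::{real_normed_field, euclidean_space}"
  assumes p: "1 \<le> p" and f: "f \<in> Lp_c p" "(\<lambda>y. b y ^ m * f y) \<notin> Lp_c p" and b: "b \<in> borel_measurable lebesgue"
    and h: "0 < h" and supp: "\<And>x. x \<notin> cube c h \<Longrightarrow> f x = 0"
  shows "avg p (cube c h) (\<lambda>x. norm (b x - a) ^ m * norm (f x)) = \<infinity>"
proof (rule ccontr)
  assume fin: "avg p (cube c h) (\<lambda>x. norm (b x - a) ^ m * norm (f x)) \<noteq> \<infinity>"
  have p0: "0 < p" "0 \<le> p" using p by auto
  have [measurable]: "f \<in> borel_measurable lebesgue" "b \<in> borel_measurable lebesgue" using f b by (simp_all add: Lp_c_iff)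
  obtain K where K: "avg p (cube c h) (\<lambda>x. norm (b x - a) ^ m * norm (f x)) = ennreal K" "0 \<le> K"
    using fin by (cases "avg p (cube c h) (\<lambda>x. norm (b x - a) ^ m * norm (f x))" rule: ennreal_cases) auto
  have "(\<integral>\<^sup>+x. ennreal (norm ((b x - a) ^ m * f x) powr p) \<partial>lebesgue) =
    (\<integral>\<^sup>+x\<in>cube c h. ennreal ((norm (b x - a) ^ m * norm (f x)) powr p) \<partial>lebesgue)"
    using supp by (intro nn_integral_cong) (auto simp: norm_mult norm_power indicator_def)
  also have "\<dots> \<le> ennreal (K powr p) * emeasure lebesgue (cube c h)"
    using avg_le_iff[OF p0(1) K(2) h, of c "\<lambda>x. norm (b x - a) ^ m * norm (f x)"] K(1) by simp
  also have "\<dots> < \<infinity>" using h by (simp add: emeasure_cube ennreal_mult_less_top)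
  finally have int: "(\<integral>\<^sup>+x. ennreal (norm ((b x - a) ^ m * f x) powr p) \<partial>lebesgue) < \<infinity>" .
  have "bounded {x. (b x - a) ^ m * f x \<noteq> 0}"
    using f(1) by (auto simp: Lp_c_iff intro: bounded_subset[of "{x. f x \<noteq> 0}"])
  then have "(\<lambda>y. (b y - a) ^ m * f y) \<in> Lp_c p"
    using int by (simp add: Lp_c_iff)
  then have "(\<lambda>y. (- a - (b y - a)) ^ m * f y) \<in> Lp_c p"
    using f(1) p0(2) by (intro Lp_c_power[where m = m]) simp_all
  \<comment> \<open>The base -a - (b - a) equals -b, hence the correction of the sign.\<close>
  then have "(\<lambda>y. (- 1) ^ m * ((- a - (b y - a)) ^ m * f y)) \<in> Lp_c p"
    using p0(2) by (rule Lp_c_cmult)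
  moreover have "(\<lambda>y. (- 1) ^ m * ((- a - (b y - a)) ^ m * f y)) = (\<lambda>y. b y ^ m * f y)"
  proof
    fix y
    have "(- 1) ^ m * (- a - (b y - a)) ^ m = b y ^ m" by (simp flip: power_mult_distrib)
    then show "(- 1) ^ m * ((- a - (b y - a)) ^ m * f y) = b y ^ m * f y" by (simp only: mult.assoc[symmetric])
  qed
  ultimately show False using f(2) by (simp only:)
qed

text \<open>E of Q lies in Q, hence in 3Q, and has at least half the measure of Q, that is 1 / (2
  3^n) of that of 3Q. Injectivity carries E over from pairs of centre and half side to cubes as
  sets.\<close>

lemma sparse_family_triples:
  fixes F :: "((real ^ 'n) \<times> real) set"
  assumes pos: "\<And>c h. (c, h) \<in> F \<Longrightarrow> 0 < h" and disj: "disjoint_family_on E F"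
    and E: "\<And>c h. (c, h) \<in> F \<Longrightarrow> E (c, h) \<in> sets lebesgue \<and> E (c, h) \<subseteq> cube c h \<and>
      measure lebesgue (cube c h) \<le> 2 * measure lebesgue (E (c, h))"
  defines "T \<equiv> \<lambda>(c, h). cube c (3 * h)"
  shows "inj_on T F" "sparse_family (1 / (2 * 3 ^ CARD('n))) (T ` F)"
proof -
  show inj: "inj_on T F"
  proof (rule inj_onI)
    fix x y assume xy: "x \<in> F" "y \<in> F" "T x = T y"
    obtain c h d e where ch: "x = (c, h)" "y = (d, e)" by (cases x, cases y) auto
    have "0 < 3 * h" "0 < 3 * e" "cube c (3 * h) = cube d (3 * e)" using xy pos by (auto simp: ch T_def)
    from cube_inject[OF this] show "x = y" by (simp add: ch)
  qed
  define E' where "E' Q = E (the_inv_into F T Q)" for Q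
  have E': "E' (T x) = E x" if "x \<in> F" for x
    using the_inv_into_f_f[OF inj that] by (simp add: E'_def)
  have "0 < 1 / (2 * 3 ^ CARD('n) :: real)" by simp
  moreover have "1 / (2 * 3 ^ CARD('n)) < (1 :: real)"
  proof -
    have "1 / (2 * x) < 1" if "1 \<le> x" for x :: real using that by simp
    note less = this
    show ?thesis by (rule less) simp
  qed
  moreover have "is_cube Q" if "Q \<in> T ` F" for Q
  proof -
    obtain c h where ch: "(c, h) \<in> F" "Q = cube c (3 * h)" using \<open>Q \<in> T ` F\<close> by (auto simp: T_def)
    then show ?thesis using pos unfolding is_cube_def by (intro exI[of _ c] exI[of _ "3 * h"]) auto
  qed
  moreover have "disjoint_family_on E' (T ` F)"
    unfolding disjoint_family_on_def
  proof (intro ballI impI)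
    fix Q R assume "Q \<in> T ` F" "R \<in> T ` F" "Q \<noteq> R"
    then obtain x y where "x \<in> F" "Q = T x" "y \<in> F" "R = T y" "x \<noteq> y" by blast
    then show "E' Q \<inter> E' R = {}" using disjoint_family_onD[OF disj] by (simp only: E')
  qed
  moreover have "E' Q \<subseteq> Q \<and> E' Q \<in> sets lebesgue \<and> measure lebesgue (E' Q) \<ge> 1 / (2 * 3 ^ CARD('n)) * measure lebesgue Q"
    if "Q \<in> T ` F" for Q
  proof -
    obtain c h where ch: "(c, h) \<in> F" "Q = T (c, h)" using \<open>Q \<in> T ` F\<close> by auto
    have Q: "Q = cube c (3 * h)" and h: "0 < h" using ch pos by (auto simp: T_def)
    have EQ: "E' Q = E (c, h)" using E'[OF ch(1)] ch(2) by simp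
    have m: "1 / (2 * 3 ^ CARD('n)) * measure lebesgue Q = measure lebesgue (cube c h) / 2"
      unfolding Q measure_triple_cube[OF h] by simp
    have "E (c, h) \<subseteq> Q" using E[OF ch(1)] cube_subset_triple[OF h, of c] unfolding Q by blast
    then show ?thesis using E[OF ch(1)] unfolding EQ m by simp
  qed
  ultimately show "sparse_family (1 / (2 * 3 ^ CARD('n))) (T ` F)"
    unfolding sparse_family_def by blast
qed

lemma card_three_vectors:
  "finite {j :: int ^ 'n. \<forall>i. j $ i \<in> {0, 1, 2}}" "card {j :: int ^ 'n. \<forall>i. j $ i \<in> {0, 1, 2}} = 3 ^ CARD('n)"
proof -
  let ?J = "{j :: int ^ 'n. \<forall>i. j $ i \<in> {0, 1, 2}}" and ?P = "(UNIV :: 'n set) \<rightarrow>\<^sub>E {0, 1, 2 :: int}"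
  have bij: "bij_betw vec_nth ?J ?P"
    by (intro bij_betwI[of _ _ _ vec_lambda]) (auto simp: PiE_def Pi_def extensional_def vec_lambda_inverse)
  have "finite ?P" by (intro finite_PiE) auto
  then show "finite ?J" using bij_betw_finite[OF bij] by blast
  have "card ?J = card ?P" by (rule bij_betw_same_card[OF bij])
  also have "\<dots> = (\<Prod>i\<in>(UNIV :: 'n set). card {0, 1, 2 :: int})" by (rule card_PiE) simp
  also have "card {0, 1, 2 :: int} = 3" by simp
  also have "(\<Prod>i\<in>(UNIV :: 'n set). 3 :: nat) = 3 ^ CARD('n)" by (rule prod_constant)
  finally show "card ?J = 3 ^ CARD('n)" .
qed

text \<open>The recursion sums over pairs of centre and half side, the theorem over sets of points;
  injectivity translates one sum into the other.\<close>

lemma infsum_sparse_term: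
  assumes "countable F" "inj_on T F"
  shows "(\<integral>\<^sup>+i. f\<^sub>1 (T i) + f\<^sub>2 (T i) \<partial>count_space F) \<le> infsum f\<^sub>1 (T ` F) + (infsum f\<^sub>2 (T ` F) :: ennreal)"
proof -
  have "(\<integral>\<^sup>+i. f\<^sub>1 (T i) + f\<^sub>2 (T i) \<partial>count_space F) = (\<integral>\<^sup>+i. f\<^sub>1 (T i) \<partial>count_space F) + (\<integral>\<^sup>+i. f\<^sub>2 (T i) \<partial>count_space F)"
    by (rule nn_integral_add) simp_all
  also have "\<dots> \<le> infsum (\<lambda>i. f\<^sub>1 (T i)) F + infsum (\<lambda>i. f\<^sub>2 (T i)) F"
    using assms(1) by (intro add_mono nn_integral_count_space_le_infsum)
  also have "\<dots> = infsum f\<^sub>1 (T ` F) + infsum f\<^sub>2 (T ` F)"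
    using assms(2) by (simp add: infsum_reindex comp_def)
  finally show ?thesis .
qed

theorem theorem1p7:
  fixes m :: nat
  shows "\<exists>C \<Lambda> :: real. 1 < C \<and> 0 < \<Lambda> \<and> \<Lambda> < 1 \<and>
    (\<forall>(p\<^sub>0 :: real) (q\<^sub>0 :: ennreal) (\<alpha> :: real)
       (T :: (real ^ 'n \<Rightarrow> 'k::{real_normed_field, euclidean_space}) \<Rightarrow> real ^ 'n \<Rightarrow> 'k)
       (\<phi>\<^sub>T :: real \<Rightarrow> real) (\<phi>\<^sub>M :: real \<Rightarrow> real).
      1 \<le> p\<^sub>0 \<longrightarrow> ennreal p\<^sub>0 < q\<^sub>0 \<longrightarrow> 0 \<le> \<alpha> \<longrightarrow> \<alpha> < real CARD('n) / p\<^sub>0 \<longrightarrow>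
      sublinear_operator_on (Lp_c p\<^sub>0) T \<longrightarrow>
      locally_weak_bounded p\<^sub>0 \<alpha> (\<lambda>f x. ennreal (norm (T f x))) \<phi>\<^sub>T \<longrightarrow>
      locally_weak_bounded p\<^sub>0 \<alpha> (sharp_grand_maximal T q\<^sub>0) \<phi>\<^sub>M \<longrightarrow>
      (\<forall>(f :: real ^ 'n \<Rightarrow> 'k) (g :: real ^ 'n \<Rightarrow> 'k) (b :: real ^ 'n \<Rightarrow> 'k).
        f \<in> Linf_c \<longrightarrow> g \<in> Linf_c \<longrightarrow> locally_integrable b \<longrightarrow>
        (\<exists>\<D> \<S>. dyadic_lattice \<D> \<and> \<S> \<subseteq> \<D> \<and> sparse_family (1 / (2 * 3 ^ CARD('n))) \<S> \<and>
          (\<integral>\<^sup>+x. ennreal (norm (commutator T b m f x) * norm (g x)) \<partial>lebesgue)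
          \<le> const_times (C * (\<phi>\<^sub>T \<Lambda> + \<phi>\<^sub>M \<Lambda>))
              ((\<Sum>\<^sub>\<infinity>Q\<in>\<S>. avg p\<^sub>0 Q (\<lambda>x. norm (b x - mean Q b) ^ m * norm (f x))
                   * avg (conj_exponent q\<^sub>0) Q (\<lambda>x. norm (g x))
                   * ennreal (measure lebesgue Q powr (1 + \<alpha> / real CARD('n))))
               + (\<Sum>\<^sub>\<infinity>Q\<in>\<S>. avg p\<^sub>0 Q (\<lambda>x. norm (f x))
                   * avg (conj_exponent q\<^sub>0) Q (\<lambda>x. norm (b x - mean Q b) ^ m * norm (g x))
                   * ennreal (measure lebesgue Q powr (1 + \<alpha> / real CARD('n))))))))"
proof -
  \<comment> \<open>\<open>t\<close> is the level at which both weak bounds are evaluated and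
    becomes \<Lambda>. The leading 3^n in \<open>C\<close> pays for keeping one lattice out of
    3^n.\<close>
  define t A C :: real where "t = 1 / (16 * (real m + 1) * 6 ^ CARD('n))"
    and "A = 8 * (real m + 1) * 18 ^ CARD('n)" and "C = 3 ^ CARD('n) * (4 * 2 ^ m * (5 + A))"
  have A0: "0 \<le> A" by (simp add: A_def)
  have C1: "1 < C"
  proof -
    have "1 * (1 * 5) \<le> 3 ^ CARD('n) * (4 * 2 ^ m * (5 + A))"
    proof (intro mult_mono)
      have "1 * 1 \<le> 4 * (2 :: real) ^ m" by (rule mult_mono) auto
      then show "1 \<le> 4 * (2 :: real) ^ m" by simp
    qed (use A0 in auto)
    then show ?thesis by (simp add: C_def)
  qed
  have t01: "0 < t" "t < 1"
  proof -
    have "1 * 1 \<le> (real m + 1) * 6 ^ CARD('n)" by (intro mult_mono one_le_power) auto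
    moreover have "t = 1 / (16 * ((real m + 1) * 6 ^ CARD('n)))" by (simp only: t_def mult.assoc)
    moreover have "0 < 1 / (16 * x) \<and> 1 / (16 * x) < 1" if "1 * 1 \<le> x" for x :: real using that by simp
    ultimately show "0 < t" "t < 1" by (simp_all only:)
  qed
  have main: "\<exists>\<D> \<S>. dyadic_lattice \<D> \<and> \<S> \<subseteq> \<D> \<and> sparse_family (1 / (2 * 3 ^ CARD('n))) \<S> \<and>
      (\<integral>\<^sup>+x. ennreal (norm (commutator T b m f x) * norm (g x)) \<partial>lebesgue)
      \<le> const_times (C * (\<phi>\<^sub>T t + \<phi>\<^sub>M t))
          ((\<Sum>\<^sub>\<infinity>Q\<in>\<S>. avg p Q (\<lambda>x. norm (b x - mean Q b) ^ m * norm (f x))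
               * avg (conj_exponent q) Q (\<lambda>x. norm (g x))
               * ennreal (measure lebesgue Q powr (1 + \<alpha> / real CARD('n))))
           + (\<Sum>\<^sub>\<infinity>Q\<in>\<S>. avg p Q (\<lambda>x. norm (f x))
               * avg (conj_exponent q) Q (\<lambda>x. norm (b x - mean Q b) ^ m * norm (g x))
               * ennreal (measure lebesgue Q powr (1 + \<alpha> / real CARD('n)))))"
    if p: "1 \<le> p" "ennreal p < q" and \<alpha>: "0 \<le> \<alpha>"
      and T: "sublinear_operator_on (Lp_c p) T"
      and wT: "locally_weak_bounded p \<alpha> (\<lambda>f x. ennreal (norm (T f x))) \<phi>\<^sub>T"
      and wM: "locally_weak_bounded p \<alpha> (sharp_grand_maximal T q) \<phi>\<^sub>M"
      and f: "f \<in> Linf_c" and g: "g \<in> Linf_c" and b: "locally_integrable b"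
    for p :: real and q :: ennreal and \<alpha> :: real
      and T :: "(real ^ 'n \<Rightarrow> 'k) \<Rightarrow> real ^ 'n \<Rightarrow> 'k" and \<phi>\<^sub>T \<phi>\<^sub>M :: "real \<Rightarrow> real"
      and f g b :: "real ^ 'n \<Rightarrow> 'k"
  proof -
    let ?r = "conj_exponent q"
    define f\<^sub>1 where "f\<^sub>1 Q = avg p Q (\<lambda>x. norm (b x - mean Q b) ^ m * norm (f x)) * avg ?r Q (\<lambda>x. norm (g x))
      * ennreal (measure lebesgue Q powr (1 + \<alpha> / real CARD('n)))" for Q
    define f\<^sub>2 where "f\<^sub>2 Q = avg p Q (\<lambda>x. norm (f x)) * avg ?r Q (\<lambda>x. norm (b x - mean Q b) ^ m * norm (g x))
      * ennreal (measure lebesgue Q powr (1 + \<alpha> / real CARD('n)))" for Q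
    have p0: "0 \<le> p" using p by simp
    have bm: "b \<in> borel_measurable lebesgue" by (rule locally_integrable_imp_measurable[OF b])
    have gm: "g \<in> borel_measurable lebesgue" using g by (simp add: Linf_c_def)
    have fL: "f \<in> Lp_c p" by (rule Linf_c_imp_Lp_c[OF f p0])
    have "compact (closure {x. f x \<noteq> 0} \<union> closure {x. g x \<noteq> 0})"
      using f g by (intro compact_Un) (simp_all only: Linf_c_def mem_Collect_eq)
    then obtain h\<^sub>0 where h0: "0 < h\<^sub>0" "closure {x. f x \<noteq> 0} \<union> closure {x. g x \<noteq> 0} \<subseteq> cube 0 h\<^sub>0"
      by (rule compact_subset_cube)
    have supp: "f x = 0 \<and> g x = 0" if "x \<notin> cube 0 h\<^sub>0" for x
      using h0(2) that closure_subset[of "{x. f x \<noteq> 0}"] closure_subset[of "{x. g x \<noteq> 0}"] by blast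
    show ?thesis
    proof (cases "(\<lambda>y. b y ^ m * f y) \<in> Lp_c p")
      case True
      obtain F E where F: "countable F" "\<And>c h. (c, h) \<in> F \<Longrightarrow> \<exists>k z. c = grid_center 0 h\<^sub>0 k z \<and> h = h\<^sub>0 / 2 ^ k"
        "disjoint_family_on E F"
        "\<And>c h. (c, h) \<in> F \<Longrightarrow> E (c, h) \<in> sets lebesgue \<and> E (c, h) \<subseteq> cube c h \<and>
          measure lebesgue (cube c h) \<le> 2 * measure lebesgue (E (c, h))"
        "(\<integral>\<^sup>+x. ennreal (norm (commutator T b m f x) * norm (g x)) \<partial>lebesgue) \<le>
          (\<integral>\<^sup>+(c, h). ennreal (4 * 2 ^ m * (5 + A) * (\<phi>\<^sub>T t + \<phi>\<^sub>M t)) *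
            sparse_term p q \<alpha> m b f g (mean (cube c (3 * h)) b) (cube c (3 * h)) \<partial>count_space F)"
        unfolding A_def t_def
        by (rule sparse_domination_cubes[where m = m and b = b and f = f and g = g and c\<^sub>0 = 0 and h\<^sub>0 = h\<^sub>0,
            OF p \<alpha> T wT wM fL True bm gm h0(1) supp]) blast+
      define P where "P = (\<lambda>(c :: real ^ 'n, h). cube c (3 * h))"
      define J where "J = {j :: int ^ 'n. \<forall>i. j $ i \<in> {0, 1, 2}}"
      \<comment> \<open>The side 6 h of level 0 is that of the tripled initial cube, and the
        lattices differ by multiples of a third of it.\<close>
      define D where "D j = shifted_lattice (\<chi> i. (0 :: real ^ 'n) $ i - h\<^sub>0 + of_int (j $ i) * (2 * h\<^sub>0)) (6 * h\<^sub>0)" for j :: "int ^ 'n"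
      have "\<exists>j. j \<in> J \<and> P x \<in> D j" if "x \<in> F" for x
      proof -
        obtain c h where x: "x = (c, h)" by (cases x)
        obtain k z where "c = grid_center 0 h\<^sub>0 k z" "h = h\<^sub>0 / 2 ^ k" using F(2) \<open>x \<in> F\<close> unfolding x by blast
        then show ?thesis
          using triple_mem_shifted_lattice[OF h0(1), of 0 k z] by (auto simp: J_def D_def P_def x)
      qed
      then obtain \<kappa> where \<kappa>: "\<And>x. x \<in> F \<Longrightarrow> \<kappa> x \<in> J" "\<And>x. x \<in> F \<Longrightarrow> P x \<in> D (\<kappa> x)" by metis
      define c1 where "c1 = 4 * 2 ^ m * (5 + A) * (\<phi>\<^sub>T t + \<phi>\<^sub>M t)"
      have phi: "0 \<le> \<phi>\<^sub>T t" "0 \<le> \<phi>\<^sub>M t"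
        using t01 locally_weak_bounded_nonneg[OF wT, of t] locally_weak_bounded_nonneg[OF wM, of t] by simp_all
      have c1: "0 \<le> c1" using phi A0 by (simp add: c1_def)
      have "finite J" "card J = 3 ^ CARD('n)" unfolding J_def by (rule card_three_vectors)+
      moreover from this have "J \<noteq> {}" by auto
      ultimately obtain j where j: "(\<integral>\<^sup>+x. ennreal c1 * (f\<^sub>1 (P x) + f\<^sub>2 (P x)) \<partial>count_space F)
        \<le> of_nat (3 ^ CARD('n)) * (\<integral>\<^sup>+x. ennreal c1 * (f\<^sub>1 (P x) + f\<^sub>2 (P x)) \<partial>count_space {x \<in> F. \<kappa> x = j})"
        using nn_integral_count_space_pigeonhole[of J F \<kappa> "\<lambda>x. ennreal c1 * (f\<^sub>1 (P x) + f\<^sub>2 (P x))"] \<kappa>(1) by metis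
      define F' where "F' = {x \<in> F. \<kappa> x = j}"
      have F': "countable F'" "F' \<subseteq> F" using F(1) by (auto simp: F'_def)
      have pos: "0 < h" if "(c, h) \<in> F'" for c h
      proof -
        have "(c, h) \<in> F" using that F'(2) by blast
        then obtain k where "h = h\<^sub>0 / 2 ^ k" using F(2) by blast
        then show ?thesis using h0(1) by simp
      qed
      have disj: "disjoint_family_on E F'" using F(3) F'(2) by (rule disjoint_family_on_mono[rotated])
      have sparse: "inj_on P F'" "sparse_family (1 / (2 * 3 ^ CARD('n))) (P ` F')"
      proof -
        have "E (c, h) \<in> sets lebesgue \<and> E (c, h) \<subseteq> cube c h \<and>
          measure lebesgue (cube c h) \<le> 2 * measure lebesgue (E (c, h))" if "(c, h) \<in> F'" for c h
          using F(4) F'(2) that by blast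
        note triples = sparse_family_triples[OF pos disj this]
        show "inj_on P F'" "sparse_family (1 / (2 * 3 ^ CARD('n))) (P ` F')"
          unfolding P_def by (rule triples(1); assumption) (rule triples(2); assumption)
      qed
      have sub: "P ` F' \<subseteq> D j" using \<kappa>(2) by (auto simp: F'_def)
      have lattice: "dyadic_lattice (D j)" unfolding D_def using h0(1) by (intro dyadic_lattice_shifted_lattice) simp
      have "(\<integral>\<^sup>+x. ennreal (norm (commutator T b m f x) * norm (g x)) \<partial>lebesgue) \<le>
        (\<integral>\<^sup>+x. ennreal c1 * (f\<^sub>1 (P x) + f\<^sub>2 (P x)) \<partial>count_space F)"
        using F(5) by (simp only: c1_def f\<^sub>1_def f\<^sub>2_def P_def sparse_term_def case_prod_unfold)
      also note j
      also have "(\<integral>\<^sup>+x. ennreal c1 * (f\<^sub>1 (P x) + f\<^sub>2 (P x)) \<partial>count_space {x \<in> F. \<kappa> x = j}) =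
        ennreal c1 * (\<integral>\<^sup>+x. f\<^sub>1 (P x) + f\<^sub>2 (P x) \<partial>count_space F')"
        unfolding F'_def[symmetric] by (rule nn_integral_cmult) simp
      also have "of_nat (3 ^ CARD('n)) * (ennreal c1 * (\<integral>\<^sup>+x. f\<^sub>1 (P x) + f\<^sub>2 (P x) \<partial>count_space F')) =
        ennreal (C * (\<phi>\<^sub>T t + \<phi>\<^sub>M t)) * (\<integral>\<^sup>+x. f\<^sub>1 (P x) + f\<^sub>2 (P x) \<partial>count_space F')"
      proof -
        have "C * (\<phi>\<^sub>T t + \<phi>\<^sub>M t) = real (3 ^ CARD('n)) * c1" by (simp add: C_def c1_def mult.assoc)
        then have "ennreal (C * (\<phi>\<^sub>T t + \<phi>\<^sub>M t)) = of_nat (3 ^ CARD('n)) * ennreal c1"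
          using c1 by (simp only: ennreal_mult of_nat_0_le_iff ennreal_of_nat_eq_real_of_nat)
        then show ?thesis by (simp only: mult.assoc)
      qed
      also have "\<dots> \<le> ennreal (C * (\<phi>\<^sub>T t + \<phi>\<^sub>M t)) * (infsum f\<^sub>1 (P ` F') + infsum f\<^sub>2 (P ` F'))"
        using infsum_sparse_term[OF F'(1) sparse(1)] by (rule mult_left_mono) simp
      also have "\<dots> \<le> const_times (C * (\<phi>\<^sub>T t + \<phi>\<^sub>M t)) (infsum f\<^sub>1 (P ` F') + infsum f\<^sub>2 (P ` F'))"
        by (rule ennreal_times_le_const_times)
      finally show ?thesis
        using lattice sub sparse(2) unfolding f\<^sub>1_def[abs_def] f\<^sub>2_def[abs_def] by blast
    next
      \<comment> \<open>Here nothing is known about \<open>T\<close> on (b(x) - b)^m f, so the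
        estimate has to hold because its right-hand side is infinite or g vanishes almost
        everywhere.\<close>
      case False
      obtain a L where aL: "0 < L" "cube 0 h\<^sub>0 \<in> shifted_lattice (a :: real ^ 'n) L"
        using cube_mem_shifted_lattice[OF h0(1)] by blast
      let ?Q = "cube (0 :: real ^ 'n) h\<^sub>0"
      have sparse: "sparse_family (1 / (2 * 3 ^ CARD('n))) {?Q}"
      proof -
        have "1 / (2 * x) < 1" if "1 \<le> x" for x :: real using that by simp
        note less = this
        have l: "1 / (2 * 3 ^ CARD('n)) < (1 :: real)" by (rule less) simp
        moreover have "1 / (2 * 3 ^ CARD('n)) * measure lebesgue ?Q \<le> 1 * measure lebesgue ?Q"
          using l by (intro mult_right_mono) auto
        moreover have "is_cube ?Q" using h0(1) by (auto simp: is_cube_def)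
        ultimately show ?thesis
          unfolding sparse_family_def by (intro conjI exI[of _ "\<lambda>_. ?Q"]) (auto simp: disjoint_family_on_def)
      qed
      have "(\<integral>\<^sup>+x. ennreal (norm (commutator T b m f x) * norm (g x)) \<partial>lebesgue) \<le>
        const_times (C * (\<phi>\<^sub>T t + \<phi>\<^sub>M t)) (infsum f\<^sub>1 {?Q} + infsum f\<^sub>2 {?Q})"
      proof (cases "avg ?r ?Q (\<lambda>x. norm (g x)) = 0")
        \<comment> \<open>The infinite average of |b - c|^m f comes with the average of g as a
          factor. If that is 0, the left-hand side is 0 too.\<close>
        case True
        have r: "0 < ?r"
          using conj_exponent_ge_1[of q] order_le_less_trans[OF ennreal_leI[OF p(1)] p(2)] by simp
        have "(\<lambda>x. norm (g x)) \<in> borel_measurable lebesgue" using gm by measurable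
        from True[unfolded avg_eq_0_iff[OF r h0(1) this]]
        have "AE x in lebesgue. g x = 0"
          by (rule eventually_mono) (use supp in auto)
        then have "AE x in lebesgue. ennreal (norm (commutator T b m f x) * norm (g x)) \<le> 0"
          by (rule eventually_mono) simp
        then have "(\<integral>\<^sup>+x. ennreal (norm (commutator T b m f x) * norm (g x)) \<partial>lebesgue) \<le> (\<integral>\<^sup>+x. 0 \<partial>(lebesgue :: (real ^ 'n) measure))"
          by (rule nn_integral_mono_AE)
        then show ?thesis by simp
      next
        case nonzero: False
        have "avg p ?Q (\<lambda>x. norm (b x - mean ?Q b) ^ m * norm (f x)) = \<infinity>"
          using supp by (intro infinite_average[OF p(1) fL False bm h0(1)]) blast
        moreover have "measure lebesgue ?Q powr (1 + \<alpha> / real CARD('n)) > 0"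
          using h0(1) by (simp add: measure_cube)
        ultimately have "f\<^sub>1 ?Q = \<infinity>"
          using nonzero by (simp add: f\<^sub>1_def ennreal_mult_eq_top_iff ennreal_top_mult)
        then have "infsum f\<^sub>1 {?Q} + infsum f\<^sub>2 {?Q} = \<infinity>" by (simp add: infsum_finite)
        \<comment> \<open>\<open>const_times\<close> stays infinite even if both \<phi> vanish at
          \<open>t\<close>.\<close>
        then show ?thesis by (simp add: const_times_def)
      qed
      then show ?thesis
        using dyadic_lattice_shifted_lattice[OF aL(1), of a] aL(2) sparse
        unfolding f\<^sub>1_def[abs_def] f\<^sub>2_def[abs_def]
        by (intro exI[of _ "shifted_lattice a L"] exI[of _ "{?Q}"] conjI) auto
    qed
  qed
  show ?thesis
    by (intro exI[of _ C] exI[of _ t] conjI allI impI C1 t01) (rule main)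
qed

end
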